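(* Let $n\ge 1$, let $b_1,\dots,b_n\in[-1,1]$ and let $X$ be a centered Gaussian random vector in $\mathbb{R}^{2n}$ whose covariance matrix is the block diagonal matrix $\mathrm{diag}(A_1,A_2,\dots,A_n)\in\mathcal{M}_{2n}(\mathbb{R})$, where $A_i=\begin{pmatrix}1&b_i\\ b_i&1\end{pmatrix}$. Let $S$ be a centered Gaussian random vector in $\mathbb{R}^{2n}$ with covariance $\mathbb{E}[S_i^2]=1$ for all $i\in\{1,\dots,2n\}$ and $\mathbb{E}[S_iS_j]=-\frac{1}{2n-1}$ for all $i\ne j$. Then, for all $\beta>0$, $$\mathbb{E}\left[\left(\mathrm{P}_{H_X^\perp}(f_\beta(X))+\frac1\beta\right)^2\right]\le \mathbb{E}\left[\left(\mathrm{P}_{H_S^\perp}(f_\beta(S))+\frac1\beta\right)^2\right],$$ and in particular $$\mathbb{E}\left[\left(\mathrm{P}_{H_X^\perp}\Big(\max_{1\le i\le 2n}X_i\Big)\right)^2\right]\le \mathbb{E}\left[\left(\mathrm{P}_{H_S^\perp}\Big(\max_{1\le i\le 2n}S_i\Big)\right)^2\right].$$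
   Context: For $\beta>0$, $f_\beta:\mathbb{R}^{2n}\to\mathbb{R}$ is $f_\beta(x)=\frac1\beta\log\left(\sum_{k=1}^{2n} e^{\beta x_k}\right)$. For a centered Gaussian random vector $X=(X_1,\dots,X_{2n})$, $H_X=\mathrm{span}(X_1,\dots,X_{2n})\subset L^2(\Omega,\mathbb{P})$, where $(\Omega,\mathbb{P})$ is the underlying probability space, and $\mathrm{P}_{H_X^\perp}$ is the orthogonal projection of $L^2(\Omega,\mathbb{P})$ onto the orthogonal complement $H_X^\perp$ of $H_X$; similarly for $S$. *)

theory Defs
  imports "HOL-Probability.Probability" "Jordan_Normal_Form.Matrix"
begin

text \<open>
  A random vector in dimension \<open>d\<close> is a family \<open>X\<close> of real functions on the sample space; only the
  components \<open>X i\<close> with \<open>i < d\<close> are relevant. Indices start at 0.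
\<close>

text \<open>The case \<open>\<sigma> = 0\<close> is the Dirac mass at 0; it is needed since covariance matrices may be singular.\<close>

definition centered_normal_measure :: "real \<Rightarrow> real measure" where
  "centered_normal_measure \<sigma> =
     (if \<sigma> = 0 then return borel 0 else density lborel (\<lambda>x. ennreal (normal_density 0 \<sigma> x)))"

definition centered_gaussian_vector :: "'a measure \<Rightarrow> nat \<Rightarrow> (nat \<Rightarrow> 'a \<Rightarrow> real) \<Rightarrow> bool" where
  "centered_gaussian_vector M d X \<longleftrightarrow>
     (\<forall>i<d. X i \<in> borel_measurable M) \<and>
     (\<forall>a :: nat \<Rightarrow> real. \<exists>\<sigma>\<ge>0. distr M borel (\<lambda>\<omega>. \<Sum>i<d. a i * X i \<omega>) = centered_normal_measure \<sigma>)"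

definition covariance_matrix :: "'a measure \<Rightarrow> nat \<Rightarrow> (nat \<Rightarrow> 'a \<Rightarrow> real) \<Rightarrow> real mat" where
  "covariance_matrix M d X =
     mat d d (\<lambda>(i, j). \<integral>\<omega>. (X i \<omega> - (\<integral>\<omega>'. X i \<omega>' \<partial>M)) * (X j \<omega> - (\<integral>\<omega>'. X j \<omega>' \<partial>M)) \<partial>M)"

text \<open>
  Elements of \<open>L\<^sup>2\<close> are represented by square-integrable functions. Identities in \<open>L\<^sup>2\<close> hold almost
  everywhere, and a projection is a representative of its class. Integrals do not depend on the choice
  of representatives.
\<close>

definition L2 :: "'a measure \<Rightarrow> ('a \<Rightarrow> real) set" where
  "L2 M = {f \<in> borel_measurable M. integrable M (\<lambda>\<omega>. (f \<omega>)\<^sup>2)}"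

definition L2_complement :: "'a measure \<Rightarrow> ('a \<Rightarrow> real) set \<Rightarrow> ('a \<Rightarrow> real) set" where
  "L2_complement M K = {g \<in> L2 M. \<forall>h\<in>K. (\<integral>\<omega>. g \<omega> * h \<omega> \<partial>M) = 0}"

text \<open>The orthogonal projection of \<open>F\<close> onto a closed subspace \<open>K\<close> of \<open>L\<^sup>2\<close>, for \<open>F\<close> in \<open>L\<^sup>2\<close>; it is
  unique up to a null set.\<close>

definition L2_proj :: "'a measure \<Rightarrow> ('a \<Rightarrow> real) set \<Rightarrow> ('a \<Rightarrow> real) \<Rightarrow> 'a \<Rightarrow> real" where
  "L2_proj M K F = (SOME G. G \<in> K \<and> (\<lambda>\<omega>. F \<omega> - G \<omega>) \<in> L2_complement M K)"

definition gaussian_span :: "nat \<Rightarrow> (nat \<Rightarrow> 'a \<Rightarrow> real) \<Rightarrow> ('a \<Rightarrow> real) set" where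
  "gaussian_span d X = {\<lambda>\<omega>. \<Sum>i<d. a i * X i \<omega> | a. True}"

definition soft_max :: "nat \<Rightarrow> real \<Rightarrow> (nat \<Rightarrow> real) \<Rightarrow> real" where
  "soft_max d \<beta> x = (1 / \<beta>) * ln (\<Sum>k<d. exp (\<beta> * x k))"

definition corr_block :: "real \<Rightarrow> real mat" where
  "corr_block b = mat_of_rows_list 2 [[1, b], [b, 1]]"

end

theory Submission
  imports Defs "HOL-Real_Asymp.Real_Asymp"
begin

text \<open>
  Write \<open>d = 2n\<close> and let \<open>q\<close> be the gradient of the soft maximum \<open>f\<close>, a vector of positive weights
  with sum 1. Since \<open>1/\<beta>\<close> is orthogonal to the span of \<open>X\<close>, the left-hand side is the minimum over \<open>a\<close>
  of \<open>E (f(X) - a \<bullet> X + 1/\<beta>)\<^sup>2\<close>, and by Gaussian integration by parts the minimum is attained at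
  \<open>a = E q(X)\<close>. For \<open>k \<noteq> l\<close> the mixed second derivative of \<open>(f - a \<bullet> x + 1/\<beta>)\<^sup>2\<close> is
  \<open>-2\<beta> (f - a \<bullet> x) q\<^sub>k q\<^sub>l - 2 a\<^sub>k q\<^sub>l - 2 a\<^sub>l q\<^sub>k + 2 a\<^sub>k a\<^sub>l\<close>, with \<open>f - a \<bullet> x \<ge> 0\<close> whenever \<open>a\<close> is a
  vector of nonnegative weights with sum 1. Along the path of laws of \<open>cos \<theta> X + sin \<theta> Y\<close> the
  derivative of an expectation is the pairing of these second derivatives with the difference of the
  covariances.

  Stage one replaces the correlations \<open>b\<^sub>i\<close> by \<open>-1\<close>, one pair at a time. With \<open>a = E q\<close> taken at the
  end of the path, monotonicity reduces to \<open>2 E q\<^sub>u \<ge> a\<^sub>u\<close> on the path, which follows by comparing with the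
  weight of \<open>u\<close> in the vector without its partner. Stage two goes from the vector of antithetic pairs to
  \<open>S\<close>, with \<open>a = 1/d\<close>: the linear terms cancel, and what remains is the positivity of
  \<open>E (f - a \<bullet> x) (q\<^sub>u - q\<^sub>w\<^sub>') (q\<^sub>w - q\<^sub>u\<^sub>')\<close> for two pairs \<open>(u, u')\<close>, \<open>(w, w')\<close>. This integrand is odd under the
  exchange of \<open>u'\<close> and \<open>w\<close>, which swaps two eigenvectors of the covariance, and it is nonnegative where
  the component along the eigenvector of larger variance is the larger one. At \<open>S\<close> the soft maximum is
  already orthogonal to the span, because the components of \<open>S\<close> are exchangeable and sum to 0.

  For the maximum, \<open>0 \<le> max x - a \<bullet> x \<le> f - a \<bullet> x + 1/\<beta>\<close> and \<open>f \<le> max x + ln d / \<beta>\<close> with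
  \<open>\<beta> \<rightarrow> \<infinity>\<close>.
\<close>

section \<open>Uniqueness of finite-dimensional laws\<close>

text \<open>The shift 1/\<beta> is dictated by the second derivatives: for k \<noteq> l the product
  of the two gradients contributes 2 q_k q_l, and 2/\<beta> times the mixed derivative -\<beta> q_k
  q_l of f removes exactly this term. What is left of the quadratic part carries the factor f - a.x,
  which has a sign. The optimal weights vary along a path of laws. Differentiating them is avoided
  by freezing a at the value chosen for the end of the path: at the start a frozen a can only
  overestimate the minimum, which is the harmless direction. The price is that a need not be optimal
  inside the path, so the terms linear in q do not vanish by themselves; the comparison with the
  vector without the partner (stage one) and vanishing row sums (stage two) take care of them. Laws
  are therefore handled through characteristic functions, and a one-dimensional normal component is
  split off wherever a density is required.\<close>

text \<open>The characteristic function determines a measure with a density; the joint law of several variables is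
  recovered one variable at a time, the other ones being absorbed into the weight.\<close>

lemma weighted_law_unique:
  fixes w T :: "'a \<Rightarrow> real" and w' T' :: "'b \<Rightarrow> real"
  assumes w: "integrable M w" "\<And>x. 0 \<le> w x" and T[measurable]: "T \<in> borel_measurable M"
    and w': "integrable M' w'" "\<And>x. 0 \<le> w' x" and T'[measurable]: "T' \<in> borel_measurable M'"
    and eq: "\<And>s. (CLINT x|M. w x *\<^sub>R iexp (s * T x)) = (CLINT x|M'. w' x *\<^sub>R iexp (s * T' x))"
    and A[measurable]: "A \<in> sets borel"
  shows "(\<integral>x. w x * indicator A (T x) \<partial>M) = (\<integral>x. w' x * indicator A (T' x) \<partial>M')"
proof -
  have [measurable]: "w \<in> borel_measurable M" "w' \<in> borel_measurable M'"
    using w w' by auto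
  define c where "c = (\<integral>x. w x \<partial>M)"
  have c': "c = (\<integral>x. w' x \<partial>M')"
  proof -
    have "complex_of_real (\<integral>x. w x \<partial>M) = complex_of_real (\<integral>x. w' x \<partial>M')"
      using eq[of 0] by (simp add: scaleR_conv_of_real)
    then show ?thesis unfolding c_def by (simp only: of_real_eq_iff)
  qed
  have "c \<ge> 0" unfolding c_def using w by (intro Bochner_Integration.integral_nonneg) auto
  show ?thesis
  proof (cases "c = 0")
    case True
    have "AE x in M. w x = 0"
      using True w integral_nonneg_eq_0_iff_AE[of M w] by (auto simp: c_def)
    moreover have "AE x in M'. w' x = 0"
      using True w' integral_nonneg_eq_0_iff_AE[of M' w'] by (auto simp: c')
    ultimately have "(\<integral>x. w x * indicator A (T x) \<partial>M) = (\<integral>x. 0 \<partial>M)"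
        "(\<integral>x. w' x * indicator A (T' x) \<partial>M') = (\<integral>x. 0 \<partial>M')"
      by (intro integral_cong_AE; force)+
    then show ?thesis by simp
  next
    case False
    with \<open>c \<ge> 0\<close> have c: "c > 0" by simp
    have *: "real_distribution (distr (density N (\<lambda>x. ennreal (v x / c))) borel U)
        \<and> (\<forall>t. char (distr (density N (\<lambda>x. ennreal (v x / c))) borel U) t
               = (CLINT x|N. v x *\<^sub>R iexp (t * U x)) / c)
        \<and> measure (distr (density N (\<lambda>x. ennreal (v x / c))) borel U) A
             = (\<integral>x. v x * indicator A (U x) \<partial>N) / c"
      if v: "integrable N v" "\<And>x. 0 \<le> v x" "(\<integral>x. v x \<partial>N) = c" and U[measurable]: "U \<in> borel_measurable N"
      for N :: "'c measure" and v U
    proof (intro conjI allI)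
      have [measurable]: "v \<in> borel_measurable N" using v by auto
      let ?D = "density N (\<lambda>x. ennreal (v x / c))"
      have nn: "AE x in N. 0 \<le> v x / c" using v c by auto
      have "emeasure ?D (space ?D) = (\<integral>\<^sup>+x. ennreal (v x / c) \<partial>N)"
        by (subst emeasure_density) (auto intro!: nn_integral_cong)
      also have "\<dots> = ennreal (\<integral>x. v x / c \<partial>N)"
        using v c by (intro nn_integral_eq_integral) auto
      also have "\<dots> = 1" using v c by simp
      finally have pD: "prob_space ?D" by (rule prob_spaceI)
      interpret D: prob_space ?D by (rule pD)
      show rd: "real_distribution (distr ?D borel U)"
        by (rule D.real_distribution_distr) simp
      show "char (distr ?D borel U) t = (CLINT x|N. v x *\<^sub>R iexp (t * U x)) / c" for t
      proof -
        have "char (distr ?D borel U) t = (CLINT x|?D. iexp (t * U x))"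
          unfolding char_def by (subst integral_distr) auto
        also have "\<dots> = (CLINT x|N. (v x / c) *\<^sub>R iexp (t * U x))"
          by (subst integral_density) (use nn in auto)
        also have "\<dots> = (CLINT x|N. (v x *\<^sub>R iexp (t * U x)) / c)"
          by (simp add: scaleR_conv_of_real)
        finally show ?thesis by simp
      qed
      have "measure (distr ?D borel U) A = (\<integral>x. indicator A x \<partial>(distr ?D borel U))"
        by simp
      also have "\<dots> = (\<integral>x. indicator A (U x) \<partial>?D)"
        by (subst integral_distr) auto
      also have "\<dots> = (\<integral>x. (v x / c) *\<^sub>R indicator A (U x) \<partial>N)"
        by (subst integral_density) (use nn in auto)
      also have "\<dots> = (\<integral>x. (v x * indicator A (U x)) / c \<partial>N)" by simp
      finally show "measure (distr ?D borel U) A = (\<integral>x. v x * indicator A (U x) \<partial>N) / c" by simp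
    qed
    note a = *[OF w(1,2) c_def[symmetric] T] and b = *[OF w'(1,2) c'[symmetric] T']
    have "distr (density M (\<lambda>x. ennreal (w x / c))) borel T = distr (density M' (\<lambda>x. ennreal (w' x / c))) borel T'"
      by (rule Levy_uniqueness) (use a b eq in \<open>auto simp: fun_eq_iff\<close>)
    then show ?thesis using a b c by (auto simp: divide_simps)
  qed
qed

text \<open>Uniqueness from transforms needs nonnegative weights, whereas \<open>V * iexp S\<close>
  is complex. Tilting \<open>V\<close> by the positive factor \<open>2 + cos (S + p)\<close> gives
  admissible weights whose transforms are combinations of joint transforms of \<open>S\<close> and
  \<open>T\<close>; the phases 0 and -pi/2 recover the real and the imaginary part.\<close>

lemma
  fixes V S T :: "'a \<Rightarrow> real"
  assumes M: "prob_space M"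
    and [measurable]: "V \<in> borel_measurable M" "S \<in> borel_measurable M" "T \<in> borel_measurable M" "A \<in> sets borel"
    and V: "\<And>x. 0 \<le> V x" "\<And>x. V x \<le> 1"
  shows tilted_weight_integrable: "integrable M (\<lambda>x. V x * (2 + cos (S x + p)))"
    and tilted_weight_char: "(CLINT x|M. (V x * (2 + cos (S x + p))) *\<^sub>R iexp (s * T x)) =
      2 * (CLINT x|M. V x *\<^sub>R iexp (0 * S x + s * T x)) + iexp p / 2 * (CLINT x|M. V x *\<^sub>R iexp (1 * S x + s * T x))
      + iexp (- p) / 2 * (CLINT x|M. V x *\<^sub>R iexp ((-1) * S x + s * T x))"
    and tilted_weight_integral: "(\<integral>x. V x * (2 + cos (S x + p)) * indicator A (T x) \<partial>M) =
      2 * (\<integral>x. V x * indicator A (T x) \<partial>M) + (\<integral>x. V x * cos (S x + p) * indicator A (T x) \<partial>M)"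
    and iexp_weight_integral: "(CLINT x|M. (V x * indicator A (T x)) *\<^sub>R iexp (S x)) =
      complex_of_real (\<integral>x. V x * cos (S x + 0) * indicator A (T x) \<partial>M)
      + \<i> * complex_of_real (\<integral>x. V x * cos (S x + - pi / 2) * indicator A (T x) \<partial>M)"
proof -
  interpret prob_space M by fact
  have cx: "integrable M (\<lambda>x. V x *\<^sub>R iexp (f x))" if [measurable]: "f \<in> borel_measurable M" for f
    by (rule integrable_const_bound[of _ 1]) (use V in auto)
  have mult1: "\<bar>a * b\<bar> \<le> c" if "0 \<le> a" "a \<le> 1" "\<bar>b\<bar> \<le> c" for a b c :: real
    using mult_mono[of a 1 "\<bar>b\<bar>" c] that by (simp add: abs_mult)
  have re: "integrable M (\<lambda>x. V x * f x)" if [measurable]: "f \<in> borel_measurable M" and "\<And>x. \<bar>f x\<bar> \<le> 3" for f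
    by (rule integrable_const_bound[of _ 3]) (use V that in \<open>auto intro!: mult1\<close>)
  have "\<bar>2 + cos u\<bar> \<le> 3" for u :: real
    using cos_ge_minus_one[of u] cos_le_one[of u] by linarith
  then show "integrable M (\<lambda>x. V x * (2 + cos (S x + p)))" by (intro re) auto
  have cos: "complex_of_real (cos (u + p)) * iexp t = (iexp p * iexp (u + t) + iexp (- p) * iexp (- u + t)) / 2" for u t :: real
    by (simp add: complex_eq_iff Re_exp Im_exp cos_add sin_add cos_diff sin_diff field_simps)
  have "(v * (2 + cos (u + p))) *\<^sub>R iexp t = 2 * (v *\<^sub>R iexp (0 * u + t))
      + iexp p / 2 * (v *\<^sub>R iexp (1 * u + t)) + iexp (- p) / 2 * (v *\<^sub>R iexp ((-1) * u + t))" for v u t :: real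
  proof -
    have alg: "w * (2 + c) * e = 2 * (w * e) + P / 2 * (w * a) + Q / 2 * (w * b)" if "c * e = (P * a + Q * b) / 2"
      for w c e P Q a b :: complex
    proof -
      have "w * (2 + c) * e = 2 * (w * e) + w * (c * e)" by (simp add: algebra_simps)
      then show ?thesis unfolding that by (simp add: field_simps)
    qed
    from alg[OF cos[of u t], of "complex_of_real v"] show ?thesis
      by (simp only: scaleR_conv_of_real of_real_mult of_real_add of_real_numeral mult_zero_left add_0_left mult_1 mult_minus1)
  qed
  then show "(CLINT x|M. (V x * (2 + cos (S x + p))) *\<^sub>R iexp (s * T x)) =
      2 * (CLINT x|M. V x *\<^sub>R iexp (0 * S x + s * T x)) + iexp p / 2 * (CLINT x|M. V x *\<^sub>R iexp (1 * S x + s * T x))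
      + iexp (- p) / 2 * (CLINT x|M. V x *\<^sub>R iexp ((-1) * S x + s * T x))"
  proof (simp only:)
    have "(CLINT x|M. a * F x + b * G x + c * H x) = a * integral\<^sup>L M F + b * integral\<^sup>L M G + c * integral\<^sup>L M H"
      if "integrable M F" "integrable M G" "integrable M H" for a b c :: complex and F G H
      using that by simp
    then show "(CLINT x|M. 2 * (V x *\<^sub>R iexp (0 * S x + s * T x)) + iexp p / 2 * (V x *\<^sub>R iexp (1 * S x + s * T x))
        + iexp (- p) / 2 * (V x *\<^sub>R iexp ((-1) * S x + s * T x))) =
      2 * (CLINT x|M. V x *\<^sub>R iexp (0 * S x + s * T x)) + iexp p / 2 * (CLINT x|M. V x *\<^sub>R iexp (1 * S x + s * T x))
      + iexp (- p) / 2 * (CLINT x|M. V x *\<^sub>R iexp ((-1) * S x + s * T x))"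
      by this (intro cx; measurable)+
  qed
  have ind: "\<bar>indicator A y\<bar> \<le> (3::real)" "\<bar>cos z * indicator A y\<bar> \<le> (3::real)" for y z :: real
    using cos_ge_minus_one[of z] cos_le_one[of z] by (simp_all add: indicator_def abs_le_iff, linarith)
  have i0: "integrable M (\<lambda>x. V x * indicator A (T x))" by (rule re) (use ind in simp_all)
  have i1: "integrable M (\<lambda>x. V x * cos (S x + q) * indicator A (T x))" for q
    unfolding mult.assoc by (rule re) (use ind in simp_all)
  show "(\<integral>x. V x * (2 + cos (S x + p)) * indicator A (T x) \<partial>M) =
      2 * (\<integral>x. V x * indicator A (T x) \<partial>M) + (\<integral>x. V x * cos (S x + p) * indicator A (T x) \<partial>M)"
    using i0 i1[of p] by (simp add: distrib_left distrib_right mult.assoc mult.left_commute[of _ 2])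
  have "(v * z) *\<^sub>R iexp u = complex_of_real (v * cos (u + 0) * z) + \<i> * complex_of_real (v * cos (u + - pi / 2) * z)" for v u z :: real
    by (simp add: complex_eq_iff Re_exp Im_exp cos_diff)
  then show "(CLINT x|M. (V x * indicator A (T x)) *\<^sub>R iexp (S x)) =
      complex_of_real (\<integral>x. V x * cos (S x + 0) * indicator A (T x) \<partial>M)
      + \<i> * complex_of_real (\<integral>x. V x * cos (S x + - pi / 2) * indicator A (T x) \<partial>M)"
    using i1[of 0] i1[of "- pi / 2"] by (simp only:) (simp del: of_real_mult add_0_right)
qed

text \<open>Trades the Fourier variable of \<open>T\<close> for the indicator of a Borel set while
  \<open>S\<close> stays in the exponent. This is the induction step for joint laws: indicators
  already obtained sit in \<open>V\<close>, variables still to be treated in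
  \<open>S\<close>.\<close>

lemma complex_weighted_law_unique:
  fixes V S T :: "'a \<Rightarrow> real" and V' S' T' :: "'b \<Rightarrow> real"
  assumes M: "prob_space M" and N: "prob_space N"
    and m: "V \<in> borel_measurable M" "S \<in> borel_measurable M" "T \<in> borel_measurable M"
    and m': "V' \<in> borel_measurable N" "S' \<in> borel_measurable N" "T' \<in> borel_measurable N"
    and V: "\<And>x. 0 \<le> V x" "\<And>x. V x \<le> 1" and V': "\<And>x. 0 \<le> V' x" "\<And>x. V' x \<le> 1"
    and eq: "\<And>r s. (CLINT x|M. V x *\<^sub>R iexp (r * S x + s * T x)) = (CLINT x|N. V' x *\<^sub>R iexp (r * S' x + s * T' x))"
    and A: "A \<in> sets borel"
  shows "(CLINT x|M. (V x * indicator A (T x)) *\<^sub>R iexp (S x))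
       = (CLINT x|N. (V' x * indicator A (T' x)) *\<^sub>R iexp (S' x))"
proof -
  interpret M: prob_space M by fact
  interpret N: prob_space N by fact
  note [measurable] = m m'
  have nn: "0 \<le> 2 + cos u" for u :: real using cos_ge_minus_one[of u] by linarith
  have int: "integrable M V" "integrable N V'"
    by (rule M.integrable_const_bound[of _ 1] N.integrable_const_bound[of _ 1]; use V V' in simp)+
  have i0: "(\<integral>x. V x * indicator A (T x) \<partial>M) = (\<integral>x. V' x * indicator A (T' x) \<partial>N)"
    by (rule weighted_law_unique) (use V V' A eq[of 0] int in simp_all)
  have "(\<integral>x. V x * (2 + cos (S x + p)) * indicator A (T x) \<partial>M) = (\<integral>x. V' x * (2 + cos (S' x + p)) * indicator A (T' x) \<partial>N)" for p
  proof (rule weighted_law_unique)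
    show "(CLINT x|M. (V x * (2 + cos (S x + p))) *\<^sub>R iexp (s * T x)) = (CLINT x|N. (V' x * (2 + cos (S' x + p))) *\<^sub>R iexp (s * T' x))" for s
      unfolding tilted_weight_char[OF M m A V] tilted_weight_char[OF N m' A V'] eq ..
  qed (use V V' A nn in \<open>simp_all add: tilted_weight_integrable[OF M m A] tilted_weight_integrable[OF N m' A]\<close>)
  then have "(\<integral>x. V x * cos (S x + p) * indicator A (T x) \<partial>M) = (\<integral>x. V' x * cos (S' x + p) * indicator A (T' x) \<partial>N)" for p
    unfolding tilted_weight_integral[OF M m A V] tilted_weight_integral[OF N m' A V'] i0 by simp
  then show ?thesis unfolding iexp_weight_integral[OF M m A V] iexp_weight_integral[OF N m' A V'] by (simp only:)
qed

lemma finite_dim_law_unique: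
  fixes X :: "nat \<Rightarrow> 'a \<Rightarrow> real" and Y :: "nat \<Rightarrow> 'b \<Rightarrow> real"
  assumes M: "prob_space M" and N: "prob_space N"
    and X[measurable]: "\<And>k. k < d \<Longrightarrow> X k \<in> borel_measurable M"
    and Y[measurable]: "\<And>k. k < d \<Longrightarrow> Y k \<in> borel_measurable N"
    and eq: "\<And>a :: nat \<Rightarrow> real. (CLINT x|M. iexp (\<Sum>k<d. a k * X k x)) = (CLINT x|N. iexp (\<Sum>k<d. a k * Y k x))"
  shows "distr M (Pi\<^sub>M {..<d} (\<lambda>_. borel)) (\<lambda>x. \<lambda>k\<in>{..<d}. X k x)
       = distr N (Pi\<^sub>M {..<d} (\<lambda>_. borel)) (\<lambda>x. \<lambda>k\<in>{..<d}. Y k x)"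
proof -
  interpret M: prob_space M by fact
  interpret N: prob_space N by fact
  \<comment> \<open>Hybrid of the two descriptions of a law: the first \<open>k\<close> variables
    enter through indicators, the others through the exponent. The case \<open>k = 0\<close> is the
    hypothesis, and \<open>k = d\<close> evaluates rectangles.\<close>
  have step: "(CLINT x|M. (\<Prod>j<k. indicator (A j) (X j x)) *\<^sub>R iexp (\<Sum>j\<in>{k..<d}. a j * X j x))
      = (CLINT x|N. (\<Prod>j<k. indicator (A j) (Y j x)) *\<^sub>R iexp (\<Sum>j\<in>{k..<d}. a j * Y j x))"
    if "k \<le> d" "\<And>j. A j \<in> sets borel" for k A and a :: "nat \<Rightarrow> real"
    using that
  proof (induction k arbitrary: a)
    case 0
    then show ?case using eq[of a] by (simp add: lessThan_atLeast0)
  next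
    case (Suc k)
    note [measurable] = Suc.prems(2)
    have "k < d" using Suc.prems by simp
    then have e: "{k..<d} = insert k {Suc k..<d}" by auto
    have "(CLINT x|M. ((\<Prod>j<k. indicator (A j) (X j x)) * indicator (A k) (X k x)) *\<^sub>R iexp (\<Sum>j\<in>{Suc k..<d}. a j * X j x))
      = (CLINT x|N. ((\<Prod>j<k. indicator (A j) (Y j x)) * indicator (A k) (Y k x)) *\<^sub>R iexp (\<Sum>j\<in>{Suc k..<d}. a j * Y j x))"
    proof (rule complex_weighted_law_unique[OF M N])
      \<comment> \<open>The induction hypothesis is used at new frequencies: \<open>s\<close> on
        variable \<open>k\<close> and the scaled \<open>r * a j\<close> on the later ones.\<close>
      fix r s
      have "(\<Sum>j\<in>{k..<d}. (if j = k then s else r * a j) * Z j) = r * (\<Sum>j\<in>{Suc k..<d}. a j * Z j) + s * Z k"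
        for Z :: "nat \<Rightarrow> real"
        unfolding e by (simp add: sum_distrib_left mult.assoc)
      then show "(CLINT x|M. (\<Prod>j<k. indicator (A j) (X j x)) *\<^sub>R iexp (r * (\<Sum>j\<in>{Suc k..<d}. a j * X j x) + s * X k x))
         = (CLINT x|N. (\<Prod>j<k. indicator (A j) (Y j x)) *\<^sub>R iexp (r * (\<Sum>j\<in>{Suc k..<d}. a j * Y j x) + s * Y k x))"
        using Suc.IH[of "\<lambda>j. if j = k then s else r * a j"] Suc.prems by simp
    qed (use \<open>k < d\<close> X Y Suc.prems in \<open>auto intro!: borel_measurable_sum borel_measurable_prod prod_nonneg prod_le_1 borel_measurable_times simp: indicator_def\<close>)
    then show ?case by (simp add: mult.commute)
  qed
  have meas: "(\<lambda>x. \<lambda>k\<in>{..<d}. Z k x) \<in> L \<rightarrow>\<^sub>M Pi\<^sub>M {..<d} (\<lambda>_. borel)"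
    if "\<And>k. k < d \<Longrightarrow> Z k \<in> borel_measurable L" for L :: "'c measure" and Z :: "nat \<Rightarrow> 'c \<Rightarrow> real"
    using that by (intro measurable_restrict) auto
  have pr: "(\<Prod>j<d. indicator (A j) (Z j)) = (indicator (Pi\<^sub>E {..<d} A) (\<lambda>k\<in>{..<d}. Z k) :: real)" for A and Z :: "nat \<Rightarrow> real"
  proof (cases "\<forall>j<d. Z j \<in> A j")
    case True then show ?thesis by (simp add: indicator_def PiE_iff)
  next
    case False
    then obtain j where "j < d" "Z j \<notin> A j" by auto
    then have "(\<Prod>j<d. indicator (A j) (Z j)) = (0::real)" by (intro prod_zero) (auto intro!: bexI[of _ j])
    then show ?thesis using \<open>j < d\<close> \<open>Z j \<notin> A j\<close> by (auto simp: indicator_def PiE_iff)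
  qed
  have cl: "(CLINT x|L. (\<Prod>j<d. indicator (A j) (Z j x)) *\<^sub>R (1::complex)) =
      complex_of_real (measure (distr L (Pi\<^sub>M {..<d} (\<lambda>_. borel)) (\<lambda>x. \<lambda>k\<in>{..<d}. Z k x)) (Pi\<^sub>E {..<d} A))"
    if Z: "\<And>k. k < d \<Longrightarrow> Z k \<in> borel_measurable L" and A: "\<And>j. A j \<in> sets borel"
    for L :: "'c measure" and Z :: "nat \<Rightarrow> 'c \<Rightarrow> real" and A
  proof -
    have B: "Pi\<^sub>E {..<d} A \<in> sets (Pi\<^sub>M {..<d} (\<lambda>_. borel))" using A by (intro sets_PiM_I_finite) auto
    have "measure (distr L (Pi\<^sub>M {..<d} (\<lambda>_. borel)) (\<lambda>x. \<lambda>k\<in>{..<d}. Z k x)) (Pi\<^sub>E {..<d} A)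
        = (\<integral>z. indicator (Pi\<^sub>E {..<d} A) z \<partial>distr L (Pi\<^sub>M {..<d} (\<lambda>_. borel)) (\<lambda>x. \<lambda>k\<in>{..<d}. Z k x))"
      using B by simp
    also have "\<dots> = (\<integral>x. indicator (Pi\<^sub>E {..<d} A) (\<lambda>k\<in>{..<d}. Z k x) \<partial>L)"
      using B by (intro integral_distr meas Z) auto
    finally show ?thesis unfolding pr scaleR_conv_of_real by (simp del: of_real_indicator)
  qed
  interpret P: prob_space "distr M (Pi\<^sub>M {..<d} (\<lambda>_. borel)) (\<lambda>x. \<lambda>k\<in>{..<d}. X k x)"
    by (intro M.prob_space_distr meas X)
  interpret Q: prob_space "distr N (Pi\<^sub>M {..<d} (\<lambda>_. borel)) (\<lambda>x. \<lambda>k\<in>{..<d}. Y k x)"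
    by (intro N.prob_space_distr meas Y)
  show ?thesis
  proof (rule measure_eqI_PiM_finite)
    fix A :: "nat \<Rightarrow> real set" assume A: "\<And>i. i \<in> {..<d} \<Longrightarrow> A i \<in> sets borel"
    \<comment> \<open>\<open>step\<close> wants Borel sets at every index, so indices from
      \<open>d\<close> on get the whole line.\<close>
    define B where "B j = (if j < d then A j else UNIV)" for j
    have B: "B j \<in> sets borel" for j using A by (auto simp: B_def)
    have AB: "Pi\<^sub>E {..<d} A = Pi\<^sub>E {..<d} B" by (intro PiE_cong) (simp add: B_def)
    have "(CLINT x|M. (\<Prod>j<d. indicator (B j) (X j x)) *\<^sub>R (1::complex)) = (CLINT x|N. (\<Prod>j<d. indicator (B j) (Y j x)) *\<^sub>R (1::complex))"
      using step[of d B "\<lambda>_. 0", OF order_refl B]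
      by (simp only: atLeastLessThan_empty[OF order_refl] sum.empty of_real_0 mult_zero_right exp_zero)
    then have "measure (distr M (Pi\<^sub>M {..<d} (\<lambda>_. borel)) (\<lambda>x. \<lambda>k\<in>{..<d}. X k x)) (Pi\<^sub>E {..<d} B)
        = measure (distr N (Pi\<^sub>M {..<d} (\<lambda>_. borel)) (\<lambda>x. \<lambda>k\<in>{..<d}. Y k x)) (Pi\<^sub>E {..<d} B)"
      by (simp only: cl[of X M B] cl[of Y N B] X Y B of_real_eq_iff)
    then show "emeasure (distr M (Pi\<^sub>M {..<d} (\<lambda>_. borel)) (\<lambda>x. \<lambda>k\<in>{..<d}. X k x)) (Pi\<^sub>E {..<d} A)
      = emeasure (distr N (Pi\<^sub>M {..<d} (\<lambda>_. borel)) (\<lambda>x. \<lambda>k\<in>{..<d}. Y k x)) (Pi\<^sub>E {..<d} A)"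
      unfolding AB P.emeasure_eq_measure Q.emeasure_eq_measure by (simp only:)
  next
    show "range (\<lambda>_::nat. Pi\<^sub>E {..<d} (\<lambda>_. UNIV)) \<subseteq> prod_algebra {..<d} (\<lambda>_. borel :: real measure)"
      by (auto intro!: prod_algebraI_finite)
  qed (auto simp: space_PiM)
qed

section \<open>Gaussian vectors\<close>

text \<open>Stated through the characteristic function, so that singular covariances need no separate treatment.\<close>

definition has_gaussian_law :: "'a measure \<Rightarrow> nat \<Rightarrow> (nat \<Rightarrow> 'a \<Rightarrow> real) \<Rightarrow> (nat \<Rightarrow> nat \<Rightarrow> real) \<Rightarrow> bool" where
  "has_gaussian_law M d X C \<longleftrightarrow> prob_space M \<and> (\<forall>k<d. X k \<in> borel_measurable M) \<and>
     (\<forall>a :: nat \<Rightarrow> real. (CLINT x|M. iexp (\<Sum>k<d. a k * X k x)) =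
        complex_of_real (exp (- (\<Sum>k<d. \<Sum>l<d. a k * a l * C k l) / 2)))"

text \<open>Exponential growth is preserved by products and is integrable under every Gaussian law.\<close>

definition tame :: "nat \<Rightarrow> ((nat \<Rightarrow> real) \<Rightarrow> real) \<Rightarrow> bool" where
  "tame d F \<longleftrightarrow> continuous_on UNIV F \<and> (\<forall>x y. (\<forall>k<d. x k = y k) \<longrightarrow> F x = F y) \<and>
     (\<exists>A\<ge>0. \<forall>x. \<bar>F x\<bar> \<le> A * exp (A * (\<Sum>k<d. \<bar>x k\<bar>)))"

section \<open>Closure properties of functions of exponential growth\<close>

lemma tameI:
  assumes "continuous_on UNIV F" "\<And>x y. (\<And>k. k < d \<Longrightarrow> x k = y k) \<Longrightarrow> F x = F y"
    "\<And>x. \<bar>F x\<bar> \<le> A * exp (A * (\<Sum>k<d. \<bar>x k\<bar>))" "0 \<le> A"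
  shows "tame d F"
  unfolding tame_def using assms by blast

lemma
  assumes "tame d F"
  shows tame_continuous: "continuous_on UNIV F"
    and tame_cong: "(\<And>k. k < d \<Longrightarrow> x k = y k) \<Longrightarrow> F x = F y"
  using assms unfolding tame_def by blast+

lemma tame_bound:
  assumes "tame d F"
  obtains A where "\<And>x. \<bar>F x\<bar> \<le> A * exp (A * (\<Sum>k<d. \<bar>x k\<bar>))" "0 \<le> A"
  using assms unfolding tame_def by blast

lemma tame_const [intro]: "tame d (\<lambda>_. c)"
proof (rule tameI[where A = "\<bar>c\<bar>"])
  show "\<bar>c\<bar> \<le> \<bar>c\<bar> * exp (\<bar>c\<bar> * (\<Sum>k<d. \<bar>x k\<bar>))" for x :: "nat \<Rightarrow> real"
    using mult_left_mono[of 1 "exp (\<bar>c\<bar> * (\<Sum>k<d. \<bar>x k\<bar>))" "\<bar>c\<bar>"] by (simp add: sum_nonneg)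
qed auto

lemma tame_coord [intro]:
  assumes "k < d" shows "tame d (\<lambda>x. x k)"
proof (rule tameI[where A = 1])
  show "\<bar>x k\<bar> \<le> 1 * exp (1 * (\<Sum>k<d. \<bar>x k\<bar>))" for x :: "nat \<Rightarrow> real"
  proof -
    have "\<bar>x k\<bar> \<le> (\<Sum>k<d. \<bar>x k\<bar>)" using assms by (intro member_le_sum) auto
    also have "\<dots> \<le> exp (\<Sum>k<d. \<bar>x k\<bar>)" using exp_ge_add_one_self[of "\<Sum>k<d. \<bar>x k\<bar>"] by linarith
    finally show ?thesis by simp
  qed
qed (use assms in auto)

lemma tame_add [intro]:
  assumes "tame d F" "tame d G" shows "tame d (\<lambda>x. F x + G x)"
proof -
  obtain A where F: "\<And>x. \<bar>F x\<bar> \<le> A * exp (A * (\<Sum>k<d. \<bar>x k\<bar>))" "0 \<le> A"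
    using tame_bound[OF assms(1)] by blast
  obtain B where G: "\<And>x. \<bar>G x\<bar> \<le> B * exp (B * (\<Sum>k<d. \<bar>x k\<bar>))" "0 \<le> B"
    using tame_bound[OF assms(2)] by blast
  show ?thesis
  proof (rule tameI[where A = "A + B"])
    fix x :: "nat \<Rightarrow> real"
    let ?s = "\<Sum>k<d. \<bar>x k\<bar>"
    have s: "0 \<le> ?s" by (intro sum_nonneg) auto
    have "A * exp (A * ?s) \<le> A * exp ((A + B) * ?s)" "B * exp (B * ?s) \<le> B * exp ((A + B) * ?s)"
      using F(2) G(2) s by (auto intro!: mult_left_mono mult_right_mono)
    then show "\<bar>F x + G x\<bar> \<le> (A + B) * exp ((A + B) * ?s)"
      using F(1)[of x] G(1)[of x] by (simp add: distrib_right)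
    show "F x + G x = F y + G y" if "\<And>k. k < d \<Longrightarrow> x k = y k" for y
      using tame_cong[OF assms(1) that] tame_cong[OF assms(2) that] by simp
  qed (use F(2) G(2) in \<open>auto intro!: continuous_intros tame_continuous[OF assms(1)] tame_continuous[OF assms(2)]\<close>)
qed

lemma tame_mult [intro]:
  assumes "tame d F" "tame d G" shows "tame d (\<lambda>x. F x * G x)"
proof -
  obtain A where F: "\<And>x. \<bar>F x\<bar> \<le> A * exp (A * (\<Sum>k<d. \<bar>x k\<bar>))" "0 \<le> A"
    using tame_bound[OF assms(1)] by blast
  obtain B where G: "\<And>x. \<bar>G x\<bar> \<le> B * exp (B * (\<Sum>k<d. \<bar>x k\<bar>))" "0 \<le> B"
    using tame_bound[OF assms(2)] by blast
  show ?thesis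
  \<comment> \<open>This constant dominates both the prefactor \<open>A * B\<close> and the exponent
    \<open>A + B\<close>.\<close>
  proof (rule tameI[where A = "A * B + A + B"])
    fix x :: "nat \<Rightarrow> real"
    let ?s = "\<Sum>k<d. \<bar>x k\<bar>"
    have s: "0 \<le> ?s" by (intro sum_nonneg) auto
    have "\<bar>F x * G x\<bar> \<le> (A * exp (A * ?s)) * (B * exp (B * ?s))"
      unfolding abs_mult using F(1)[of x] G(1)[of x] F(2) G(2) by (intro mult_mono) simp_all
    also have "\<dots> = (A * B) * exp ((A + B) * ?s)"
      by (simp add: exp_add distrib_right)
    also have "\<dots> \<le> (A * B + A + B) * exp ((A * B + A + B) * ?s)"
      using F(2) G(2) s by (intro mult_mono) (auto intro!: mult_right_mono)
    finally show "\<bar>F x * G x\<bar> \<le> (A * B + A + B) * exp ((A * B + A + B) * ?s)" .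
    show "F x * G x = F y * G y" if "\<And>k. k < d \<Longrightarrow> x k = y k" for y
      using tame_cong[OF assms(1) that] tame_cong[OF assms(2) that] by simp
  qed (use F(2) G(2) in \<open>auto intro!: continuous_intros tame_continuous[OF assms(1)] tame_continuous[OF assms(2)]\<close>)
qed

lemma tame_diff [intro]:
  assumes "tame d F" "tame d G" shows "tame d (\<lambda>x. F x - G x)"
  using tame_add[OF assms(1) tame_mult[OF tame_const[of d "-1"] assms(2)]] by simp

lemma tame_power2 [intro]:
  assumes "tame d F" shows "tame d (\<lambda>x. (F x)\<^sup>2)"
  unfolding power2_eq_square using assms by auto

lemma tame_sum [intro]:
  assumes "\<And>i. i \<in> I \<Longrightarrow> tame d (F i)" shows "tame d (\<lambda>x. \<Sum>i\<in>I. F i x)"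
  using assms by (induction I rule: infinite_finite_induct) auto

lemma tame_measurable:
  assumes "tame d F" "\<And>k. k < d \<Longrightarrow> X k \<in> borel_measurable M"
  shows "(\<lambda>x. F (\<lambda>k. X k x)) \<in> borel_measurable M"
proof -
  \<comment> \<open>Components from \<open>d\<close> on are arbitrary functions, possibly not
    measurable; \<open>F\<close> ignores them, so they are set to 0.\<close>
  have "(\<lambda>x. if k < d then X k x else 0) \<in> borel_measurable M" for k
    using assms(2) by (cases "k < d") auto
  then have "(\<lambda>x. F (\<lambda>k. if k < d then X k x else 0)) \<in> borel_measurable M"
    by (intro borel_measurable_continuous_on[OF tame_continuous[OF assms(1)]] measurable_coordinatewise_then_product)
  also have "(\<lambda>x. F (\<lambda>k. if k < d then X k x else 0)) = (\<lambda>x. F (\<lambda>k. X k x))"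
    by (auto intro!: tame_cong[OF assms(1)])
  finally show ?thesis .
qed

lemma tame_continuous_on_compose:
  assumes "tame d F" "\<And>k. k < d \<Longrightarrow> continuous_on S (z k)"
  shows "continuous_on S (\<lambda>t. F (\<lambda>k. z k t))"
proof -
  have "continuous_on S (\<lambda>t. if k < d then z k t else 0)" for k
    using assms(2) by (cases "k < d") auto
  then have "continuous_on S (\<lambda>t. F (\<lambda>k. if k < d then z k t else 0))"
    by (intro continuous_on_compose2[OF tame_continuous[OF assms(1)]] continuous_on_coordinatewise_then_product) auto
  also have "(\<lambda>x. F (\<lambda>k. if k < d then z k x else 0)) = (\<lambda>x. F (\<lambda>k. z k x))"
    by (auto intro!: tame_cong[OF assms(1)])
  finally show ?thesis .
qed

text \<open>The sum is at most \<open>d\<close> times its largest term. This reduces exponential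
  moments of the vector to those of single components, without any information on their joint law.
  The summand 1 covers \<open>d = 0\<close>.\<close>

lemma exp_sum_abs_le:
  fixes x :: "nat \<Rightarrow> real" assumes "0 \<le> A"
  shows "exp (A * (\<Sum>k<d. \<bar>x k\<bar>)) \<le> 1 + (\<Sum>k<d. exp (A * d * \<bar>x k\<bar>))"
proof (cases "d = 0")
  case False
  obtain j where j: "j < d" "\<And>k. k < d \<Longrightarrow> \<bar>x k\<bar> \<le> \<bar>x j\<bar>"
    using obtains_MAX[of "{..<d}" "\<lambda>k. \<bar>x k\<bar>"] False
    by (metis (no_types, lifting) Max_ge finite_imageI finite_lessThan image_eqI lessThan_empty_iff lessThan_iff)
  have "(\<Sum>k<d. \<bar>x k\<bar>) \<le> d * \<bar>x j\<bar>" using sum_bounded_above[of "{..<d}" "\<lambda>k. \<bar>x k\<bar>" "\<bar>x j\<bar>"] j by simp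
  then have "exp (A * (\<Sum>k<d. \<bar>x k\<bar>)) \<le> exp (A * d * \<bar>x j\<bar>)"
    using mult_left_mono[OF _ assms, of "\<Sum>k<d. \<bar>x k\<bar>" "d * \<bar>x j\<bar>"] by (simp add: mult.assoc)
  also have "\<dots> \<le> (\<Sum>k<d. exp (A * d * \<bar>x k\<bar>))" using j by (intro member_le_sum) auto
  finally show ?thesis by simp
qed simp

section \<open>Exponential moments, and transfer between Gaussian vectors of equal
  covariance\<close>

lemma std_normal_integrable_exp: "integrable std_normal_distribution (\<lambda>x. exp (r * x))"
proof -
  have "std_normal_density x * exp (r * x) = exp (r\<^sup>2 / 2) * normal_density r 1 x" for x
    by (simp add: std_normal_density_def normal_density_def exp_add[symmetric] exp_diff[symmetric])
       (simp add: power2_eq_square field_simps)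
  then show ?thesis
    by (subst integrable_density) (auto simp: normal_density_nonneg)
qed

lemma std_normal_integrable_exp_abs: "integrable std_normal_distribution (\<lambda>x. exp (r * \<bar>x\<bar>))"
proof (rule Bochner_Integration.integrable_bound)
  show "integrable std_normal_distribution (\<lambda>x. exp (r * x) + exp (- r * x))"
    by (intro Bochner_Integration.integrable_add std_normal_integrable_exp)
  show "AE x in std_normal_distribution. norm (exp (r * \<bar>x\<bar>)) \<le> norm (exp (r * x) + exp (- r * x))"
  proof (rule AE_I2)
    fix x
    have "exp (r * \<bar>x\<bar>) \<le> exp (r * x) + exp (- r * x)" by (cases "x < 0") simp_all
    then show "norm (exp (r * \<bar>x\<bar>)) \<le> norm (exp (r * x) + exp (- r * x))"
      using abs_ge_self[of "exp (r * x) + exp (- r * x)"] by (simp del: abs_ge_self)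
  qed
qed simp

lemma
  assumes "has_gaussian_law M d X C"
  shows gaussian_prob_space: "prob_space M"
    and gaussian_measurable: "k < d \<Longrightarrow> X k \<in> borel_measurable M"
    and gaussian_char: "(CLINT x|M. iexp (\<Sum>k<d. a k * X k x)) =
        complex_of_real (exp (- (\<Sum>k<d. \<Sum>l<d. a k * a l * C k l) / 2))"
  using assms unfolding has_gaussian_law_def by auto

lemma gaussian_integrable_exp_abs:
  assumes X: "has_gaussian_law M d X C" and k: "k < d"
  shows "integrable M (\<lambda>x. exp (r * \<bar>X k x\<bar>))"
proof -
  interpret prob_space M using X by (rule gaussian_prob_space)
  note [measurable] = gaussian_measurable[OF X k]
  have char: "(CLINT x|M. iexp (s * X k x)) = complex_of_real (exp (- (s\<^sup>2 * C k k) / 2))" for s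
  proof -
    have "(\<Sum>j<d. (if j = k then s else 0) * Z j) = s * Z k" for Z :: "nat \<Rightarrow> real"
      using k by (simp add: if_distrib[where f = "\<lambda>a. a * _"] cong: if_cong)
    moreover have "(\<Sum>j<d. \<Sum>l<d. (if j = k then s else 0) * (if l = k then s else 0) * C j l) = s\<^sup>2 * C k k"
      using k by (simp add: if_distrib[where f = "\<lambda>a. a * _"] if_distrib[where f = "\<lambda>a. _ * a"] power2_eq_square cong: if_cong)
    ultimately show ?thesis using gaussian_char[OF X, of "\<lambda>j. if j = k then s else 0"] by simp
  qed
  \<comment> \<open>\<open>has_gaussian_law\<close> does not state that \<open>C\<close> is positive
    semidefinite; the nonnegative variance is read off from the bound 1 on a characteristic
    function.\<close>
  have "norm (CLINT x|M. iexp (1 * X k x)) \<le> 1"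
    by (rule order_trans[OF integral_norm_bound]) (simp add: prob_space)
  then have C: "0 \<le> C k k" unfolding char by simp
  have "distr M borel (X k) = distr std_normal_distribution borel (\<lambda>x. sqrt (C k k) * x)"
  proof (rule Levy_uniqueness)
    interpret N: real_distribution std_normal_distribution by (rule real_dist_normal_dist)
    show "real_distribution (distr M borel (X k))" by (rule real_distribution_distr) simp
    show "real_distribution (distr std_normal_distribution borel (\<lambda>x. sqrt (C k k) * x))"
      by (rule N.real_distribution_distr) simp
    show "char (distr M borel (X k)) = char (distr std_normal_distribution borel (\<lambda>x. sqrt (C k k) * x))"
    proof
      fix t
      have "char (distr M borel (X k)) t = (CLINT x|M. iexp (t * X k x))"
        unfolding char_def by (subst integral_distr) auto
      also have "\<dots> = char std_normal_distribution (t * sqrt (C k k))"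
        unfolding char char_std_normal_distribution using C by (simp add: power_mult_distrib)
      also have "\<dots> = char (distr std_normal_distribution borel (\<lambda>x. sqrt (C k k) * x)) t"
        unfolding char_def by (subst integral_distr) (auto simp: mult.assoc)
      finally show "char (distr M borel (X k)) t = char (distr std_normal_distribution borel (\<lambda>x. sqrt (C k k) * x)) t" .
    qed
  qed
  moreover have "integrable (distr std_normal_distribution borel (\<lambda>x. sqrt (C k k) * x)) (\<lambda>x. exp (r * \<bar>x\<bar>))"
    using std_normal_integrable_exp_abs[of "r * sqrt (C k k)"] C
    by (subst integrable_distr_eq) (auto simp: abs_mult mult.assoc)
  ultimately have "integrable (distr M borel (X k)) (\<lambda>x. exp (r * \<bar>x\<bar>))" by simp
  then show ?thesis by (subst (asm) integrable_distr_eq) auto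
qed

lemma gaussian_integrable_exp_sum:
  assumes X: "has_gaussian_law M d X C" and A: "0 \<le> A"
  shows "integrable M (\<lambda>x. exp (A * (\<Sum>k<d. \<bar>X k x\<bar>)))"
proof (rule Bochner_Integration.integrable_bound)
  interpret prob_space M using X by (rule gaussian_prob_space)
  note [measurable] = gaussian_measurable[OF X]
  show "integrable M (\<lambda>x. 1 + (\<Sum>k<d. exp (A * d * \<bar>X k x\<bar>)))"
    by (intro Bochner_Integration.integrable_add integrable_const Bochner_Integration.integrable_sum)
      (auto intro!: gaussian_integrable_exp_abs[OF X])
  show "(\<lambda>x. exp (A * (\<Sum>k<d. \<bar>X k x\<bar>))) \<in> borel_measurable M"
    by (auto intro!: borel_measurable_exp borel_measurable_times borel_measurable_sum)
  show "AE x in M. norm (exp (A * (\<Sum>k<d. \<bar>X k x\<bar>))) \<le> norm (1 + (\<Sum>k<d. exp (A * d * \<bar>X k x\<bar>)))"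
    using exp_sum_abs_le[OF A] by (auto simp: abs_of_nonneg add_nonneg_nonneg sum_nonneg)
qed

lemma gaussian_tame_integrable:
  assumes X: "has_gaussian_law M d X C" and F: "tame d F"
  shows "integrable M (\<lambda>x. F (\<lambda>k. X k x))"
proof -
  obtain A where A: "\<And>x. \<bar>F x\<bar> \<le> A * exp (A * (\<Sum>k<d. \<bar>x k\<bar>))" "0 \<le> A" using tame_bound[OF F] by blast
  show ?thesis
  proof (rule Bochner_Integration.integrable_bound)
    show "integrable M (\<lambda>x. A * exp (A * (\<Sum>k<d. \<bar>X k x\<bar>)))"
      using gaussian_integrable_exp_sum[OF X A(2)] by simp
  qed (use A in \<open>auto intro!: tame_measurable[OF F] gaussian_measurable[OF X]\<close>)
qed

text \<open>Expectations depend on the covariance alone. This licenses the later changes of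
  probability space: regression copies, rotations, permuted or erased components.\<close>

lemma gaussian_transfer:
  assumes X: "has_gaussian_law M d X C" and Y: "has_gaussian_law N d Y C" and F: "tame d F"
  shows "(\<integral>x. F (\<lambda>k. X k x) \<partial>M) = (\<integral>x. F (\<lambda>k. Y k x) \<partial>N)"
proof -
  let ?P = "Pi\<^sub>M {..<d} (\<lambda>_. borel) :: (nat \<Rightarrow> real) measure"
  have eq: "distr M ?P (\<lambda>x. \<lambda>k\<in>{..<d}. X k x) = distr N ?P (\<lambda>x. \<lambda>k\<in>{..<d}. Y k x)"
    by (rule finite_dim_law_unique, unfold gaussian_char[OF X] gaussian_char[OF Y])
       (auto intro: gaussian_prob_space[OF X] gaussian_prob_space[OF Y]
         gaussian_measurable[OF X] gaussian_measurable[OF Y])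
  have mF: "F \<in> borel_measurable ?P" using tame_measurable[OF F, of "\<lambda>k x. x k" ?P] by auto
  have "(\<integral>x. F (\<lambda>k. Z k x) \<partial>L) = (\<integral>z. F z \<partial>distr L ?P (\<lambda>x. \<lambda>k\<in>{..<d}. Z k x))"
    if "has_gaussian_law L d Z C" for L :: "'c measure" and Z
  proof -
    have "(\<integral>z. F z \<partial>distr L ?P (\<lambda>x. \<lambda>k\<in>{..<d}. Z k x)) = (\<integral>x. F (\<lambda>k\<in>{..<d}. Z k x) \<partial>L)"
      using mF by (intro integral_distr measurable_restrict gaussian_measurable[OF that]) auto
    also have "\<dots> = (\<integral>x. F (\<lambda>k. Z k x) \<partial>L)"
      by (intro Bochner_Integration.integral_cong refl tame_cong[OF F]) auto
    finally show ?thesis by simp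
  qed
  from this[OF X] this[OF Y] eq show ?thesis by simp
qed

section \<open>Gaussian integration by parts\<close>

lemma pair_prob_space_integral:
  fixes f :: "'a \<times> 'b \<Rightarrow> 'c::{banach, second_countable_topology}"
  assumes "prob_space M" "prob_space N" "integrable (M \<Otimes>\<^sub>M N) f"
  shows "integral\<^sup>L (M \<Otimes>\<^sub>M N) f = (\<integral>x. (\<integral>y. f (x, y) \<partial>N) \<partial>M)"
proof -
  interpret M: prob_space M by fact
  interpret N: prob_space N by fact
  interpret P: pair_sigma_finite M N ..
  show ?thesis using P.integral_fst'[OF assms(3)] by simp
qed

lemma pair_prob_space_prob_space:
  assumes "prob_space M" "prob_space N" shows "prob_space (M \<Otimes>\<^sub>M N)"
proof -
  interpret M: prob_space M by fact
  interpret N: prob_space N by fact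
  interpret P: pair_prob_space M N ..
  show ?thesis by unfold_locales
qed

lemma pair_integral_iexp:
  assumes M: "prob_space M" and N: "prob_space N"
    and [measurable]: "f \<in> borel_measurable M" "g \<in> borel_measurable N"
  shows "(CLINT z|(M \<Otimes>\<^sub>M N). iexp (f (fst z) + g (snd z))) = (CLINT x|M. iexp (f x)) * (CLINT y|N. iexp (g y))"
proof -
  interpret P: prob_space "M \<Otimes>\<^sub>M N" by (rule pair_prob_space_prob_space[OF M N])
  have "integrable (M \<Otimes>\<^sub>M N) (\<lambda>z. iexp (f (fst z) + g (snd z)))"
    by (rule P.integrable_const_bound[of _ 1]) auto
  then have "(CLINT z|(M \<Otimes>\<^sub>M N). iexp (f (fst z) + g (snd z))) = (CLINT x|M. CLINT y|N. iexp (f x + g y))"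
    by (subst pair_prob_space_integral[OF M N]) auto
  also have "\<dots> = (CLINT x|M. iexp (f x) * (CLINT y|N. iexp (g y)))"
    by (simp add: exp_add distrib_left)
  finally show ?thesis by simp
qed

lemma quadratic_form_expand:
  fixes C :: "nat \<Rightarrow> nat \<Rightarrow> real"
  assumes sym: "\<And>k l. C k l = C l k" and w: "\<And>k. k < d \<Longrightarrow> w k = (\<Sum>l<d. C k l * u l)"
  shows "(\<Sum>k<d. \<Sum>l<d. (a k - r * u k) * (a l - r * u l) * C k l)
    = (\<Sum>k<d. \<Sum>l<d. a k * a l * C k l) - 2 * r * (\<Sum>k<d. a k * w k) + r\<^sup>2 * (\<Sum>k<d. u k * w k)"
proof -
  have 1: "(\<Sum>k<d. \<Sum>l<d. b k * u l * C k l) = (\<Sum>k<d. b k * w k)" for b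
    using w by (simp add: sum_distrib_left mult_ac)
  have 2: "(\<Sum>k<d. \<Sum>l<d. u k * a l * C k l) = (\<Sum>k<d. a k * w k)"
    unfolding 1[symmetric] by (subst sum.swap) (simp add: sym mult_ac)
  have "(\<Sum>k<d. \<Sum>l<d. (a k - r * u k) * (a l - r * u l) * C k l) =
     (\<Sum>k<d. \<Sum>l<d. a k * a l * C k l - r * (a k * u l * C k l) - r * (u k * a l * C k l) + r\<^sup>2 * (u k * u l * C k l))"
    by (intro sum.cong refl) (simp add: algebra_simps power2_eq_square)
  also have "\<dots> = (\<Sum>k<d. \<Sum>l<d. a k * a l * C k l) - r * (\<Sum>k<d. a k * w k) - r * (\<Sum>k<d. a k * w k) + r\<^sup>2 * (\<Sum>k<d. u k * w k)"
    by (simp only: sum.distrib sum_subtractf sum_distrib_left[symmetric] 1 2)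
  finally show ?thesis by simp
qed

lemma std_normal_char: "(CLINT t|std_normal_distribution. iexp (s * t)) = complex_of_real (exp (- s\<^sup>2 / 2))"
  using char_std_normal_distribution by (simp add: char_def fun_eq_iff)

lemma prob_space_std_normal: "prob_space std_normal_distribution"
  using real_dist_normal_dist by (simp add: real_distribution_def)

text \<open>The component of \<open>X\<close> along \<open>u \<bullet> X\<close> is independent of the rest and may be replaced by an independent copy.\<close>

lemma gaussian_regression:
  assumes X: "has_gaussian_law M d X C" and sym: "\<And>k l. C k l = C l k"
    and w: "\<And>k. k < d \<Longrightarrow> w k = (\<Sum>l<d. C k l * u l)" and 1: "(\<Sum>k<d. u k * w k) = 1"
  shows "has_gaussian_law (M \<Otimes>\<^sub>M std_normal_distribution) d
     (\<lambda>k z. X k (fst z) - (\<Sum>l<d. u l * X l (fst z)) * w k + snd z * w k) C"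
  unfolding has_gaussian_law_def
proof (intro conjI allI impI)
  note [measurable] = gaussian_measurable[OF X]
  note M = gaussian_prob_space[OF X]
  show "prob_space (M \<Otimes>\<^sub>M std_normal_distribution)"
    by (rule pair_prob_space_prob_space[OF M prob_space_std_normal])
  show "(\<lambda>z. X k (fst z) - (\<Sum>l<d. u l * X l (fst z)) * w k + snd z * w k) \<in> borel_measurable (M \<Otimes>\<^sub>M std_normal_distribution)"
    if "k < d" for k
    using that by (auto intro!: borel_measurable_add borel_measurable_diff borel_measurable_times borel_measurable_sum)
  fix a :: "nat \<Rightarrow> real"
  define r where "r = (\<Sum>k<d. a k * w k)"
  have "(\<Sum>k<d. a k * (X k x - (\<Sum>l<d. u l * X l x) * w k + t * w k)) = (\<Sum>k<d. (a k - r * u k) * X k x) + r * t" for x t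
  proof -
    have "(\<Sum>k<d. a k * (X k x - (\<Sum>l<d. u l * X l x) * w k + t * w k))
      = (\<Sum>k<d. a k * X k x - (\<Sum>l<d. u l * X l x) * (a k * w k) + t * (a k * w k))"
      by (intro sum.cong refl) (simp add: algebra_simps)
    also have "\<dots> = (\<Sum>k<d. a k * X k x) - (\<Sum>l<d. u l * X l x) * r + t * r"
      by (simp add: sum.distrib sum_subtractf sum_distrib_left r_def)
    also have "\<dots> = (\<Sum>k<d. a k * X k x - r * (u k * X k x)) + r * t"
      by (simp add: sum_subtractf sum_distrib_left mult_ac)
    finally show ?thesis by (simp add: algebra_simps)
  qed
  then have "(CLINT z|(M \<Otimes>\<^sub>M std_normal_distribution). iexp (\<Sum>k<d. a k * (X k (fst z) - (\<Sum>l<d. u l * X l (fst z)) * w k + snd z * w k)))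
    = (CLINT x|M. iexp (\<Sum>k<d. (a k - r * u k) * X k x)) * (CLINT t|std_normal_distribution. iexp (r * t))"
    by (simp only:) (intro pair_integral_iexp M prob_space_std_normal borel_measurable_sum borel_measurable_times; simp)
  also have "\<dots> = complex_of_real (exp (- (\<Sum>k<d. \<Sum>l<d. (a k - r * u k) * (a l - r * u l) * C k l) / 2 + - r\<^sup>2 / 2))"
    unfolding gaussian_char[OF X] std_normal_char exp_add by simp
  \<comment> \<open>Removing the component along \<open>u\<close> lowers the variance of the
    combination by the square of \<open>r\<close>, since \<open>u\<close> is normalized; the fresh
    normal variable adds it back.\<close>
  also have "- (\<Sum>k<d. \<Sum>l<d. (a k - r * u k) * (a l - r * u l) * C k l) / 2 + - r\<^sup>2 / 2 = - (\<Sum>k<d. \<Sum>l<d. a k * a l * C k l) / 2"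
  proof -
    have "(\<Sum>k<d. \<Sum>l<d. (a k - r * u k) * (a l - r * u l) * C k l)
      = (\<Sum>k<d. \<Sum>l<d. a k * a l * C k l) - 2 * r * (\<Sum>k<d. a k * w k) + r\<^sup>2 * (\<Sum>k<d. u k * w k)"
      by (rule quadratic_form_expand) (rule sym, erule w)
    then show ?thesis unfolding 1 r_def[symmetric] by (simp add: power2_eq_square field_simps)
  qed
  finally show "(CLINT z|(M \<Otimes>\<^sub>M std_normal_distribution). iexp (\<Sum>k<d. a k * (X k (fst z) - (\<Sum>l<d. u l * X l (fst z)) * w k + snd z * w k)))
     = complex_of_real (exp (- (\<Sum>k<d. \<Sum>l<d. a k * a l * C k l) / 2))" .
qed

text \<open>\<open>- (std_normal_density t * F t)\<close> is an antiderivative of the difference of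
  the two integrands, and it vanishes at both infinities because the Gaussian factor beats
  exponential growth.\<close>

lemma std_normal_integration_by_parts:
  fixes F F' :: "real \<Rightarrow> real"
  assumes F: "\<And>t. (F has_real_derivative F' t) (at t)" and cont: "continuous_on UNIV F'"
    and bF: "\<And>t. \<bar>F t\<bar> \<le> B * exp (B * \<bar>t\<bar>)" and bF': "\<And>t. \<bar>F' t\<bar> \<le> D * exp (D * \<bar>t\<bar>)"
  shows "(\<integral>t. t * F t \<partial>std_normal_distribution) = (\<integral>t. F' t \<partial>std_normal_distribution)"
proof -
  have contF: "continuous_on UNIV F"
    using F by (auto intro!: DERIV_isCont continuous_at_imp_continuous_on)
  have [measurable]: "F \<in> borel_measurable borel" "F' \<in> borel_measurable borel"
    using contF cont by (auto intro: borel_measurable_continuous_onI)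
  have B: "0 \<le> B" "0 \<le> D"
    using bF[of 0] bF'[of 0] by auto
  have intF: "integrable std_normal_distribution (\<lambda>t. t * F t)"
  proof (rule Bochner_Integration.integrable_bound)
    show "integrable std_normal_distribution (\<lambda>t. B * exp ((1 + B) * \<bar>t\<bar>))"
      by (intro integrable_mult_right std_normal_integrable_exp_abs)
    show "AE t in std_normal_distribution. norm (t * F t) \<le> norm (B * exp ((1 + B) * \<bar>t\<bar>))"
    proof (rule AE_I2)
      fix t :: real
      have "\<bar>t\<bar> \<le> exp \<bar>t\<bar>" using exp_ge_add_one_self[of "\<bar>t\<bar>"] by linarith
      then have "\<bar>t\<bar> * \<bar>F t\<bar> \<le> exp \<bar>t\<bar> * (B * exp (B * \<bar>t\<bar>))"
        using bF[of t] by (intro mult_mono) auto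
      then show "norm (t * F t) \<le> norm (B * exp ((1 + B) * \<bar>t\<bar>))"
        using B by (simp add: abs_mult exp_add[symmetric] algebra_simps)
    qed
  qed simp
  have intF': "integrable std_normal_distribution F'"
  proof (rule Bochner_Integration.integrable_bound)
    show "integrable std_normal_distribution (\<lambda>t. D * exp (D * \<bar>t\<bar>))"
      by (intro integrable_mult_right std_normal_integrable_exp_abs)
  qed (use bF' B in \<open>auto simp: abs_mult\<close>)
  let ?\<phi> = "std_normal_density"
  let ?f = "\<lambda>t. ?\<phi> t * (t * F t) - ?\<phi> t * F' t"
  have int1: "integrable lborel (\<lambda>t. ?\<phi> t * (t * F t))" and int2: "integrable lborel (\<lambda>t. ?\<phi> t * F' t)"
    using intF intF' by (simp_all add: integrable_density normal_density_nonneg)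
  have int: "integrable lborel ?f" using int1 int2 by simp
  have d\<phi>: "(?\<phi> has_real_derivative - (t * ?\<phi> t)) (at t)" for t
    unfolding std_normal_density_def by (auto intro!: derivative_eq_intros simp: field_simps power2_eq_square)
  have der: "((\<lambda>t. - (?\<phi> t * F t)) has_real_derivative ?f t) (at t)" for t
    by (rule DERIV_cong[OF DERIV_minus[OF DERIV_mult[OF d\<phi> F]]]) (simp add: algebra_simps)
  have lim0: "((\<lambda>t. B * exp (B * t - t\<^sup>2 / 2)) \<longlongrightarrow> 0) at_top"
    by real_asymp
  have bnd: "\<bar>?\<phi> t * F t\<bar> \<le> B * exp (B * \<bar>t\<bar> - \<bar>t\<bar>\<^sup>2 / 2)" for t
  proof -
    have "?\<phi> t \<le> exp (- t\<^sup>2 / 2)"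
      unfolding std_normal_density_def using pi_ge_two by (simp add: divide_simps)
    then have "\<bar>?\<phi> t * F t\<bar> \<le> exp (- t\<^sup>2 / 2) * (B * exp (B * \<bar>t\<bar>))"
      unfolding abs_mult using bF[of t] by (intro mult_mono) (auto simp: normal_density_nonneg)
    also have "\<dots> = B * exp (B * \<bar>t\<bar> - \<bar>t\<bar>\<^sup>2 / 2)" by (simp add: exp_add[symmetric])
    finally show ?thesis .
  qed
  have l1: "((\<lambda>t. - (?\<phi> t * F t)) \<longlongrightarrow> 0) at_top"
  proof (rule Lim_null_comparison[OF _ lim0])
    show "\<forall>\<^sub>F t in at_top. norm (- (?\<phi> t * F t)) \<le> B * exp (B * t - t\<^sup>2 / 2)"
      using eventually_ge_at_top[of 0]
    proof eventually_elim
      case (elim t) then show ?case using bnd[of t] by simp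
    qed
  qed
  have l2: "((\<lambda>t. - (?\<phi> t * F t)) \<longlongrightarrow> 0) at_bot"
    unfolding filterlim_at_bot_mirror
  proof (rule Lim_null_comparison[OF _ lim0])
    show "\<forall>\<^sub>F t in at_top. norm (- (?\<phi> (- t) * F (- t))) \<le> B * exp (B * t - t\<^sup>2 / 2)"
      using eventually_ge_at_top[of 0]
    proof eventually_elim
      case (elim t) then show ?case using bnd[of "-t"] by simp
    qed
  qed
  have "(LBINT t=-\<infinity>..\<infinity>. ?f t) = 0 - 0"
  proof (rule interval_integral_FTC_integrable)
    show "((\<lambda>t. - (?\<phi> t * F t)) has_vector_derivative ?f t) (at t)" for t
      using der by (simp add: has_real_derivative_iff_has_vector_derivative)
    show "isCont ?f t" for t
      using contF cont DERIV_isCont[OF d\<phi>]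
      by (auto intro!: continuous_intros simp: continuous_on_eq_continuous_at)
    show "set_integrable lborel (einterval (- \<infinity>) \<infinity>) ?f"
      using int by (simp add: set_integrable_def einterval_def)
  qed (use l1 l2 in \<open>auto simp: ereal_tendsto_simps1\<close>)
  then have "integral\<^sup>L lborel ?f = 0"
    by (simp add: interval_lebesgue_integral_def einterval_def set_lebesgue_integral_def)
  then have "(\<integral>t. ?\<phi> t * (t * F t) \<partial>lborel) = (\<integral>t. ?\<phi> t * F' t \<partial>lborel)"
    using int1 int2 by simp
  then show ?thesis by (simp add: integral_density normal_density_nonneg)
qed

text \<open>Differentiability is encoded as the chain rule along curves. Points are functions on all
  of \<open>nat\<close>, of which only the coordinates below \<open>d\<close> count, and the curves
  of interest are straight lines and circular interpolation paths.\<close>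

definition has_gradient :: "nat \<Rightarrow> ((nat \<Rightarrow> real) \<Rightarrow> real) \<Rightarrow> (nat \<Rightarrow> (nat \<Rightarrow> real) \<Rightarrow> real) \<Rightarrow> bool" where
  "has_gradient d F G \<longleftrightarrow> (\<forall>z z' t. (\<forall>k<d. (z k has_real_derivative z' k) (at t)) \<longrightarrow>
     ((\<lambda>s. F (\<lambda>k. z k s)) has_real_derivative (\<Sum>k<d. G k (\<lambda>k. z k t) * z' k)) (at t))"

lemma has_gradientD:
  assumes "has_gradient d F G" "\<And>k. k < d \<Longrightarrow> (z k has_real_derivative z' k) (at t)"
  shows "((\<lambda>s. F (\<lambda>k. z k s)) has_real_derivative (\<Sum>k<d. G k (\<lambda>k. z k t) * z' k)) (at t)"
  using assms unfolding has_gradient_def by blast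

text \<open>One constant serves for all \<open>z\<close> in the stated range, so the bound holds
  uniformly along lines and planes and under affine changes of variable.\<close>

lemma tame_linear_growth:
  assumes "tame d F" "0 \<le> a"
  obtains B where "0 \<le> B" "\<And>z s. (\<Sum>k<d. \<bar>z k\<bar>) \<le> c + a * s \<Longrightarrow> 0 \<le> s \<Longrightarrow> \<bar>F z\<bar> \<le> B * exp (B * s)"
proof -
  obtain A where A: "\<And>x. \<bar>F x\<bar> \<le> A * exp (A * (\<Sum>k<d. \<bar>x k\<bar>))" "0 \<le> A"
    using tame_bound[OF assms(1)] by blast
  define B where "B = A * exp (A * c) + A * a"
  have nn: "0 \<le> A * a" "0 \<le> A * exp (A * c)" using A assms(2) by auto
  show thesis
  proof (rule that[of B])
    fix z and s :: real assume z: "(\<Sum>k<d. \<bar>z k\<bar>) \<le> c + a * s" and s: "0 \<le> s"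
    have "\<bar>F z\<bar> \<le> A * exp (A * (c + a * s))"
      using A(1)[of z] A(2) mult_left_mono[OF z A(2)] by (meson exp_le_cancel_iff mult_left_mono order_trans)
    also have "\<dots> = (A * exp (A * c)) * exp (A * a * s)" by (simp add: exp_add algebra_simps)
    also have "\<dots> \<le> B * exp (B * s)"
      using nn A(2) s by (intro mult_mono) (auto simp: B_def intro!: mult_right_mono)
    finally show "\<bar>F z\<bar> \<le> B * exp (B * s)" .
  qed (use nn in \<open>simp add: B_def\<close>)
qed

lemma sum_abs_affine_le:
  fixes p w :: "nat \<Rightarrow> real"
  shows "(\<Sum>k<d. \<bar>p k + t * w k\<bar>) \<le> (\<Sum>k<d. \<bar>p k\<bar>) + \<bar>t\<bar> * (\<Sum>k<d. \<bar>w k\<bar>)"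
  unfolding sum_distrib_left sum.distrib[symmetric] abs_mult[symmetric] by (intro sum_mono abs_triangle_ineq)

lemma tame_affine_bound:
  assumes "tame d F"
  obtains B where "\<And>t. \<bar>F (\<lambda>k. p k + t * w k)\<bar> \<le> B * exp (B * \<bar>t\<bar>)"
proof -
  obtain B where B: "\<And>z s. (\<Sum>k<d. \<bar>z k\<bar>) \<le> (\<Sum>k<d. \<bar>p k\<bar>) + (\<Sum>k<d. \<bar>w k\<bar>) * s \<Longrightarrow> 0 \<le> s \<Longrightarrow> \<bar>F z\<bar> \<le> B * exp (B * s)"
    by (rule tame_linear_growth[OF assms, of "\<Sum>k<d. \<bar>w k\<bar>" "\<Sum>k<d. \<bar>p k\<bar>"]) (auto intro: sum_nonneg)
  show thesis
    by (rule that[of B], rule B) (use sum_abs_affine_le[of p _ w d] in \<open>simp_all add: mult.commute\<close>)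
qed

text \<open>Regressing on the \<open>j\<close>-th component reduces the claim to one-dimensional integration by parts.\<close>

lemma gaussian_integration_by_parts:
  assumes X: "has_gaussian_law M d X C" and sym: "\<And>k l. C k l = C l k" and j: "j < d" "0 < C j j"
    and F: "tame d F" and G: "\<And>k. k < d \<Longrightarrow> tame d (G k)" and FG: "has_gradient d F G"
  shows "(\<integral>x. X j x * F (\<lambda>k. X k x) \<partial>M) = (\<Sum>k<d. C j k * (\<integral>x. G k (\<lambda>k. X k x) \<partial>M))"
proof -
  define \<sigma> where "\<sigma> = sqrt (C j j)"
  have \<sigma>: "\<sigma> > 0" "\<sigma>\<^sup>2 = C j j" using j by (auto simp: \<sigma>_def)
  \<comment> \<open>Regression on the \<open>j\<close>-th component divided by its standard
    deviation; \<open>w\<close> is the vector of covariances with it. The \<open>j\<close>-th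
    component of the copy is then exactly \<open>\<sigma> * t\<close>, with no remainder.\<close>
  define u where "u k = (if k = j then 1 / \<sigma> else 0)" for k
  define w where "w k = C j k / \<sigma>" for k
  have u: "(\<Sum>l<d. f l * u l) = f j / \<sigma>" "(\<Sum>l<d. u l * f l) = f j / \<sigma>" for f
    using j by (simp_all add: u_def if_distrib[where f = "\<lambda>a. a * _"] if_distrib[where f = "\<lambda>a. _ * a"] cong: if_cong)
  let ?Q = "M \<Otimes>\<^sub>M std_normal_distribution"
  define Z where "Z k z = X k (fst z) - (\<Sum>l<d. u l * X l (fst z)) * w k + snd z * w k" for k z
  have Z: "has_gaussian_law ?Q d Z C"
    unfolding Z_def
  proof (rule gaussian_regression[OF X sym])
    show "w k = (\<Sum>l<d. C k l * u l)" for k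
      unfolding u w_def by (subst sym) (rule refl)
    show "(\<Sum>k<d. u k * w k) = 1"
      unfolding u w_def using \<sigma> j by (simp add: power2_eq_square[symmetric])
  qed
  note M = gaussian_prob_space[OF X]
  define p where "p x k = X k x - (\<Sum>l<d. u l * X l x) * w k" for x k
  have Zp: "Z k (x, t) = p x k + t * w k" for k x t by (simp add: Z_def p_def)
  have Zj: "Z j (x, t) = \<sigma> * t" for x t
    using \<sigma> by (simp add: Z_def u w_def \<sigma>(2)[symmetric] power2_eq_square)
  have tG: "tame d (\<lambda>y. \<Sum>k<d. G k y * w k)" using G by (intro tame_sum tame_mult) auto
  have inner: "(\<integral>t. t * F (\<lambda>k. Z k (x, t)) \<partial>std_normal_distribution)
     = (\<integral>t. (\<Sum>k<d. G k (\<lambda>k. Z k (x, t)) * w k) \<partial>std_normal_distribution)" for x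
    unfolding Zp
  proof -
    obtain B where B: "\<And>t. \<bar>F (\<lambda>k. p x k + t * w k)\<bar> \<le> B * exp (B * \<bar>t\<bar>)" using tame_affine_bound[OF F, of "p x" w] by blast
    obtain D where D: "\<And>t. \<bar>\<Sum>k<d. G k (\<lambda>k. p x k + t * w k) * w k\<bar> \<le> D * exp (D * \<bar>t\<bar>)" using tame_affine_bound[OF tG, of "p x" w] by blast
    show "(\<integral>t. t * F (\<lambda>k. p x k + t * w k) \<partial>std_normal_distribution)
     = (\<integral>t. (\<Sum>k<d. G k (\<lambda>k. p x k + t * w k) * w k) \<partial>std_normal_distribution)"
    proof (rule std_normal_integration_by_parts)
      show "((\<lambda>t. F (\<lambda>k. p x k + t * w k)) has_real_derivative (\<Sum>k<d. G k (\<lambda>k. p x k + t * w k) * w k)) (at t)" for t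
        by (rule has_gradientD[OF FG]) (auto intro!: derivative_eq_intros)
      show "continuous_on UNIV (\<lambda>t. \<Sum>k<d. G k (\<lambda>k. p x k + t * w k) * w k)"
        by (rule tame_continuous_on_compose[OF tG]) (auto intro!: continuous_intros)
    qed (use B D in auto)
  qed
  have t1: "tame d (\<lambda>y. y j * F y)" using j F by auto
  have "(\<integral>x. X j x * F (\<lambda>k. X k x) \<partial>M) = (\<integral>z. Z j z * F (\<lambda>k. Z k z) \<partial>?Q)"
    by (rule gaussian_transfer[OF X Z t1])
  also have "\<dots> = (\<integral>x. \<integral>t. Z j (x, t) * F (\<lambda>k. Z k (x, t)) \<partial>std_normal_distribution \<partial>M)"
    by (rule pair_prob_space_integral[OF M prob_space_std_normal gaussian_tame_integrable[OF Z t1]])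
  also have "\<dots> = \<sigma> * (\<integral>x. \<integral>t. (\<Sum>k<d. G k (\<lambda>k. Z k (x, t)) * w k) \<partial>std_normal_distribution \<partial>M)"
    by (simp only: Zj mult.assoc integral_mult_right_zero inner)
  also have "\<dots> = \<sigma> * (\<integral>z. (\<Sum>k<d. G k (\<lambda>k. Z k z) * w k) \<partial>?Q)"
    by (simp only: pair_prob_space_integral[OF M prob_space_std_normal gaussian_tame_integrable[OF Z tG]])
  also have "\<dots> = \<sigma> * (\<integral>x. (\<Sum>k<d. G k (\<lambda>k. X k x) * w k) \<partial>M)"
    by (simp only: gaussian_transfer[OF Z X tG])
  also have "\<dots> = \<sigma> * (\<Sum>k<d. (\<integral>x. G k (\<lambda>k. X k x) \<partial>M) * w k)"
    using gaussian_tame_integrable[OF X G] by (subst Bochner_Integration.integral_sum) auto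
  also have "\<dots> = (\<Sum>k<d. C j k * (\<integral>x. G k (\<lambda>k. X k x) \<partial>M))"
    using \<sigma> by (simp add: sum_distrib_left w_def mult_ac)
  finally show ?thesis .
qed

section \<open>Gaussian interpolation\<close>

lemma integrable_mult_L2:
  fixes f g :: "'a \<Rightarrow> real"
  assumes "f \<in> L2 M" "g \<in> L2 M" shows "integrable M (\<lambda>x. f x * g x)"
proof (rule Bochner_Integration.integrable_bound)
  show "integrable M (\<lambda>x. (f x)\<^sup>2 + (g x)\<^sup>2)" using assms by (auto simp: L2_def)
  show "(\<lambda>x. f x * g x) \<in> borel_measurable M" using assms by (auto simp: L2_def)
  have "\<bar>u * v\<bar> \<le> u\<^sup>2 + v\<^sup>2" for u v :: real
    using sum_squares_bound[of "\<bar>u\<bar>" "\<bar>v\<bar>"] abs_ge_zero[of "u * v"] unfolding abs_mult power2_abs by linarith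
  then show "AE x in M. norm (f x * g x) \<le> norm ((f x)\<^sup>2 + (g x)\<^sup>2)" by simp
qed

lemma gaussian_tame_L2:
  assumes X: "has_gaussian_law M d X C" and F: "tame d F"
  shows "(\<lambda>x. F (\<lambda>k. X k x)) \<in> L2 M"
  using tame_measurable[OF F gaussian_measurable[OF X]] gaussian_tame_integrable[OF X tame_power2[OF F]]
  by (simp add: L2_def)

lemma tame_affine:
  assumes "tame d F" shows "tame d (\<lambda>x. F (\<lambda>k. c k + a * x k))"
proof -
  obtain B where B: "0 \<le> B" "\<And>z s. (\<Sum>k<d. \<bar>z k\<bar>) \<le> (\<Sum>k<d. \<bar>c k\<bar>) + \<bar>a\<bar> * s \<Longrightarrow> 0 \<le> s \<Longrightarrow> \<bar>F z\<bar> \<le> B * exp (B * s)"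
    by (rule tame_linear_growth[OF assms, of "\<bar>a\<bar>" "\<Sum>k<d. \<bar>c k\<bar>"]) auto
  show ?thesis
  proof (rule tameI[where A = B])
    show "\<bar>F (\<lambda>k. c k + a * x k)\<bar> \<le> B * exp (B * (\<Sum>k<d. \<bar>x k\<bar>))" for x
      by (intro B(2) sum_abs_affine_le sum_nonneg) auto
  next
    show "continuous_on UNIV (\<lambda>x. F (\<lambda>k. c k + a * x k))"
      by (intro continuous_on_compose2[OF tame_continuous[OF assms]] continuous_on_coordinatewise_then_product)
         (auto intro!: continuous_intros)
    show "F (\<lambda>k. c k + a * x k) = F (\<lambda>k. c k + a * y k)" if "\<And>k. k < d \<Longrightarrow> x k = y k" for x y
      using that by (intro tame_cong[OF assms]) auto
    show "0 \<le> B" by fact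
  qed
qed

text \<open>The offset \<open>c\<close> will hold the other, independent vector at a fixed sample,
  so that Fubini reduces integration by parts on the product space to this form.\<close>

lemma gaussian_integration_by_parts_affine:
  assumes X: "has_gaussian_law M d X C" and sym: "\<And>k l. C k l = C l k" and j: "j < d" "0 < C j j"
    and F: "tame d F" and G: "\<And>k. k < d \<Longrightarrow> tame d (G k)" and FG: "has_gradient d F G"
  shows "(\<integral>x. X j x * F (\<lambda>k. c k + a * X k x) \<partial>M) = (\<Sum>k<d. C j k * (a * (\<integral>x. G k (\<lambda>k. c k + a * X k x) \<partial>M)))"
proof -
  have "has_gradient d (\<lambda>x. F (\<lambda>k. c k + a * x k)) (\<lambda>k x. a * G k (\<lambda>k. c k + a * x k))"
    unfolding has_gradient_def
  proof (intro allI impI)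
    fix z z' and t :: real assume z: "\<forall>k<d. (z k has_real_derivative z' k) (at t)"
    have "((\<lambda>s. F (\<lambda>k. c k + a * z k s)) has_real_derivative (\<Sum>k<d. G k (\<lambda>k. c k + a * z k t) * (a * z' k))) (at t)"
      by (rule has_gradientD[OF FG]) (use z in \<open>auto intro!: derivative_eq_intros\<close>)
    then show "((\<lambda>s. F (\<lambda>k. c k + a * z k s)) has_real_derivative (\<Sum>k<d. a * G k (\<lambda>k. c k + a * z k t) * z' k)) (at t)"
      by (simp add: mult_ac)
  qed
  from gaussian_integration_by_parts[OF X sym j tame_affine[OF F] tame_mult[OF tame_const tame_affine[OF G]] this]
  show ?thesis by simp
qed

text \<open>Used with \<open>cos\<close> and \<open>sin\<close> for the interpolation path, and with
  the coefficients 1 and 0 to move both vectors to the product space.\<close>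

lemma gaussian_pair_rotation:
  assumes X: "has_gaussian_law M d X C" and Y: "has_gaussian_law N d Y D"
  shows "has_gaussian_law (M \<Otimes>\<^sub>M N) d (\<lambda>k z. a * X k (fst z) + b * Y k (snd z)) (\<lambda>k l. a\<^sup>2 * C k l + b\<^sup>2 * D k l)"
  unfolding has_gaussian_law_def
proof (intro conjI allI impI)
  note [measurable] = gaussian_measurable[OF X] gaussian_measurable[OF Y]
  note M = gaussian_prob_space[OF X] and N = gaussian_prob_space[OF Y]
  show "prob_space (M \<Otimes>\<^sub>M N)"
    by (rule pair_prob_space_prob_space[OF M N])
  show "(\<lambda>z. a * X k (fst z) + b * Y k (snd z)) \<in> borel_measurable (M \<Otimes>\<^sub>M N)" if "k < d" for k
    using that by measurable
  fix c :: "nat \<Rightarrow> real"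
  have "(\<Sum>k<d. c k * (a * X k x + b * Y k y)) = (\<Sum>k<d. (a * c k) * X k x) + (\<Sum>k<d. (b * c k) * Y k y)" for x y
    by (simp add: sum.distrib algebra_simps)
  then have "(CLINT z|(M \<Otimes>\<^sub>M N). iexp (\<Sum>k<d. c k * (a * X k (fst z) + b * Y k (snd z))))
    = (CLINT x|M. iexp (\<Sum>k<d. (a * c k) * X k x)) * (CLINT y|N. iexp (\<Sum>k<d. (b * c k) * Y k y))"
    by (simp only:) (intro pair_integral_iexp M N borel_measurable_sum borel_measurable_times; simp)
  also have "\<dots> = complex_of_real (exp (- (\<Sum>k<d. \<Sum>l<d. (a * c k) * (a * c l) * C k l) / 2 + - (\<Sum>k<d. \<Sum>l<d. (b * c k) * (b * c l) * D k l) / 2))"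
    unfolding gaussian_char[OF X] gaussian_char[OF Y] exp_add by simp
  also have "- (\<Sum>k<d. \<Sum>l<d. (a * c k) * (a * c l) * C k l) / 2 + - (\<Sum>k<d. \<Sum>l<d. (b * c k) * (b * c l) * D k l) / 2
    = - (\<Sum>k<d. \<Sum>l<d. c k * c l * (a\<^sup>2 * C k l + b\<^sup>2 * D k l)) / 2"
    by (simp add: sum.distrib distrib_left sum_distrib_left power2_eq_square mult_ac field_simps)
  finally show "(CLINT z|(M \<Otimes>\<^sub>M N). iexp (\<Sum>k<d. c k * (a * X k (fst z) + b * Y k (snd z))))
     = complex_of_real (exp (- (\<Sum>k<d. \<Sum>l<d. c k * c l * (a\<^sup>2 * C k l + b\<^sup>2 * D k l)) / 2))" .
qed

text \<open>The second factor is the velocity of the path in coordinate \<open>j\<close>.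
  Integration by parts in the first vector yields \<open>- a * b * C\<close>, in the second
  \<open>a * b * D\<close>, which is how the difference of the covariances appears.\<close>

lemma gaussian_interpolation_derivative:
  assumes X: "has_gaussian_law M d X C" and Y: "has_gaussian_law N d Y D"
    and symC: "\<And>k l. C k l = C l k" and symD: "\<And>k l. D k l = D l k"
    and pos: "\<And>k. k < d \<Longrightarrow> 0 < C k k" "\<And>k. k < d \<Longrightarrow> 0 < D k k"
    and F: "tame d F" and G: "\<And>k. k < d \<Longrightarrow> tame d (G k)" and FG: "has_gradient d F G" and j: "j < d"
  shows "(\<integral>z. F (\<lambda>k. a * X k (fst z) + b * Y k (snd z)) * (- b * X j (fst z) + a * Y j (snd z)) \<partial>(M \<Otimes>\<^sub>M N))
     = a * b * (\<Sum>k<d. (D j k - C j k) * (\<integral>z. G k (\<lambda>k. a * X k (fst z) + b * Y k (snd z)) \<partial>(M \<Otimes>\<^sub>M N)))"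
proof -
  let ?Q = "M \<Otimes>\<^sub>M N"
  note M = gaussian_prob_space[OF X] and N = gaussian_prob_space[OF Y]
  interpret M: prob_space M by fact
  interpret N: prob_space N by fact
  interpret P: pair_sigma_finite M N ..
  have Z: "has_gaussian_law ?Q d (\<lambda>k z. a * X k (fst z) + b * Y k (snd z)) (\<lambda>k l. a\<^sup>2 * C k l + b\<^sup>2 * D k l)"
    by (rule gaussian_pair_rotation[OF X Y])
  have X': "has_gaussian_law ?Q d (\<lambda>k z. 1 * X k (fst z) + 0 * Y k (snd z)) (\<lambda>k l. 1\<^sup>2 * C k l + 0\<^sup>2 * D k l)"
    by (rule gaussian_pair_rotation[OF X Y])
  have Y': "has_gaussian_law ?Q d (\<lambda>k z. 0 * X k (fst z) + 1 * Y k (snd z)) (\<lambda>k l. 0\<^sup>2 * C k l + 1\<^sup>2 * D k l)"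
    by (rule gaussian_pair_rotation[OF X Y])
  let ?F = "\<lambda>z. F (\<lambda>k. a * X k (fst z) + b * Y k (snd z))"
  let ?G = "\<lambda>l z. G l (\<lambda>k. a * X k (fst z) + b * Y k (snd z))"
  have iG: "integrable ?Q (?G l)" if "l < d" for l using gaussian_tame_integrable[OF Z G[OF that]] .
  have FL: "?F \<in> L2 ?Q" by (rule gaussian_tame_L2[OF Z F])
  have iX: "integrable ?Q (\<lambda>z. X j (fst z) * ?F z)" and iY: "integrable ?Q (\<lambda>z. Y j (snd z) * ?F z)"
    using integrable_mult_L2[OF _ FL] gaussian_tame_L2[OF X' tame_coord[OF j]] gaussian_tame_L2[OF Y' tame_coord[OF j]] by simp_all
  have swap: "integral\<^sup>L ?Q f = (\<integral>y. \<integral>x. f (x, y) \<partial>M \<partial>N)" if "integrable ?Q f" for f :: "_ \<Rightarrow> real"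
    using P.integral_snd[of "\<lambda>x y. f (x, y)"] that by simp
  have EX: "(\<integral>z. X j (fst z) * ?F z \<partial>?Q) = a * (\<Sum>k<d. C j k * integral\<^sup>L ?Q (?G k))"
  proof -
    have "(\<integral>z. X j (fst z) * ?F z \<partial>?Q) = (\<integral>y. \<integral>x. X j x * F (\<lambda>k. a * X k x + b * Y k y) \<partial>M \<partial>N)"
      by (subst swap[OF iX]) simp
    also have "\<dots> = (\<integral>y. (\<Sum>k<d. C j k * (a * (\<integral>x. G k (\<lambda>k. a * X k x + b * Y k y) \<partial>M))) \<partial>N)"
      using gaussian_integration_by_parts_affine[OF X symC j pos(1)[OF j] F G FG, of "\<lambda>k. b * Y k _" a]
      by (simp add: add.commute)
    also have "\<dots> = (\<Sum>k<d. C j k * (a * integral\<^sup>L ?Q (?G k)))"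
    proof (subst Bochner_Integration.integral_sum)
      fix k assume "k \<in> {..<d}"
      then show "integrable N (\<lambda>y. C j k * (a * (\<integral>x. G k (\<lambda>k. a * X k x + b * Y k y) \<partial>M)))"
        using P.integrable_snd[of "\<lambda>x y. ?G k (x, y)"] iG[of k] by (simp add: case_prod_beta')
    qed (simp add: swap iG)
    finally show ?thesis by (simp add: sum_distrib_left mult_ac)
  qed
  have EY: "(\<integral>z. Y j (snd z) * ?F z \<partial>?Q) = b * (\<Sum>k<d. D j k * integral\<^sup>L ?Q (?G k))"
  proof -
    have "(\<integral>z. Y j (snd z) * ?F z \<partial>?Q) = (\<integral>x. \<integral>y. Y j y * F (\<lambda>k. a * X k x + b * Y k y) \<partial>N \<partial>M)"
      by (subst pair_prob_space_integral[OF M N iY]) simp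
    also have "\<dots> = (\<integral>x. (\<Sum>k<d. D j k * (b * (\<integral>y. G k (\<lambda>k. a * X k x + b * Y k y) \<partial>N))) \<partial>M)"
      using gaussian_integration_by_parts_affine[OF Y symD j pos(2)[OF j] F G FG, of "\<lambda>k. a * X k _" b]
      by simp
    also have "\<dots> = (\<Sum>k<d. D j k * (b * integral\<^sup>L ?Q (?G k)))"
      using P.integrable_fst'[of "?G _"] iG by (subst Bochner_Integration.integral_sum) (auto simp: pair_prob_space_integral[OF M N])
    finally show ?thesis by (simp add: sum_distrib_left mult_ac)
  qed
  have "(\<integral>z. ?F z * (- b * X j (fst z) + a * Y j (snd z)) \<partial>?Q) = (\<integral>z. - b * (X j (fst z) * ?F z) + a * (Y j (snd z) * ?F z) \<partial>?Q)"
    by (simp add: algebra_simps)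
  also have "\<dots> = - b * (a * (\<Sum>k<d. C j k * integral\<^sup>L ?Q (?G k))) + a * (b * (\<Sum>k<d. D j k * integral\<^sup>L ?Q (?G k)))"
    using iX iY EX EY by simp
  also have "\<dots> = a * b * (\<Sum>k<d. (D j k - C j k) * integral\<^sup>L ?Q (?G k))"
    by (simp add: left_diff_distrib sum_subtractf algebra_simps)
  finally show ?thesis .
qed

text \<open>The path is an arc, so for each sample the velocity stays bounded up to both ends.
  Differentiation under the expectation is replaced by the fundamental theorem of calculus for each
  sample, followed by Fubini. The factor \<open>cos \<theta> * sin \<theta>\<close> vanishes at the
  ends, hence the sign condition is asked at interior angles only, away from the degenerate end
  laws.\<close>

lemma gaussian_interpolation_mono:
  assumes X: "has_gaussian_law M d X C" and Y: "has_gaussian_law N d Y D"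
    and symC: "\<And>k l. C k l = C l k" and symD: "\<And>k l. D k l = D l k"
    and pos: "\<And>k. k < d \<Longrightarrow> 0 < C k k" "\<And>k. k < d \<Longrightarrow> 0 < D k k"
    and g: "tame d g" and G: "\<And>k. k < d \<Longrightarrow> tame d (G k)" and H: "\<And>k l. k < d \<Longrightarrow> l < d \<Longrightarrow> tame d (H k l)"
    and gG: "has_gradient d g G" and GH: "\<And>k. k < d \<Longrightarrow> has_gradient d (G k) (H k)"
    and nonneg: "\<And>\<theta> Z. 0 < \<theta> \<Longrightarrow> \<theta> < pi / 2 \<Longrightarrow>
       has_gaussian_law (M \<Otimes>\<^sub>M N) d Z (\<lambda>k l. (cos \<theta>)\<^sup>2 * C k l + (sin \<theta>)\<^sup>2 * D k l) \<Longrightarrow>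
       0 \<le> (\<Sum>k<d. \<Sum>l<d. (D k l - C k l) * (\<integral>z. H k l (\<lambda>k. Z k z) \<partial>(M \<Otimes>\<^sub>M N)))"
  shows "(\<integral>x. g (\<lambda>k. X k x) \<partial>M) \<le> (\<integral>y. g (\<lambda>k. Y k y) \<partial>N)"
proof -
  let ?Q = "M \<Otimes>\<^sub>M N"
  note M = gaussian_prob_space[OF X] and N = gaussian_prob_space[OF Y]
  note [measurable] = gaussian_measurable[OF X] gaussian_measurable[OF Y]
  interpret Q: prob_space ?Q by (rule pair_prob_space_prob_space[OF M N])
  interpret P: pair_sigma_finite lborel ?Q ..
  define Z where "Z \<theta> k z = cos \<theta> * X k (fst z) + sin \<theta> * Y k (snd z)" for \<theta> k z
  define Z' where "Z' \<theta> k z = - sin \<theta> * X k (fst z) + cos \<theta> * Y k (snd z)" for \<theta> k z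
  define \<psi> where "\<psi> \<theta> z = (\<Sum>k<d. G k (\<lambda>k. Z \<theta> k z) * Z' \<theta> k z)" for \<theta> z
  have Z: "has_gaussian_law ?Q d (Z \<theta>) (\<lambda>k l. (cos \<theta>)\<^sup>2 * C k l + (sin \<theta>)\<^sup>2 * D k l)" for \<theta>
    unfolding Z_def by (rule gaussian_pair_rotation[OF X Y])
  have Z0: "has_gaussian_law ?Q d (\<lambda>k z. X k (fst z)) C" and Z1: "has_gaussian_law ?Q d (\<lambda>k z. Y k (snd z)) D"
    using gaussian_pair_rotation[OF X Y, of 1 0] gaussian_pair_rotation[OF X Y, of 0 1] by simp_all
  have sum_nonneg': "0 \<le> (\<Sum>k<d. \<bar>h k\<bar>)" for h :: "nat \<Rightarrow> real" by (intro sum_nonneg) auto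
  define S where "S z = (\<Sum>k<d. \<bar>X k (fst z)\<bar>) + (\<Sum>k<d. \<bar>Y k (snd z)\<bar>)" for z
  have intS: "integrable ?Q (\<lambda>z. exp (A * S z))" if "0 \<le> A" for A
  proof (rule Bochner_Integration.integrable_bound)
    show "integrable ?Q (\<lambda>z. exp ((2 * A) * (\<Sum>k<d. \<bar>X k (fst z)\<bar>)) + exp ((2 * A) * (\<Sum>k<d. \<bar>Y k (snd z)\<bar>)))"
      using gaussian_integrable_exp_sum[OF Z0, of "2 * A"] gaussian_integrable_exp_sum[OF Z1, of "2 * A"] that by auto
    show "(\<lambda>z. exp (A * S z)) \<in> borel_measurable ?Q"
      unfolding S_def by (auto intro!: borel_measurable_exp borel_measurable_times borel_measurable_add borel_measurable_sum borel_measurable_abs)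
    have "exp (A * (u + v)) \<le> exp (2 * A * u) + exp (2 * A * v)" for u v
    proof (cases "u \<le> v")
      case True
      then have "A * (u + v) \<le> 2 * A * v" using mult_left_mono[OF True that] by (simp add: algebra_simps)
      then show ?thesis by (simp add: add_increasing)
    next
      case False
      then have "A * (u + v) \<le> 2 * A * u" using mult_left_mono[of v u A] that by (simp add: algebra_simps)
      then show ?thesis by (simp add: add_increasing2)
    qed
    then show "AE z in ?Q. norm (exp (A * S z)) \<le> norm (exp ((2 * A) * (\<Sum>k<d. \<bar>X k (fst z)\<bar>)) + exp ((2 * A) * (\<Sum>k<d. \<bar>Y k (snd z)\<bar>)))"
      unfolding S_def by (auto simp: abs_of_nonneg add_nonneg_nonneg)
  qed
  have comb: "\<bar>a * u + b * v\<bar> \<le> \<bar>u\<bar> + \<bar>v\<bar>" if "\<bar>a\<bar> \<le> 1" "\<bar>b\<bar> \<le> 1" for a b u v :: real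
    using abs_triangle_ineq[of "a * u" "b * v"] mult_right_mono[OF that(1) abs_ge_zero[of u]]
      mult_right_mono[OF that(2) abs_ge_zero[of v]] by (simp add: abs_mult)
  have rot: "\<bar>cos \<theta> * u + sin \<theta> * v\<bar> \<le> \<bar>u\<bar> + \<bar>v\<bar>" "\<bar>- sin \<theta> * u + cos \<theta> * v\<bar> \<le> \<bar>u\<bar> + \<bar>v\<bar>" for \<theta> u v :: real
    by (intro comb; simp)+
  have Zb: "(\<Sum>k<d. \<bar>Z \<theta> k z\<bar>) \<le> S z" for \<theta> z
    unfolding S_def Z_def sum.distrib[symmetric] by (intro sum_mono rot)
  have Z'b: "\<bar>Z' \<theta> k z\<bar> \<le> S z" if "k < d" for \<theta> k z
  proof -
    have "\<bar>Z' \<theta> k z\<bar> \<le> \<bar>X k (fst z)\<bar> + \<bar>Y k (snd z)\<bar>" unfolding Z'_def by (rule rot)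
    also have "\<dots> \<le> S z" unfolding S_def using that by (intro add_mono member_le_sum) auto
    finally show ?thesis .
  qed
  have "\<exists>A. \<forall>k<d. (\<forall>x. \<bar>G k x\<bar> \<le> A k * exp (A k * (\<Sum>k<d. \<bar>x k\<bar>))) \<and> 0 \<le> A k"
    using tame_bound[OF G] by (intro choice_iff'[THEN iffD1]) metis
  then obtain A where A: "\<And>k x. k < d \<Longrightarrow> \<bar>G k x\<bar> \<le> A k * exp (A k * (\<Sum>k<d. \<bar>x k\<bar>))" "\<And>k. k < d \<Longrightarrow> 0 \<le> A k" by blast
  \<comment> \<open>Majorant of the path derivative, uniform in the angle; the \<open>+ 1\<close> in
    the exponent absorbs the velocity, which is at most \<open>S z \<le> exp (S z)\<close>.\<close>
  define D' where "D' z = (\<Sum>k<d. A k * exp ((A k + 1) * S z))" for z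
  have intD': "integrable ?Q D'"
    unfolding D'_def using A(2) by (intro Bochner_Integration.integrable_sum integrable_mult_right intS) (auto intro: add_nonneg_nonneg)
  have GZb: "\<bar>G k (\<lambda>k. Z \<theta> k z) * Z' \<theta> k z\<bar> \<le> A k * exp ((A k + 1) * S z)" if k: "k < d" for \<theta> z k
  proof -
    have "\<bar>G k (\<lambda>k. Z \<theta> k z)\<bar> \<le> A k * exp (A k * S z)"
      using A[OF k] mult_left_mono[OF Zb A(2)[OF k], of \<theta> z] by (meson exp_le_cancel_iff mult_left_mono order_trans)
    moreover have "\<bar>Z' \<theta> k z\<bar> \<le> exp (S z)" using Z'b[OF k, of \<theta> z] exp_ge_add_one_self[of "S z"] by linarith
    ultimately have "\<bar>G k (\<lambda>k. Z \<theta> k z)\<bar> * \<bar>Z' \<theta> k z\<bar> \<le> (A k * exp (A k * S z)) * exp (S z)"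
      using A(2)[OF k] by (intro mult_mono) auto
    then show ?thesis by (simp add: abs_mult exp_add[symmetric] algebra_simps)
  qed
  have \<psi>b: "\<bar>\<psi> \<theta> z\<bar> \<le> D' z" for \<theta> z
    unfolding \<psi>_def D'_def by (rule order_trans[OF sum_abs]) (intro sum_mono GZb, simp)
  have D'nn: "0 \<le> D' z" for z using \<psi>b[of 0 z] by linarith
  let ?I = "{0..pi/2} :: real set"
  have m\<psi>: "(\<lambda>p. indicator ?I (fst p) * \<psi> (fst p) (snd p)) \<in> borel_measurable (lborel \<Otimes>\<^sub>M ?Q)"
    unfolding \<psi>_def Z_def Z'_def
    by (intro borel_measurable_times borel_measurable_sum tame_measurable[OF G] borel_measurable_add) measurable
  have "integrable (lborel \<Otimes>\<^sub>M ?Q) (\<lambda>p. indicator ?I (fst p) * D' (snd p))"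
  proof (rule P.Fubini_integrable)
    have [measurable]: "D' \<in> borel_measurable ?Q" using intD' by auto
    show "(\<lambda>p. indicator ?I (fst p) * D' (snd p)) \<in> borel_measurable (lborel \<Otimes>\<^sub>M ?Q)" by measurable
    show "integrable lborel (\<lambda>\<theta>. \<integral>z. norm (indicator ?I (fst (\<theta>, z)) * D' (snd (\<theta>, z))) \<partial>?Q)"
      by (simp add: abs_mult D'nn)
    show "AE \<theta> in lborel. integrable ?Q (\<lambda>z. indicator ?I (fst (\<theta>, z)) * D' (snd (\<theta>, z)))"
      using intD' by simp
  qed
  then have int\<psi>: "integrable (lborel \<Otimes>\<^sub>M ?Q) (\<lambda>p. indicator ?I (fst p) * \<psi> (fst p) (snd p))"
    by (rule Bochner_Integration.integrable_bound[OF _ m\<psi>])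
       (use \<psi>b D'nn in \<open>auto simp: abs_mult indicator_def\<close>)
  have ftc: "(\<integral>\<theta>. indicator ?I \<theta> * \<psi> \<theta> z \<partial>lborel) = g (\<lambda>k. Y k (snd z)) - g (\<lambda>k. X k (fst z))" for z
  proof -
    have dZ: "((\<lambda>\<theta>. Z \<theta> k z) has_real_derivative Z' \<theta> k z) (at \<theta>)" for k \<theta>
      unfolding Z_def Z'_def by (auto intro!: derivative_eq_intros)
    have dg: "((\<lambda>\<theta>. g (\<lambda>k. Z \<theta> k z)) has_real_derivative \<psi> \<theta> z) (at \<theta>)" for \<theta>
      unfolding \<psi>_def by (rule has_gradientD[OF gG, of "\<lambda>k \<theta>. Z \<theta> k z"]) (rule dZ)
    have "continuous_on UNIV (\<lambda>\<theta>. \<psi> \<theta> z)"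
      unfolding \<psi>_def Z_def Z'_def
      by (intro continuous_on_sum continuous_on_mult tame_continuous_on_compose[OF G]) (auto intro!: continuous_intros)
    then have "(\<integral>\<theta>. \<psi> \<theta> z * indicator ?I \<theta> \<partial>lborel) = g (\<lambda>k. Z (pi/2) k z) - g (\<lambda>k. Z 0 k z)"
      by (intro integral_FTC_Icc_real dg) (auto simp: continuous_on_eq_continuous_at)
    then show ?thesis by (simp add: Z_def mult.commute)
  qed
  have E\<psi>: "(\<integral>z. \<psi> \<theta> z \<partial>?Q) = cos \<theta> * sin \<theta> * (\<Sum>k<d. \<Sum>l<d. (D k l - C k l) * (\<integral>z. H k l (\<lambda>k. Z \<theta> k z) \<partial>?Q))" for \<theta>
  proof -
    have iGZ: "integrable ?Q (\<lambda>z. G k (\<lambda>k. Z \<theta> k z) * Z' \<theta> k z)" if k: "k < d" for k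
    proof (rule Bochner_Integration.integrable_bound)
      show "integrable ?Q (\<lambda>z. A k * exp ((A k + 1) * S z))" using A(2)[OF k] by (intro integrable_mult_right intS) auto
      show "(\<lambda>z. G k (\<lambda>k. Z \<theta> k z) * Z' \<theta> k z) \<in> borel_measurable ?Q"
        unfolding Z_def Z'_def using k
        by (intro borel_measurable_times tame_measurable[OF G] borel_measurable_add) measurable
      show "AE z in ?Q. norm (G k (\<lambda>k. Z \<theta> k z) * Z' \<theta> k z) \<le> norm (A k * exp ((A k + 1) * S z))"
        using A(2)[OF k] GZb[OF k] by simp
    qed
    have "(\<integral>z. \<psi> \<theta> z \<partial>?Q) = (\<Sum>k<d. \<integral>z. G k (\<lambda>k. Z \<theta> k z) * Z' \<theta> k z \<partial>?Q)"
      unfolding \<psi>_def using iGZ by (intro Bochner_Integration.integral_sum) auto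
    also have "\<dots> = (\<Sum>k<d. cos \<theta> * sin \<theta> * (\<Sum>l<d. (D k l - C k l) * (\<integral>z. H k l (\<lambda>k. Z \<theta> k z) \<partial>?Q)))"
      unfolding Z_def Z'_def
      by (intro sum.cong refl gaussian_interpolation_derivative[OF X Y symC symD pos G H GH]) auto
    finally show ?thesis by (simp add: sum_distrib_left)
  qed
  have nn: "0 \<le> (\<integral>z. indicator ?I \<theta> * \<psi> \<theta> z \<partial>?Q)" for \<theta>
  proof -
    consider "\<theta> \<notin> ?I" | "cos \<theta> * sin \<theta> = 0" | "0 < \<theta>" "\<theta> < pi / 2"
      by (cases "\<theta> = 0"; cases "\<theta> = pi / 2"; force)
    then show ?thesis
    proof cases
      case 3
      then show ?thesis unfolding integral_mult_right_zero E\<psi>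
        using cos_gt_zero[of \<theta>] sin_gt_zero[of \<theta>] by (intro mult_nonneg_nonneg nonneg[OF _ _ Z]) auto
    qed (auto simp: E\<psi>)
  qed
  have "(\<integral>y. g (\<lambda>k. Y k y) \<partial>N) - (\<integral>x. g (\<lambda>k. X k x) \<partial>M) = (\<integral>z. g (\<lambda>k. Y k (snd z)) \<partial>?Q) - (\<integral>z. g (\<lambda>k. X k (fst z)) \<partial>?Q)"
    using gaussian_transfer[OF X Z0 g] gaussian_transfer[OF Y Z1 g] by simp
  also have "\<dots> = (\<integral>z. g (\<lambda>k. Y k (snd z)) - g (\<lambda>k. X k (fst z)) \<partial>?Q)"
    using gaussian_tame_integrable[OF Z0 g] gaussian_tame_integrable[OF Z1 g] by simp
  also have "\<dots> = (\<integral>z. \<integral>\<theta>. indicator ?I \<theta> * \<psi> \<theta> z \<partial>lborel \<partial>?Q)" by (simp add: ftc)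
  also have "\<dots> = (\<integral>\<theta>. \<integral>z. indicator ?I \<theta> * \<psi> \<theta> z \<partial>?Q \<partial>lborel)"
    using int\<psi> by (intro P.Fubini_integral) (simp add: case_prod_beta')
  also have "\<dots> \<ge> 0" by (rule Bochner_Integration.integral_nonneg) (rule nn)
  finally show ?thesis by simp
qed

section \<open>The soft maximum\<close>

lemma tame_linear_boundI:
  assumes "continuous_on UNIV F" "\<And>x y. (\<And>k. k < d \<Longrightarrow> x k = y k) \<Longrightarrow> F x = F y"
    and b: "\<And>x. \<bar>F x\<bar> \<le> c + (\<Sum>k<d. \<bar>x k\<bar>)" and c: "0 \<le> c"
  shows "tame d F"
proof (rule tameI[OF assms(1,2), where A = "1 + c"])
  fix x :: "nat \<Rightarrow> real"
  let ?s = "\<Sum>k<d. \<bar>x k\<bar>"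
  have s: "0 \<le> ?s" by (intro sum_nonneg) auto
  then have "c + ?s \<le> (1 + c) * (1 + ?s)" using c by (simp add: algebra_simps)
  also have "\<dots> \<le> (1 + c) * exp ?s" using c exp_ge_add_one_self[of ?s] by (intro mult_left_mono) auto
  also have "\<dots> \<le> (1 + c) * exp ((1 + c) * ?s)" using c s by (intro mult_left_mono) (auto simp: distrib_right)
  finally show "\<bar>F x\<bar> \<le> (1 + c) * exp ((1 + c) * ?s)" using b[of x] by linarith
qed (use c in auto)

text \<open>The Gibbs weights at inverse temperature \<beta>, called \<open>q\<close> above.\<close>

definition soft_weight :: "nat \<Rightarrow> real \<Rightarrow> nat \<Rightarrow> (nat \<Rightarrow> real) \<Rightarrow> real" where
  "soft_weight d \<beta> k x = exp (\<beta> * x k) / (\<Sum>l<d. exp (\<beta> * x l))"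

lemma soft_den_pos:
  fixes x :: "nat \<Rightarrow> real"
  assumes "0 < d" shows "0 < (\<Sum>l<d. exp (\<beta> * x l))"
  using assms by (intro sum_pos) auto

lemma soft_weight_pos: "0 < d \<Longrightarrow> 0 < soft_weight d \<beta> k x"
  using soft_den_pos[of d \<beta> x] by (simp add: soft_weight_def)

lemma soft_weight_le_1:
  assumes "k < d" shows "soft_weight d \<beta> k x \<le> 1"
proof -
  have "exp (\<beta> * x k) \<le> (\<Sum>l<d. exp (\<beta> * x l))" using assms by (intro member_le_sum) auto
  then show ?thesis using soft_den_pos[of d \<beta> x] assms by (simp add: soft_weight_def)
qed

lemma sum_soft_weight: "0 < d \<Longrightarrow> (\<Sum>k<d. soft_weight d \<beta> k x) = 1"
  using soft_den_pos[of d \<beta> x] by (simp add: soft_weight_def sum_divide_distrib[symmetric])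

lemma soft_max_ge:
  assumes "0 < \<beta>" "k < d" shows "x k \<le> soft_max d \<beta> x"
proof -
  have "exp (\<beta> * x k) \<le> (\<Sum>l<d. exp (\<beta> * x l))" using assms by (intro member_le_sum) auto
  then have "\<beta> * x k \<le> ln (\<Sum>l<d. exp (\<beta> * x l))"
    using soft_den_pos[of d \<beta> x] assms by (subst ln_ge_iff) auto
  then show ?thesis using assms by (simp add: soft_max_def field_simps)
qed

lemma soft_max_le:
  assumes "0 < \<beta>" "0 < d" "\<And>k. k < d \<Longrightarrow> x k \<le> m"
  shows "soft_max d \<beta> x \<le> m + ln d / \<beta>"
proof -
  have "(\<Sum>l<d. exp (\<beta> * x l)) \<le> d * exp (\<beta> * m)"
    using sum_bounded_above[of "{..<d}" "\<lambda>l. exp (\<beta> * x l)" "exp (\<beta> * m)"] assms by auto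
  then have "ln (\<Sum>l<d. exp (\<beta> * x l)) \<le> ln (d * exp (\<beta> * m))"
    using soft_den_pos[of d \<beta> x] assms by (subst ln_le_cancel_iff) auto
  also have "\<dots> = ln d + \<beta> * m" using assms by (simp add: ln_mult)
  finally show ?thesis using assms by (simp add: soft_max_def field_simps)
qed

lemma tame_soft_max:
  assumes "0 < \<beta>" "0 < d" shows "tame d (soft_max d \<beta>)"
proof (rule tame_linear_boundI)
  show "continuous_on UNIV (soft_max d \<beta>)"
    unfolding soft_max_def using soft_den_pos[OF assms(2), of \<beta>] assms(1)
    by (auto intro!: continuous_intros simp: less_imp_neq[symmetric])
  show "soft_max d \<beta> x = soft_max d \<beta> y" if "\<And>k. k < d \<Longrightarrow> x k = y k" for x y
    using that by (simp add: soft_max_def)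
  show "\<bar>soft_max d \<beta> x\<bar> \<le> ln d / \<beta> + (\<Sum>k<d. \<bar>x k\<bar>)" for x
  proof -
    have le: "\<bar>x k\<bar> \<le> (\<Sum>k<d. \<bar>x k\<bar>)" if "k < d" for k using that by (intro member_le_sum) auto
    have "soft_max d \<beta> x \<le> (\<Sum>k<d. \<bar>x k\<bar>) + ln d / \<beta>"
      using le assms by (intro soft_max_le) (auto intro: order_trans[OF abs_ge_self])
    moreover have "- (\<Sum>k<d. \<bar>x k\<bar>) \<le> soft_max d \<beta> x"
      using soft_max_ge[OF assms, of x] le[OF assms(2)] by linarith
    moreover have "0 \<le> ln d / \<beta>" using assms by simp
    ultimately show ?thesis by linarith
  qed
  show "0 \<le> ln d / \<beta>" using assms by simp
qed

lemma tame_soft_weight [intro]: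
  assumes "k < d" shows "tame d (soft_weight d \<beta> k)"
proof (rule tame_linear_boundI)
  show "continuous_on UNIV (soft_weight d \<beta> k)"
    unfolding soft_weight_def using soft_den_pos[of d \<beta>] assms
    by (auto intro!: continuous_intros simp: less_imp_neq[symmetric])
  show "soft_weight d \<beta> k x = soft_weight d \<beta> k y" if "\<And>k. k < d \<Longrightarrow> x k = y k" for x y
    using that assms by (simp add: soft_weight_def)
  show "\<bar>soft_weight d \<beta> k x\<bar> \<le> 1 + (\<Sum>k<d. \<bar>x k\<bar>)" for x
    using soft_weight_le_1[OF assms, of \<beta> x] soft_weight_pos[of d \<beta> k x] assms sum_nonneg[of "{..<d}" "\<lambda>k. \<bar>x k\<bar>"]
    by (simp add: add_increasing2)
qed simp

lemma has_gradient_soft_max: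
  assumes "0 < \<beta>" "0 < d" shows "has_gradient d (soft_max d \<beta>) (soft_weight d \<beta>)"
  unfolding has_gradient_def
proof (intro allI impI)
  fix z z' and t :: real assume z: "\<forall>k<d. (z k has_real_derivative z' k) (at t)"
  have D: "((\<lambda>s. \<Sum>l<d. exp (\<beta> * z l s)) has_real_derivative (\<Sum>l<d. exp (\<beta> * z l t) * (\<beta> * z' l))) (at t)"
    using z by (intro DERIV_sum) (auto intro!: derivative_eq_intros)
  have "((\<lambda>s. (1 / \<beta>) * ln (\<Sum>l<d. exp (\<beta> * z l s))) has_real_derivative
     (1 / \<beta>) * (inverse (\<Sum>l<d. exp (\<beta> * z l t)) * (\<Sum>l<d. exp (\<beta> * z l t) * (\<beta> * z' l)))) (at t)"
    by (intro DERIV_cmult DERIV_chain2[OF DERIV_ln D] soft_den_pos assms)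
  also have "(1 / \<beta>) * (inverse (\<Sum>l<d. exp (\<beta> * z l t)) * (\<Sum>l<d. exp (\<beta> * z l t) * (\<beta> * z' l)))
      = (\<Sum>k<d. soft_weight d \<beta> k (\<lambda>k. z k t) * z' k)"
    using assms by (simp add: soft_weight_def sum_distrib_left field_simps)
  finally show "((\<lambda>s. soft_max d \<beta> (\<lambda>k. z k s)) has_real_derivative (\<Sum>k<d. soft_weight d \<beta> k (\<lambda>k. z k t) * z' k)) (at t)"
    by (simp add: soft_max_def)
qed

lemma has_gradient_soft_weight:
  assumes k: "k < d"
  shows "has_gradient d (soft_weight d \<beta> k)
    (\<lambda>l x. \<beta> * ((if l = k then soft_weight d \<beta> k x else 0) - soft_weight d \<beta> k x * soft_weight d \<beta> l x))"
  unfolding has_gradient_def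
proof (intro allI impI)
  fix z z' and t :: real assume z: "\<forall>k<d. (z k has_real_derivative z' k) (at t)"
  define D where "D = (\<Sum>l<d. exp (\<beta> * z l t))"
  have D: "((\<lambda>s. \<Sum>l<d. exp (\<beta> * z l s)) has_real_derivative (\<Sum>l<d. exp (\<beta> * z l t) * (\<beta> * z' l))) (at t)"
    using z by (intro DERIV_sum) (auto intro!: derivative_eq_intros)
  have D0: "D \<noteq> 0" using soft_den_pos[of d \<beta> "\<lambda>l. z l t"] k by (auto simp: D_def)
  have E: "((\<lambda>s. exp (\<beta> * z k s)) has_real_derivative exp (\<beta> * z k t) * (\<beta> * z' k)) (at t)"
    using z k by (auto intro!: derivative_eq_intros)
  have "((\<lambda>s. exp (\<beta> * z k s) / (\<Sum>l<d. exp (\<beta> * z l s))) has_real_derivative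
     (exp (\<beta> * z k t) * (\<beta> * z' k) * D - exp (\<beta> * z k t) * (\<Sum>l<d. exp (\<beta> * z l t) * (\<beta> * z' l))) / (D * D)) (at t)"
    unfolding D_def by (intro DERIV_divide E D) (use D0 in \<open>simp add: D_def\<close>)
  also have "(exp (\<beta> * z k t) * (\<beta> * z' k) * D - exp (\<beta> * z k t) * (\<Sum>l<d. exp (\<beta> * z l t) * (\<beta> * z' l))) / (D * D)
    = \<beta> * (exp (\<beta> * z k t) / D * z' k - exp (\<beta> * z k t) / D * (\<Sum>l<d. exp (\<beta> * z l t) / D * z' l))"
    using D0 by (simp add: sum_distrib_left sum_divide_distrib[symmetric] field_simps)
  also have "\<dots> = (\<Sum>l<d. \<beta> * ((if l = k then soft_weight d \<beta> k (\<lambda>k. z k t) else 0)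
       - soft_weight d \<beta> k (\<lambda>k. z k t) * soft_weight d \<beta> l (\<lambda>k. z k t)) * z' l)"
    using k by (simp add: soft_weight_def D_def[symmetric] left_diff_distrib right_diff_distrib sum_subtractf sum_distrib_left
        if_distrib[where f = "\<lambda>a. a * _"] if_distrib[where f = "\<lambda>a. _ * a"] mult_ac cong: if_cong)
  finally show "((\<lambda>s. soft_weight d \<beta> k (\<lambda>k. z k s)) has_real_derivative (\<Sum>l<d. \<beta> * ((if l = k then soft_weight d \<beta> k (\<lambda>k. z k t) else 0)
       - soft_weight d \<beta> k (\<lambda>k. z k t) * soft_weight d \<beta> l (\<lambda>k. z k t)) * z' l)) (at t)"
    by (simp add: soft_weight_def)
qed

section \<open>The squared gap and its first two derivatives\<close>

definition soft_gap :: "nat \<Rightarrow> real \<Rightarrow> (nat \<Rightarrow> real) \<Rightarrow> (nat \<Rightarrow> real) \<Rightarrow> real" where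
  "soft_gap d \<beta> a x = soft_max d \<beta> x - (\<Sum>k<d. a k * x k)"

lemma tame_soft_gap:
  assumes "0 < \<beta>" "0 < d" shows "tame d (soft_gap d \<beta> a)"
  unfolding soft_gap_def by (intro tame_diff tame_soft_max tame_sum tame_mult tame_const tame_coord assms) auto

lemma soft_gap_nonneg:
  assumes "0 < \<beta>" "\<And>k. k < d \<Longrightarrow> 0 \<le> a k" "(\<Sum>k<d. a k) = 1"
  shows "0 \<le> soft_gap d \<beta> a x"
proof -
  have "(\<Sum>k<d. a k * x k) \<le> (\<Sum>k<d. a k * soft_max d \<beta> x)"
    using assms by (intro sum_mono mult_left_mono soft_max_ge) auto
  also have "\<dots> = soft_max d \<beta> x" using assms(3) by (simp add: sum_distrib_right[symmetric])
  finally show ?thesis by (simp add: soft_gap_def)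
qed

lemma has_gradient_soft_gap:
  assumes "0 < \<beta>" "0 < d" shows "has_gradient d (soft_gap d \<beta> a) (\<lambda>k x. soft_weight d \<beta> k x - a k)"
  unfolding has_gradient_def
proof (intro allI impI)
  fix z z' and t :: real assume z: "\<forall>k<d. (z k has_real_derivative z' k) (at t)"
  have "((\<lambda>s. soft_max d \<beta> (\<lambda>k. z k s) - (\<Sum>k<d. a k * z k s)) has_real_derivative
     (\<Sum>k<d. soft_weight d \<beta> k (\<lambda>k. z k t) * z' k) - (\<Sum>k<d. a k * z' k)) (at t)"
    using z by (intro DERIV_diff has_gradientD[OF has_gradient_soft_max[OF assms]] DERIV_sum DERIV_cmult) auto
  then show "((\<lambda>s. soft_gap d \<beta> a (\<lambda>k. z k s)) has_real_derivative
     (\<Sum>k<d. (soft_weight d \<beta> k (\<lambda>k. z k t) - a k) * z' k)) (at t)"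
    by (simp add: soft_gap_def left_diff_distrib sum_subtractf)
qed

definition gap_energy_grad :: "nat \<Rightarrow> real \<Rightarrow> (nat \<Rightarrow> real) \<Rightarrow> nat \<Rightarrow> (nat \<Rightarrow> real) \<Rightarrow> real" where
  "gap_energy_grad d \<beta> a k x = 2 * (soft_gap d \<beta> a x + 1 / \<beta>) * (soft_weight d \<beta> k x - a k)"

definition gap_energy_hess :: "nat \<Rightarrow> real \<Rightarrow> (nat \<Rightarrow> real) \<Rightarrow> nat \<Rightarrow> nat \<Rightarrow> (nat \<Rightarrow> real) \<Rightarrow> real" where
  "gap_energy_hess d \<beta> a k l x = 2 * (soft_weight d \<beta> l x - a l) * (soft_weight d \<beta> k x - a k)
     + 2 * (soft_gap d \<beta> a x + 1 / \<beta>) * (\<beta> * ((if l = k then soft_weight d \<beta> k x else 0) - soft_weight d \<beta> k x * soft_weight d \<beta> l x))"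

text \<open>These entries are the ones that matter: both interpolations below join covariances with
  the same unit diagonal, so diagonal entries are multiplied by 0.\<close>

lemma gap_energy_hess_off_diagonal:
  assumes "0 < \<beta>" "l \<noteq> k"
  shows "gap_energy_hess d \<beta> a k l x = - 2 * \<beta> * (soft_gap d \<beta> a x * soft_weight d \<beta> k x * soft_weight d \<beta> l x)
     - 2 * a k * soft_weight d \<beta> l x - 2 * a l * soft_weight d \<beta> k x + 2 * a k * a l"
  using assms by (simp add: gap_energy_hess_def field_simps)

lemma
  assumes "0 < \<beta>" "0 < d"
  shows tame_gap_energy: "tame d (\<lambda>x. (soft_gap d \<beta> a x + 1 / \<beta>)\<^sup>2)"
    and tame_gap_energy_grad: "k < d \<Longrightarrow> tame d (gap_energy_grad d \<beta> a k)"
    and tame_gap_energy_hess: "k < d \<Longrightarrow> l < d \<Longrightarrow> tame d (gap_energy_hess d \<beta> a k l)"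
proof -
  note t = tame_soft_gap[OF assms]
  show "tame d (\<lambda>x. (soft_gap d \<beta> a x + 1 / \<beta>)\<^sup>2)" by (intro tame_power2 tame_add tame_const t)
  show "tame d (gap_energy_grad d \<beta> a k)" if "k < d"
    unfolding gap_energy_grad_def by (intro tame_mult tame_diff tame_add tame_const t tame_soft_weight that)
  show "tame d (gap_energy_hess d \<beta> a k l)" if "k < d" "l < d"
    unfolding gap_energy_hess_def
    by (cases "l = k"; simp) (intro tame_mult tame_diff tame_add tame_const t tame_soft_weight that tame_power2)+
qed

lemma has_gradient_gap_energy:
  assumes "0 < \<beta>" "0 < d" shows "has_gradient d (\<lambda>x. (soft_gap d \<beta> a x + 1 / \<beta>)\<^sup>2) (gap_energy_grad d \<beta> a)"
  unfolding has_gradient_def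
proof (intro allI impI)
  fix z z' and t :: real assume z: "\<forall>k<d. (z k has_real_derivative z' k) (at t)"
  note h = has_gradientD[OF has_gradient_soft_gap[OF assms], of z z' t a]
  have "((\<lambda>s. (soft_gap d \<beta> a (\<lambda>k. z k s) + 1 / \<beta>)\<^sup>2) has_real_derivative
      2 * (soft_gap d \<beta> a (\<lambda>k. z k t) + 1 / \<beta>) * (\<Sum>k<d. (soft_weight d \<beta> k (\<lambda>k. z k t) - a k) * z' k)) (at t)"
    using z by (auto intro!: derivative_eq_intros h)
  then show "((\<lambda>s. (soft_gap d \<beta> a (\<lambda>k. z k s) + 1 / \<beta>)\<^sup>2) has_real_derivative
      (\<Sum>k<d. gap_energy_grad d \<beta> a k (\<lambda>k. z k t) * z' k)) (at t)"
    by (simp add: gap_energy_grad_def sum_distrib_left mult.assoc)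
qed

lemma has_gradient_gap_energy_grad:
  assumes "0 < \<beta>" "k < d" shows "has_gradient d (gap_energy_grad d \<beta> a k) (gap_energy_hess d \<beta> a k)"
  unfolding has_gradient_def
proof (intro allI impI)
  fix z z' and t :: real assume z: "\<forall>k<d. (z k has_real_derivative z' k) (at t)"
  have d: "0 < d" using assms by simp
  let ?h = "soft_gap d \<beta> a (\<lambda>k. z k t)" and ?q = "\<lambda>l. soft_weight d \<beta> l (\<lambda>k. z k t)"
  let ?h' = "\<Sum>l<d. (?q l - a l) * z' l"
  let ?q' = "\<Sum>l<d. \<beta> * ((if l = k then ?q k else 0) - ?q k * ?q l) * z' l"
  have h: "((\<lambda>s. soft_gap d \<beta> a (\<lambda>k. z k s)) has_real_derivative ?h') (at t)"
    using z by (intro has_gradientD[OF has_gradient_soft_gap[OF assms(1) d]]) auto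
  have q: "((\<lambda>s. soft_weight d \<beta> k (\<lambda>k. z k s)) has_real_derivative ?q') (at t)"
    using z by (intro has_gradientD[OF has_gradient_soft_weight[OF assms(2)]]) auto
  have "((\<lambda>s. gap_energy_grad d \<beta> a k (\<lambda>k. z k s)) has_real_derivative 2 * ?h' * (?q k - a k) + 2 * (?h + 1 / \<beta>) * ?q') (at t)"
    unfolding gap_energy_grad_def
    by (rule DERIV_cong[OF DERIV_mult[OF DERIV_cmult[OF DERIV_add[OF h DERIV_const]] DERIV_diff[OF q DERIV_const]]]) (simp add: mult_ac)
  also have "2 * ?h' * (?q k - a k) + 2 * (?h + 1 / \<beta>) * ?q' = (\<Sum>l<d. gap_energy_hess d \<beta> a k l (\<lambda>k. z k t) * z' l)"
    unfolding gap_energy_hess_def distrib_right sum.distrib by (simp only: sum_distrib_left sum_distrib_right mult_ac)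
  finally show "((\<lambda>s. gap_energy_grad d \<beta> a k (\<lambda>k. z k s)) has_real_derivative (\<Sum>l<d. gap_energy_hess d \<beta> a k l (\<lambda>k. z k t) * z' l)) (at t)" .
qed

section \<open>Weighted soft gaps\<close>

definition gap_energy :: "nat \<Rightarrow> real \<Rightarrow> (nat \<Rightarrow> real) \<Rightarrow> 'a measure \<Rightarrow> (nat \<Rightarrow> 'a \<Rightarrow> real) \<Rightarrow> real" where
  "gap_energy d \<beta> a M X = (\<integral>x. (soft_gap d \<beta> a (\<lambda>k. X k x) + 1 / \<beta>)\<^sup>2 \<partial>M)"

definition mean_weight :: "nat \<Rightarrow> real \<Rightarrow> 'a measure \<Rightarrow> (nat \<Rightarrow> 'a \<Rightarrow> real) \<Rightarrow> nat \<Rightarrow> real" where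
  "mean_weight d \<beta> M X k = (\<integral>x. soft_weight d \<beta> k (\<lambda>k. X k x) \<partial>M)"

lemma mean_weight_nonneg: "0 < d \<Longrightarrow> 0 \<le> mean_weight d \<beta> M X k"
  unfolding mean_weight_def by (intro Bochner_Integration.integral_nonneg less_imp_le soft_weight_pos)

lemma sum_mean_weight:
  assumes X: "has_gaussian_law M d X C" and d: "0 < d"
  shows "(\<Sum>k<d. mean_weight d \<beta> M X k) = 1"
proof -
  interpret prob_space M using X by (rule gaussian_prob_space)
  have "(\<Sum>k<d. mean_weight d \<beta> M X k) = (\<integral>x. (\<Sum>k<d. soft_weight d \<beta> k (\<lambda>k. X k x)) \<partial>M)"
    unfolding mean_weight_def
    by (intro Bochner_Integration.integral_sum[symmetric] gaussian_tame_integrable[OF X]) auto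
  then show ?thesis using sum_soft_weight[OF d] by (simp add: prob_space)
qed

lemma gap_energy_transfer:
  assumes "has_gaussian_law M d X C" "has_gaussian_law N d Y C" "0 < \<beta>" "0 < d"
  shows "gap_energy d \<beta> a M X = gap_energy d \<beta> a N Y"
  unfolding gap_energy_def by (rule gaussian_transfer[OF assms(1,2) tame_gap_energy[OF assms(3,4)]])

lemma gap_energy_mean_weight_transfer:
  assumes X: "has_gaussian_law M d X C" and Y: "has_gaussian_law N d Y C" and "0 < \<beta>" "0 < d"
  shows "gap_energy d \<beta> (mean_weight d \<beta> M X) M X = gap_energy d \<beta> (mean_weight d \<beta> N Y) N Y"
proof -
  have "mean_weight d \<beta> M X k = mean_weight d \<beta> N Y k" if "k < d" for k
    unfolding mean_weight_def by (rule gaussian_transfer[OF X Y tame_soft_weight[OF that]])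
  then have "gap_energy d \<beta> (mean_weight d \<beta> M X) M X = gap_energy d \<beta> (mean_weight d \<beta> N Y) M X"
    by (simp add: gap_energy_def soft_gap_def)
  then show ?thesis using gap_energy_transfer[OF assms] by simp
qed

text \<open>By integration by parts the pairing of the shifted gap with \<open>X j\<close> is a
  combination of the differences between the means of the weights and \<open>a\<close>, hence
  vanishes for the mean weights. Any other \<open>a\<close> adds a linear form orthogonal to the
  gap, and the energies differ by its second moment.\<close>

lemma gap_energy_mean_weight_le:
  assumes X: "has_gaussian_law M d X C" and sym: "\<And>k l. C k l = C l k" and pos: "\<And>k. k < d \<Longrightarrow> 0 < C k k"
    and \<beta>: "0 < \<beta>" and d: "0 < d"
  shows "gap_energy d \<beta> (mean_weight d \<beta> M X) M X \<le> gap_energy d \<beta> a M X"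
proof -
  interpret prob_space M using X by (rule gaussian_prob_space)
  define p where "p = mean_weight d \<beta> M X"
  let ?h = "\<lambda>x. soft_gap d \<beta> p (\<lambda>k. X k x) + 1 / \<beta>"
  let ?L = "\<lambda>x. \<Sum>k<d. (p k - a k) * X k x"
  have th: "tame d (\<lambda>y. soft_gap d \<beta> p y + 1 / \<beta>)" by (intro tame_add tame_soft_gap \<beta> d tame_const)
  have tL: "tame d (\<lambda>y. \<Sum>k<d. (p k - a k) * y k)" by (intro tame_sum tame_mult tame_const tame_coord) simp
  have gr: "has_gradient d (\<lambda>y. soft_gap d \<beta> p y + 1 / \<beta>) (\<lambda>k x. soft_weight d \<beta> k x - p k)"
    using has_gradient_soft_gap[OF \<beta> d, of p] unfolding has_gradient_def by (auto intro!: derivative_eq_intros)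
  have orth: "(\<integral>x. X j x * ?h x \<partial>M) = 0" if "j < d" for j
  proof -
    have "(\<integral>x. X j x * ?h x \<partial>M) = (\<Sum>k<d. C j k * (\<integral>x. soft_weight d \<beta> k (\<lambda>k. X k x) - p k \<partial>M))"
      by (rule gaussian_integration_by_parts[OF X sym that pos[OF that] th _ gr]) auto
    also have "\<dots> = 0"
      using gaussian_tame_integrable[OF X tame_soft_weight] by (simp add: p_def mean_weight_def prob_space)
    finally show ?thesis .
  qed
  have ij: "integrable M (\<lambda>x. X j x * ?h x)" if "j < d" for j
    using gaussian_tame_integrable[OF X tame_mult[OF tame_coord[OF that] th]] .
  have "(\<integral>x. ?L x * ?h x \<partial>M) = (\<integral>x. (\<Sum>j<d. (p j - a j) * (X j x * ?h x)) \<partial>M)"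
    by (simp add: sum_distrib_right mult.assoc)
  also have "\<dots> = 0" using ij orth by (subst Bochner_Integration.integral_sum) auto
  finally have cross: "(\<integral>x. ?L x * ?h x \<partial>M) = 0" .
  have "soft_gap d \<beta> a (\<lambda>k. X k x) + 1 / \<beta> = ?h x + ?L x" for x
    by (simp add: soft_gap_def left_diff_distrib sum_subtractf)
  moreover have sq: "(u + v)\<^sup>2 = u\<^sup>2 + v\<^sup>2 + 2 * (v * u)" for u v :: real by (simp add: power2_sum)
  ultimately have "gap_energy d \<beta> a M X = (\<integral>x. (?h x)\<^sup>2 + (?L x)\<^sup>2 + 2 * (?L x * ?h x) \<partial>M)"
    unfolding gap_energy_def by (simp only: sq)
  also have "\<dots> = gap_energy d \<beta> p M X + (\<integral>x. (?L x)\<^sup>2 \<partial>M)"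
    using gaussian_tame_integrable[OF X tame_power2[OF th]] gaussian_tame_integrable[OF X tame_power2[OF tL]]
      gaussian_tame_integrable[OF X tame_mult[OF tL th]] cross
    by (simp add: gap_energy_def)
  finally show ?thesis by (simp add: p_def)
qed

section \<open>Permuting and erasing components\<close>

lemma gaussian_involution:
  assumes X: "has_gaussian_law M d X C" and \<tau>: "\<And>k. k < d \<Longrightarrow> \<tau> k < d" "\<And>k. k < d \<Longrightarrow> \<tau> (\<tau> k) = k"
  shows "has_gaussian_law M d (\<lambda>k. X (\<tau> k)) (\<lambda>k l. C (\<tau> k) (\<tau> l))"
proof -
  have re: "(\<Sum>k<d. f (\<tau> k)) = (\<Sum>k<d. f k)" for f :: "nat \<Rightarrow> real"
    by (rule sum.reindex_bij_witness[of _ \<tau> \<tau>]) (use \<tau> in auto)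
  have 1: "(\<Sum>k<d. a k * X (\<tau> k) x) = (\<Sum>k<d. a (\<tau> k) * X k x)" for a x
    using re[of "\<lambda>k. a (\<tau> k) * X k x"] \<tau> by simp
  have 2: "(\<Sum>k<d. \<Sum>l<d. a (\<tau> k) * a (\<tau> l) * C k l) = (\<Sum>k<d. \<Sum>l<d. a k * a l * C (\<tau> k) (\<tau> l))" for a
  proof -
    have "(\<Sum>k<d. \<Sum>l<d. a (\<tau> k) * a (\<tau> l) * C k l) = (\<Sum>k<d. \<Sum>l<d. a (\<tau> (\<tau> k)) * a (\<tau> l) * C (\<tau> k) l)"
      by (rule re[symmetric])
    also have "\<dots> = (\<Sum>k<d. \<Sum>l<d. a (\<tau> (\<tau> k)) * a (\<tau> (\<tau> l)) * C (\<tau> k) (\<tau> l))"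
      by (intro sum.cong refl re[symmetric])
    also have "\<dots> = (\<Sum>k<d. \<Sum>l<d. a k * a l * C (\<tau> k) (\<tau> l))" using \<tau> by (intro sum.cong) auto
    finally show ?thesis .
  qed
  show ?thesis
    unfolding has_gaussian_law_def 1 gaussian_char[OF X] 2
    using gaussian_prob_space[OF X] gaussian_measurable[OF X] \<tau> by auto
qed

text \<open>Erasing a component means setting it to 0, which keeps the dimension and the indexing; a
  vanishing row and column of the covariance cause no trouble for characteristic functions.\<close>

lemma gaussian_drop:
  assumes X: "has_gaussian_law M d X C"
  shows "has_gaussian_law M d (\<lambda>k x. if k = v then 0 else X k x) (\<lambda>k l. if k = v \<or> l = v then 0 else C k l)"
proof -
  have 1: "(\<Sum>k<d. a k * (if k = v then 0 else X k x)) = (\<Sum>k<d. (if k = v then 0 else a k) * X k x)" for a x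
    by (intro sum.cong) auto
  have 2: "(\<Sum>k<d. \<Sum>l<d. (if k = v then 0 else a k) * (if l = v then 0 else a l) * C k l)
     = (\<Sum>k<d. \<Sum>l<d. a k * a l * (if k = v \<or> l = v then 0 else C k l))" for a
    by (intro sum.cong) auto
  have 3: "(\<lambda>x. if k = v then 0 else X k x) \<in> borel_measurable M" if "k < d" for k
    using gaussian_measurable[OF X that] by (cases "k = v") auto
  show ?thesis
    unfolding has_gaussian_law_def 1 gaussian_char[OF X] 2
    using gaussian_prob_space[OF X] 3 by auto
qed

lemma gaussian_cong:
  assumes "has_gaussian_law M d X C" "\<And>k l. k < d \<Longrightarrow> l < d \<Longrightarrow> C k l = D k l"
  shows "has_gaussian_law M d X D"
proof -
  have "(\<Sum>k<d. \<Sum>l<d. a k * a l * C k l) = (\<Sum>k<d. \<Sum>l<d. a k * a l * D k l)" for a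
    using assms(2) by (intro sum.cong) auto
  with assms(1) show ?thesis unfolding has_gaussian_law_def by simp
qed

lemma gaussian_involution_invariant:
  assumes X: "has_gaussian_law M d X C" and \<tau>: "\<And>k. k < d \<Longrightarrow> \<tau> k < d" "\<And>k. k < d \<Longrightarrow> \<tau> (\<tau> k) = k"
    and C: "\<And>k l. k < d \<Longrightarrow> l < d \<Longrightarrow> C (\<tau> k) (\<tau> l) = C k l" and F: "tame d F"
  shows "(\<integral>x. F (\<lambda>k. X (\<tau> k) x) \<partial>M) = (\<integral>x. F (\<lambda>k. X k x) \<partial>M)"
  by (rule gaussian_transfer[OF gaussian_cong[OF gaussian_involution[OF X \<tau>] C] X F])

text \<open>Exchanging \<open>u\<close> and \<open>v\<close> fixes the denominator and turns the
  weight of \<open>u\<close> into that of \<open>v\<close>, while the law is invariant.\<close>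

lemma mean_weight_transpose:
  assumes X: "has_gaussian_law M d X C" and uv: "u < d" "v < d"
    and C: "\<And>k l. k < d \<Longrightarrow> l < d \<Longrightarrow> C (Transposition.transpose u v k) (Transposition.transpose u v l) = C k l"
  shows "mean_weight d \<beta> M X u = mean_weight d \<beta> M X v"
proof -
  let ?\<tau> = "Transposition.transpose u v"
  have \<tau>: "?\<tau> k < d" if "k < d" for k using that uv by (simp add: Transposition.transpose_def)
  have "(\<Sum>l<d. exp (\<beta> * x (?\<tau> l))) = (\<Sum>l<d. exp (\<beta> * x l))" for x :: "nat \<Rightarrow> real"
    by (rule sum.reindex_bij_witness[of _ ?\<tau> ?\<tau>]) (use \<tau> in auto)
  then have "soft_weight d \<beta> u (\<lambda>k. X (?\<tau> k) x) = soft_weight d \<beta> v (\<lambda>k. X k x)" for x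
    unfolding soft_weight_def by simp
  moreover have "(\<integral>x. soft_weight d \<beta> u (\<lambda>k. X (?\<tau> k) x) \<partial>M) = (\<integral>x. soft_weight d \<beta> u (\<lambda>k. X k x) \<partial>M)"
    by (rule gaussian_involution_invariant[of M d X C ?\<tau>, OF X]) (use \<tau> C uv in auto)
  ultimately show ?thesis unfolding mean_weight_def by simp
qed

section \<open>Pairs of correlated components\<close>

text \<open>Indices start at 0, so block \<open>i\<close> consists of \<open>2 * i\<close> and
  \<open>2 * i + 1\<close>.\<close>

definition partner :: "nat \<Rightarrow> nat" where
  "partner k = (if even k then k + 1 else k - 1)"

definition pair_corr :: "(nat \<Rightarrow> real) \<Rightarrow> nat \<Rightarrow> nat \<Rightarrow> real" where
  "pair_corr b k l = (if k = l then 1 else if k div 2 = l div 2 then b (k div 2) else 0)"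

lemma partner_partner [simp]: "partner (partner k) = k"
  by (auto simp: partner_def)

lemma partner_inj [simp]: "partner k = partner l \<longleftrightarrow> k = l"
  by (metis partner_partner)

lemma partner_neq [simp]: "partner k \<noteq> k" "k \<noteq> partner k"
  by (auto simp: partner_def elim: oddE)

lemma partner_less [simp]: "partner k < 2 * n \<longleftrightarrow> k < 2 * n"
  by (auto simp: partner_def elim!: evenE oddE)

lemma partner_div [simp]: "partner k div 2 = k div 2"
  by (auto simp: partner_def elim!: evenE oddE)

lemma partner_cases: "k div 2 = l div 2 \<longleftrightarrow> l = k \<or> l = partner k"
  by (auto simp: partner_def elim!: evenE oddE)

lemma pair_corr_sym: "pair_corr b k l = pair_corr b l k"
  by (auto simp: pair_corr_def)

lemma pair_corr_diag [simp]: "pair_corr b k k = 1"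
  by (simp add: pair_corr_def)

lemma sum_pair_corr:
  assumes "k < 2 * n"
  shows "(\<Sum>l<2 * n. f l * pair_corr b k l) = f k + b (k div 2) * f (partner k)"
proof -
  have "(\<Sum>l<2 * n. f l * pair_corr b k l) = (\<Sum>l<2 * n. (if l = k then f l else 0) + (if l = partner k then b (k div 2) * f l else 0))"
    by (intro sum.cong refl) (auto simp: pair_corr_def partner_cases)
  then show ?thesis using assms by (simp add: sum.distrib)
qed

lemma pair_quadratic_form:
  "(\<Sum>k<2 * n. \<Sum>l<2 * n. a k * a l * pair_corr b k l) = (\<Sum>k<2 * n. (a k)\<^sup>2 + b (k div 2) * (a k * a (partner k)))"
proof (intro sum.cong refl)
  fix k assume "k \<in> {..<2 * n}"
  then have "(\<Sum>l<2 * n. a l * pair_corr b k l) = a k + b (k div 2) * a (partner k)"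
    by (intro sum_pair_corr) simp
  moreover have "(\<Sum>l<2 * n. a k * a l * pair_corr b k l) = a k * (\<Sum>l<2 * n. a l * pair_corr b k l)"
    by (simp add: sum_distrib_left mult.assoc)
  ultimately show "(\<Sum>l<2 * n. a k * a l * pair_corr b k l) = (a k)\<^sup>2 + b (k div 2) * (a k * a (partner k))"
    by (simp add: mult.assoc power2_eq_square algebra_simps flip: sum_distrib_left)
qed

lemma sum_partner: "(\<Sum>k<2 * n. f (partner k)) = (\<Sum>k<2 * n. f k)"
  by (rule sum.reindex_bij_witness[of _ partner partner]) auto

text \<open>Supplies vectors for the intermediate correlations of stage one, about which the given
  \<open>X\<close> and \<open>S\<close> say nothing.\<close>

lemma gaussian_pair_exists:
  assumes b: "\<And>i. i < n \<Longrightarrow> \<bar>b i\<bar> \<le> 1"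
  shows "\<exists>Z. has_gaussian_law (Pi\<^sub>M {..<2 * n} (\<lambda>_. std_normal_distribution)) (2 * n) Z (pair_corr b)"
proof -
  let ?d = "2 * n" and ?P = "Pi\<^sub>M {..<2 * n} (\<lambda>_. std_normal_distribution)"
  interpret N: prob_space std_normal_distribution by (rule prob_space_std_normal)
  interpret P: product_prob_space "\<lambda>_. std_normal_distribution" "{..<?d}" ..
  \<comment> \<open>Cholesky factor of a block: the even component is a coordinate, the odd one
    mixes its own coordinate with that of its partner. The correlations -1 and 1 are allowed, the
    root being 0 then.\<close>
  define s t where "s k = (if even k then 1 else sqrt (1 - (b (k div 2))\<^sup>2))"
    and "t k = (if even k then 0 else b (k div 2))" for k
  define Z where "Z k \<omega> = s k * \<omega> k + t k * \<omega> (partner k)" for k and \<omega> :: "nat \<Rightarrow> real"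
  have Zm: "Z k \<in> borel_measurable ?P" if "k < ?d" for k
    unfolding Z_def using that
    by (intro borel_measurable_add borel_measurable_times borel_measurable_const; measurable)
  have lin: "(\<Sum>k<?d. a k * Z k \<omega>) = (\<Sum>k<?d. (a k * s k + a (partner k) * t (partner k)) * \<omega> k)" for a \<omega>
  proof -
    have "(\<Sum>k<?d. a k * Z k \<omega>) = (\<Sum>k<?d. a k * s k * \<omega> k) + (\<Sum>k<?d. a k * t k * \<omega> (partner k))"
      by (simp add: Z_def sum.distrib algebra_simps)
    also have "(\<Sum>k<?d. a k * t k * \<omega> (partner k)) = (\<Sum>k<?d. a (partner k) * t (partner k) * \<omega> k)"
      using sum_partner[of "\<lambda>k. a (partner k) * t (partner k) * \<omega> k" n] by simp
    finally show ?thesis by (simp add: sum.distrib distrib_right)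
  qed
  have var: "(\<Sum>k<?d. (a k * s k + a (partner k) * t (partner k))\<^sup>2) = (\<Sum>k<?d. \<Sum>l<?d. a k * a l * pair_corr b k l)" for a
  proof -
    have "(\<Sum>k<?d. (a k * s k + a (partner k) * t (partner k))\<^sup>2)
      = (\<Sum>k<?d. (a k)\<^sup>2 * (s k)\<^sup>2) + (\<Sum>k<?d. (a (partner k))\<^sup>2 * (t (partner k))\<^sup>2)
        + (\<Sum>k<?d. s k * t (partner k) * (a k * a (partner k))) + (\<Sum>k<?d. s k * t (partner k) * (a k * a (partner k)))"
      by (simp add: power2_sum power_mult_distrib sum.distrib mult_ac sum_distrib_left)
    also have "(\<Sum>k<?d. (a (partner k))\<^sup>2 * (t (partner k))\<^sup>2) = (\<Sum>k<?d. (a k)\<^sup>2 * (t k)\<^sup>2)"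
      by (rule sum_partner)
    \<comment> \<open>The mixed sum occurs twice. Reindexing one copy by \<open>partner\<close>
      symmetrizes its coefficient, which then equals the correlation for even and odd
      \<open>k\<close> alike.\<close>
    also have "(\<Sum>k<?d. (a k)\<^sup>2 * (s k)\<^sup>2) + (\<Sum>k<?d. (a k)\<^sup>2 * (t k)\<^sup>2)
        + (\<Sum>k<?d. s k * t (partner k) * (a k * a (partner k))) + (\<Sum>k<?d. s k * t (partner k) * (a k * a (partner k)))
       = (\<Sum>k<?d. (a k)\<^sup>2 * (s k)\<^sup>2) + (\<Sum>k<?d. (a k)\<^sup>2 * (t k)\<^sup>2)
        + (\<Sum>k<?d. s k * t (partner k) * (a k * a (partner k))) + (\<Sum>k<?d. s (partner k) * t k * (a (partner k) * a k))"
      using sum_partner[of "\<lambda>k. s k * t (partner k) * (a k * a (partner k))" n] by simp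
    also have "\<dots> = (\<Sum>k<?d. (a k)\<^sup>2 * ((s k)\<^sup>2 + (t k)\<^sup>2) + (s k * t (partner k) + s (partner k) * t k) * (a k * a (partner k)))"
      by (simp add: sum.distrib[symmetric] algebra_simps)
    also have "\<dots> = (\<Sum>k<?d. (a k)\<^sup>2 + b (k div 2) * (a k * a (partner k)))"
    proof (intro sum.cong refl)
      fix k assume "k \<in> {..<?d}"
      then have "\<bar>b (k div 2)\<bar> \<le> 1" by (intro b) auto
      then have "(b (k div 2))\<^sup>2 \<le> 1" by (simp add: abs_square_le_1)
      moreover have "even (partner k) \<longleftrightarrow> odd k" by (auto simp: partner_def)
      ultimately have "(s k)\<^sup>2 + (t k)\<^sup>2 = 1" "s k * t (partner k) + s (partner k) * t k = b (k div 2)"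
        by (auto simp: s_def t_def)
      then show "(a k)\<^sup>2 * ((s k)\<^sup>2 + (t k)\<^sup>2) + (s k * t (partner k) + s (partner k) * t k) * (a k * a (partner k))
          = (a k)\<^sup>2 + b (k div 2) * (a k * a (partner k))" by simp
    qed
    finally show ?thesis by (simp add: pair_quadratic_form)
  qed
  have "(CLINT \<omega>|?P. iexp (\<Sum>k<?d. a k * Z k \<omega>)) = complex_of_real (exp (- (\<Sum>k<?d. \<Sum>l<?d. a k * a l * pair_corr b k l) / 2))" for a
  proof -
    define c where "c k = a k * s k + a (partner k) * t (partner k)" for k
    have "(CLINT \<omega>|?P. iexp (\<Sum>k<?d. a k * Z k \<omega>)) = (CLINT \<omega>|?P. (\<Prod>k<?d. iexp (c k * \<omega> k)))"
      unfolding lin c_def[symmetric] by (simp add: exp_sum sum_distrib_left del: of_real_mult)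
    also have "\<dots> = (\<Prod>k<?d. CLINT x|std_normal_distribution. iexp (c k * x))"
      by (rule P.product_integral_prod) (auto intro!: N.integrable_const_bound[of _ 1])
    also have "\<dots> = complex_of_real (exp (\<Sum>k<?d. - (c k)\<^sup>2 / 2))"
      unfolding std_normal_char by (simp add: exp_sum)
    also have "(\<Sum>k<?d. - (c k)\<^sup>2 / 2) = - (\<Sum>k<?d. (c k)\<^sup>2) / 2"
      by (simp add: sum_negf sum_divide_distrib)
    finally show ?thesis unfolding c_def var .
  qed
  then have "has_gaussian_law ?P ?d Z (pair_corr b)"
    unfolding has_gaussian_law_def using Zm P.prob_space_axioms by blast
  then show ?thesis by blast
qed

text \<open>
  The law of the weight of \<open>u\<close> in the vector without its \<open>v\<close>-th component does not depend on the
  correlation between \<open>u\<close> and \<open>v\<close>.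
\<close>

definition dropped_weight :: "nat \<Rightarrow> real \<Rightarrow> nat \<Rightarrow> nat \<Rightarrow> (nat \<Rightarrow> real) \<Rightarrow> real" where
  "dropped_weight d \<beta> v u x = exp (\<beta> * x u) / (\<Sum>l\<in>{..<d} - {v}. exp (\<beta> * x l))"

context
  fixes d u v :: nat and \<beta> :: real
  assumes uv: "u < d" "v < d" "u \<noteq> v"
begin

lemma dropped_weight_split:
  fixes x :: "nat \<Rightarrow> real"
  obtains R where "0 \<le> R" "(\<Sum>l<d. exp (\<beta> * x l)) = exp (\<beta> * x u) + exp (\<beta> * x v) + R"
    "(\<Sum>l\<in>{..<d} - {v}. exp (\<beta> * x l)) = exp (\<beta> * x u) + R"
proof
  let ?R = "\<Sum>l\<in>{..<d} - {v} - {u}. exp (\<beta> * x l)"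
  show "0 \<le> ?R" by (intro sum_nonneg) auto
  show 1: "(\<Sum>l\<in>{..<d} - {v}. exp (\<beta> * x l)) = exp (\<beta> * x u) + ?R"
    using uv by (subst sum.remove[of _ u]) auto
  show "(\<Sum>l<d. exp (\<beta> * x l)) = exp (\<beta> * x u) + exp (\<beta> * x v) + ?R"
    using uv 1 by (subst sum.remove[of _ v]) auto
qed

lemma soft_weight_le_dropped_weight: "soft_weight d \<beta> u x \<le> dropped_weight d \<beta> v u x"
proof -
  obtain R where R: "0 \<le> R" "(\<Sum>l<d. exp (\<beta> * x l)) = exp (\<beta> * x u) + exp (\<beta> * x v) + R"
    "(\<Sum>l\<in>{..<d} - {v}. exp (\<beta> * x l)) = exp (\<beta> * x u) + R" by (rule dropped_weight_split)
  show ?thesis unfolding soft_weight_def dropped_weight_def R(2,3)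
    using R(1) by (intro divide_left_mono mult_pos_pos add_pos_nonneg) auto
qed

text \<open>\<open>t / (t + R)\<close> increases with \<open>t\<close>: the mass of \<open>v\<close>
  is added to numerator and denominator at once.\<close>

lemma dropped_weight_le_sum: "dropped_weight d \<beta> v u x \<le> soft_weight d \<beta> u x + soft_weight d \<beta> v x"
proof -
  obtain R where R: "0 \<le> R" "(\<Sum>l<d. exp (\<beta> * x l)) = exp (\<beta> * x u) + exp (\<beta> * x v) + R"
    "(\<Sum>l\<in>{..<d} - {v}. exp (\<beta> * x l)) = exp (\<beta> * x u) + R" by (rule dropped_weight_split)
  have "a / (a + R) \<le> (a + b) / (a + b + R)" if "0 < a" "0 < b" for a b
    using that R(1) by (simp add: frac_le_eq divide_nonpos_pos field_simps add_pos_nonneg)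
  then have "exp (\<beta> * x u) / (exp (\<beta> * x u) + R) \<le> (exp (\<beta> * x u) + exp (\<beta> * x v)) / (exp (\<beta> * x u) + exp (\<beta> * x v) + R)"
    by simp
  then show ?thesis unfolding soft_weight_def dropped_weight_def R(2,3) by (simp add: add_divide_distrib)
qed

lemma tame_dropped_weight: "tame d (dropped_weight d \<beta> v u)"
proof (rule tame_linear_boundI)
  have pos: "0 < (\<Sum>l\<in>{..<d} - {v}. exp (\<beta> * x l))" for x :: "nat \<Rightarrow> real"
    using uv by (intro sum_pos) auto
  show "continuous_on UNIV (dropped_weight d \<beta> v u)"
    unfolding dropped_weight_def using pos by (auto intro!: continuous_intros simp: less_imp_neq[symmetric])
  show "dropped_weight d \<beta> v u x = dropped_weight d \<beta> v u y" if "\<And>k. k < d \<Longrightarrow> x k = y k" for x y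
    using that uv by (simp add: dropped_weight_def)
  show "\<bar>dropped_weight d \<beta> v u x\<bar> \<le> 1 + (\<Sum>k<d. \<bar>x k\<bar>)" for x
  proof -
    have "exp (\<beta> * x u) \<le> (\<Sum>l\<in>{..<d} - {v}. exp (\<beta> * x l))" using uv by (intro member_le_sum) auto
    then have "dropped_weight d \<beta> v u x \<le> 1" "0 \<le> dropped_weight d \<beta> v u x"
      using pos[of x] by (simp_all add: dropped_weight_def less_imp_le)
    then show ?thesis using sum_nonneg[of "{..<d}" "\<lambda>k. \<bar>x k\<bar>"] by (simp add: add_increasing2)
  qed
qed simp

lemma dropped_weight_transfer:
  assumes X: "has_gaussian_law M d X C" and Y: "has_gaussian_law N d Y D"
    and CD: "\<And>k l. k \<noteq> v \<Longrightarrow> l \<noteq> v \<Longrightarrow> C k l = D k l"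
  shows "(\<integral>x. dropped_weight d \<beta> v u (\<lambda>k. X k x) \<partial>M) = (\<integral>x. dropped_weight d \<beta> v u (\<lambda>k. Y k x) \<partial>N)"
proof -
  have e: "dropped_weight d \<beta> v u (\<lambda>k. if k = v then 0 else x k) = dropped_weight d \<beta> v u x" for x
    using uv by (simp add: dropped_weight_def)
  have Y': "has_gaussian_law N d (\<lambda>k x. if k = v then 0 else Y k x) (\<lambda>k l. if k = v \<or> l = v then 0 else C k l)"
    by (rule gaussian_cong[OF gaussian_drop[OF Y]]) (use CD in auto)
  show ?thesis
    using gaussian_transfer[OF gaussian_drop[OF X] Y' tame_dropped_weight] by (simp add: e)
qed

end

section \<open>Lowering the correlation of one pair to -1\<close>

lemma pair_corr_partner_transpose:
  "pair_corr b (Transposition.transpose u (partner u) k) (Transposition.transpose u (partner u) l) = pair_corr b k l"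
proof -
  have "Transposition.transpose u (partner u) k div 2 = k div 2" for k
    by (auto simp: Transposition.transpose_def)
  moreover have "Transposition.transpose u (partner u) k = Transposition.transpose u (partner u) l \<longleftrightarrow> k = l"
    by (simp add: inj_eq)
  ultimately show ?thesis by (simp add: pair_corr_def)
qed

lemma sum_two_entries:
  fixes f :: "nat \<Rightarrow> nat \<Rightarrow> real"
  assumes "u < d" "v < d" "u \<noteq> v" and "\<And>k l. k < d \<Longrightarrow> l < d \<Longrightarrow> (k, l) \<noteq> (u, v) \<Longrightarrow> (k, l) \<noteq> (v, u) \<Longrightarrow> f k l = 0"
  shows "(\<Sum>k<d. \<Sum>l<d. f k l) = f u v + f v u"
proof -
  have "(\<Sum>k<d. \<Sum>l<d. f k l) = (\<Sum>p\<in>{..<d} \<times> {..<d}. f (fst p) (snd p))"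
    by (simp add: sum.cartesian_product case_prod_beta')
  also have "\<dots> = (\<Sum>p\<in>{(u, v), (v, u)}. f (fst p) (snd p))"
  proof (intro sum.mono_neutral_right ballI)
    fix p assume "p \<in> {..<d} \<times> {..<d} - {(u, v), (v, u)}"
    then show "f (fst p) (snd p) = 0" by (cases p) (auto intro!: assms(4))
  qed (use assms in auto)
  finally show ?thesis using assms by simp
qed

text \<open>The covariances differ only in the two off-diagonal entries of pair \<open>i\<close>, by
  \<open>- (1 + b i) \<le> 0\<close>, so the mixed second derivative must have nonpositive mean. By
  the symmetry of the pair this mean is
  \<open>- 2 * \<beta> * h - 2 * a u * (2 * m u - a u)\<close>, with \<open>h\<close> the
  nonnegative gap term and \<open>m\<close> the mean weights on the path.\<close>

lemma gap_energy_flip_pair_le: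
  assumes X: "has_gaussian_law M (2 * n) X (pair_corr b)" and Y: "has_gaussian_law N (2 * n) Y (pair_corr (b(i := -1)))"
    and i: "i < n" and b: "-1 \<le> b i" and \<beta>: "0 < \<beta>"
  shows "gap_energy (2 * n) \<beta> (mean_weight (2 * n) \<beta> N Y) M X \<le> gap_energy (2 * n) \<beta> (mean_weight (2 * n) \<beta> N Y) N Y"
proof -
  let ?d = "2 * n"
  define a where "a = mean_weight ?d \<beta> N Y"
  have d: "0 < ?d" using i by simp
  define u where "u = 2 * i"
  define v where "v = 2 * i + 1"
  have uv: "u < ?d" "v < ?d" "u \<noteq> v" "v < ?d" "u < ?d" "v \<noteq> u" using i by (auto simp: u_def v_def)
  have pv: "v = partner u" by (simp add: u_def v_def partner_def)
  have a: "0 \<le> a k" "(\<Sum>k<?d. a k) = 1" for k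
    unfolding a_def using mean_weight_nonneg[OF d] sum_mean_weight[OF Y d] by auto
  have "a u = a v" unfolding a_def pv
    by (rule mean_weight_transpose[OF Y]) (use uv pv in \<open>auto simp: pair_corr_partner_transpose\<close>)
  have diff: "pair_corr (b(i := -1)) k l - pair_corr b k l = (if (k, l) = (u, v) \<or> (k, l) = (v, u) then - (1 + b i) else 0)" for k l
  proof (cases "k div 2 = i \<and> l div 2 = i")
    case True
    then have "k = u \<or> k = v" "l = u \<or> l = v" by (auto simp: u_def v_def)
    then show ?thesis by (auto simp: pair_corr_def u_def v_def)
  next
    case False
    then show ?thesis by (auto simp: pair_corr_def u_def v_def)
  qed
  have "gap_energy ?d \<beta> a M X \<le> gap_energy ?d \<beta> a N Y"
    unfolding gap_energy_def
  proof (rule gaussian_interpolation_mono[OF X Y pair_corr_sym pair_corr_sym _ _ tame_gap_energy[OF \<beta> d]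
        tame_gap_energy_grad[OF \<beta> d] tame_gap_energy_hess[OF \<beta> d] has_gradient_gap_energy[OF \<beta> d]
        has_gradient_gap_energy_grad[OF \<beta>]])
    fix \<theta> Z
    let ?Q = "M \<Otimes>\<^sub>M N" and ?q = "\<lambda>k z. soft_weight ?d \<beta> k z"
    assume Z': "has_gaussian_law ?Q ?d Z (\<lambda>k l. (cos \<theta>)\<^sup>2 * pair_corr b k l + (sin \<theta>)\<^sup>2 * pair_corr (b(i := - 1)) k l)"
    \<comment> \<open>The interpolated covariance keeps the pair structure; the correlation of pair
      \<open>i\<close> becomes a convex combination of \<open>b i\<close> and -1.\<close>
    define c where "c = b(i := (cos \<theta>)\<^sup>2 * b i - (sin \<theta>)\<^sup>2)"
    have Z: "has_gaussian_law ?Q ?d Z (pair_corr c)"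
      by (rule gaussian_cong[OF Z']) (auto simp: pair_corr_def c_def distrib_right[symmetric])
    interpret Q: prob_space ?Q using Z by (rule gaussian_prob_space)
    define m where "m k = (\<integral>z. ?q k (\<lambda>k. Z k z) \<partial>?Q)" for k
    have muv: "m u = m v"
      using mean_weight_transpose[OF Z uv(1,2)] unfolding m_def mean_weight_def pv
      by (simp add: pair_corr_partner_transpose)
    have iq: "integrable ?Q (\<lambda>z. ?q k (\<lambda>k. Z k z))" if "k < ?d" for k
      by (rule gaussian_tame_integrable[OF Z tame_soft_weight[OF that]])
    \<comment> \<open>Erasing \<open>v\<close> raises the weight of \<open>u\<close> at the end of
      the path; the erased vector has the same law all along the path; and there the erased weight
      is at most the joint weight of the pair.\<close>
    have le: "a u \<le> m u + m v"
    proof -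
      have "a u \<le> (\<integral>y. dropped_weight ?d \<beta> v u (\<lambda>k. Y k y) \<partial>N)"
        unfolding a_def mean_weight_def
        using uv by (intro integral_mono gaussian_tame_integrable[OF Y] tame_dropped_weight soft_weight_le_dropped_weight tame_soft_weight)
      also have "\<dots> = (\<integral>z. dropped_weight ?d \<beta> v u (\<lambda>k. Z k z) \<partial>?Q)"
      proof (rule dropped_weight_transfer[OF uv(1-3) Y Z])
        fix k l assume "k \<noteq> v" "l \<noteq> v"
        then show "pair_corr (b(i := -1)) k l = pair_corr c k l"
          by (auto simp: pair_corr_def c_def v_def elim!: evenE oddE)
      qed
      also have "\<dots> \<le> (\<integral>z. ?q u (\<lambda>k. Z k z) + ?q v (\<lambda>k. Z k z) \<partial>?Q)"
        using uv by (intro integral_mono gaussian_tame_integrable[OF Z] Bochner_Integration.integrable_add tame_dropped_weight dropped_weight_le_sum tame_soft_weight)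
      also have "\<dots> = m u + m v" using iq uv by (simp add: m_def)
      finally show ?thesis .
    qed
    define h where "h = (\<integral>z. soft_gap ?d \<beta> a (\<lambda>k. Z k z) * ?q u (\<lambda>k. Z k z) * ?q v (\<lambda>k. Z k z) \<partial>?Q)"
    have h: "0 \<le> h" unfolding h_def
      using a by (intro Bochner_Integration.integral_nonneg mult_nonneg_nonneg soft_gap_nonneg[OF \<beta>] less_imp_le[OF soft_weight_pos[OF d]]) auto
    have H: "(\<integral>z. gap_energy_hess ?d \<beta> a k l (\<lambda>k. Z k z) \<partial>?Q)
      = - 2 * \<beta> * (\<integral>z. soft_gap ?d \<beta> a (\<lambda>k. Z k z) * ?q k (\<lambda>k. Z k z) * ?q l (\<lambda>k. Z k z) \<partial>?Q) - 2 * a k * m l - 2 * a l * m k + 2 * a k * a l"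
      if "k < ?d" "l < ?d" "l \<noteq> k" for k l
      unfolding gap_energy_hess_off_diagonal[OF \<beta> that(3)]
      using that iq gaussian_tame_integrable[OF Z tame_mult[OF tame_mult[OF tame_soft_gap[OF \<beta> d, of a] tame_soft_weight[OF that(1)]] tame_soft_weight[OF that(2)]], of \<beta> \<beta>]
      by (simp add: m_def Q.prob_space)
    have Huv: "(\<integral>z. gap_energy_hess ?d \<beta> a u v (\<lambda>k. Z k z) \<partial>?Q) \<le> 0"
      and Hvu: "(\<integral>z. gap_energy_hess ?d \<beta> a v u (\<lambda>k. Z k z) \<partial>?Q) \<le> 0"
    proof -
      have "a u * (2 * m u - a u) \<ge> 0" using le muv a(1)[of u] by (intro mult_nonneg_nonneg) auto
      moreover have "0 \<le> \<beta> * h" using h \<beta> by simp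
      moreover have "(\<integral>z. soft_gap ?d \<beta> a (\<lambda>k. Z k z) * ?q v (\<lambda>k. Z k z) * ?q u (\<lambda>k. Z k z) \<partial>?Q) = h"
        unfolding h_def by (simp add: mult_ac)
      ultimately show "(\<integral>z. gap_energy_hess ?d \<beta> a u v (\<lambda>k. Z k z) \<partial>?Q) \<le> 0"
        "(\<integral>z. gap_energy_hess ?d \<beta> a v u (\<lambda>k. Z k z) \<partial>?Q) \<le> 0"
        using H[OF uv(1,2)] H[OF uv(2,1)] uv muv \<open>a u = a v\<close> unfolding h_def[symmetric] by (simp_all add: algebra_simps)
    qed
    show "0 \<le> (\<Sum>k<?d. \<Sum>l<?d. (pair_corr (b(i := - 1)) k l - pair_corr b k l) * (\<integral>z. gap_energy_hess ?d \<beta> a k l (\<lambda>k. Z k z) \<partial>?Q))"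
      unfolding diff
      by (subst sum_two_entries[OF uv(1-3)]) (use Huv Hvu b uv in \<open>auto intro!: add_nonneg_nonneg mult_nonpos_nonpos\<close>)
  qed auto
  then show ?thesis by (simp add: a_def)
qed

text \<open>Each step joins two inequalities in the same direction: passing to the optimal weights
  of the next vector raises the energy of the present one, and flipping the pair at these fixed
  weights raises it again.\<close>

lemma gap_energy_antithetic_le:
  assumes X: "has_gaussian_law M (2 * n) X (pair_corr b)" and W: "has_gaussian_law N (2 * n) W (pair_corr (\<lambda>_. -1))"
    and b: "\<And>i. i < n \<Longrightarrow> \<bar>b i\<bar> \<le> 1" and \<beta>: "0 < \<beta>" and n: "0 < n"
  shows "gap_energy (2 * n) \<beta> (mean_weight (2 * n) \<beta> M X) M X \<le> gap_energy (2 * n) \<beta> (mean_weight (2 * n) \<beta> N W) N W"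
proof -
  let ?d = "2 * n" and ?P = "Pi\<^sub>M {..<2 * n} (\<lambda>_. std_normal_distribution)"
  have d: "0 < ?d" using n by simp
  define c where "c k i = (if i < k then -1 else b i)" for k i
  have "\<exists>Z. has_gaussian_law ?P ?d Z (pair_corr (c k))" for k
    by (rule gaussian_pair_exists) (use b in \<open>auto simp: c_def\<close>)
  then obtain Z where Z: "\<And>k. has_gaussian_law ?P ?d (Z k) (pair_corr (c k))" by metis
  define E where "E k = gap_energy ?d \<beta> (mean_weight ?d \<beta> ?P (Z k)) ?P (Z k)" for k
  have step: "E k \<le> E (Suc k)" if "k < n" for k
  proof -
    have c: "c (Suc k) = (c k)(k := -1)" by (auto simp: c_def)
    have "E k \<le> gap_energy ?d \<beta> (mean_weight ?d \<beta> ?P (Z (Suc k))) ?P (Z k)"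
      unfolding E_def by (rule gap_energy_mean_weight_le[OF Z pair_corr_sym _ \<beta> d]) simp
    also have "\<dots> \<le> E (Suc k)"
      unfolding E_def
      by (rule gap_energy_flip_pair_le[OF Z Z[of "Suc k", unfolded c] that _ \<beta>]) (use b[OF that] in \<open>simp add: c_def abs_le_iff\<close>)
    finally show ?thesis .
  qed
  have "E 0 \<le> E k" if "k \<le> n" for k
    using that by (induction k) (auto intro: order_trans[OF _ step])
  then have "E 0 \<le> E n" by simp
  moreover have "gap_energy ?d \<beta> (mean_weight ?d \<beta> M X) M X = E 0"
  proof -
    have "c 0 = b" by (auto simp: c_def)
    then show ?thesis unfolding E_def using gap_energy_mean_weight_transfer[OF X _ \<beta> d] Z[of 0] by simp
  qed
  moreover have "gap_energy ?d \<beta> (mean_weight ?d \<beta> N W) N W = E n"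
  proof -
    have "has_gaussian_law ?P ?d (Z n) (pair_corr (\<lambda>_. -1))"
      by (rule gaussian_cong[OF Z]) (auto simp: pair_corr_def c_def)
    then show ?thesis unfolding E_def by (rule gap_energy_mean_weight_transfer[OF W _ \<beta> d])
  qed
  ultimately show ?thesis by simp
qed

section \<open>From antithetic pairs to the simplex\<close>

lemma std_normal_scale_distr:
  assumes "0 < s"
  shows "distr std_normal_distribution borel (\<lambda>t. s * t) = density lborel (\<lambda>x. ennreal (normal_density 0 s x))"
proof -
  interpret N: prob_space std_normal_distribution by (rule prob_space_std_normal)
  have "distributed std_normal_distribution lborel (\<lambda>t. t) std_normal_density"
    unfolding distributed_def by (auto simp: distr_id2 density_cong)
  from N.normal_density_affine[OF this, of s 0] assms
  have "distributed std_normal_distribution lborel (\<lambda>t. s * t) (normal_density 0 s)" by simp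
  then have "distr std_normal_distribution lborel (\<lambda>t. s * t) = density lborel (\<lambda>x. ennreal (normal_density 0 s x))"
    by (simp add: distributed_def)
  then show ?thesis by (simp cong: distr_cong)
qed

text \<open>The logarithm of the ratio is
  \<open>(g1^2 - g2^2) * (1 / (2 * s2^2) - 1 / (2 * s1^2))\<close>: the coordinate of larger modulus
  is more likely to lie along the axis of larger variance.\<close>

lemma normal_density_exchange:
  assumes s: "0 < s2" "s2 \<le> s1" and g: "\<bar>g2\<bar> \<le> \<bar>g1\<bar>"
  shows "normal_density 0 s1 g2 * normal_density 0 s2 g1 \<le> normal_density 0 s1 g1 * normal_density 0 s2 g2"
proof -
  have g': "g2\<^sup>2 \<le> g1\<^sup>2" using g by (simp add: abs_le_square_iff)
  have s': "1 / (2 * s1\<^sup>2) \<le> 1 / (2 * s2\<^sup>2)" using s by (intro divide_left_mono) (auto intro!: power_mono)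
  have "(g1\<^sup>2 - g2\<^sup>2) * (1 / (2 * s2\<^sup>2) - 1 / (2 * s1\<^sup>2)) \<ge> 0" using g' s' by (intro mult_nonneg_nonneg) auto
  then have "- (g2\<^sup>2 / (2 * s1\<^sup>2)) - g1\<^sup>2 / (2 * s2\<^sup>2) \<le> - (g1\<^sup>2 / (2 * s1\<^sup>2)) - g2\<^sup>2 / (2 * s2\<^sup>2)"
    by (simp add: algebra_simps diff_divide_distrib)
  then have e: "exp (- (g2\<^sup>2 / (2 * s1\<^sup>2))) * exp (- (g1\<^sup>2 / (2 * s2\<^sup>2))) \<le> exp (- (g1\<^sup>2 / (2 * s1\<^sup>2))) * exp (- (g2\<^sup>2 / (2 * s2\<^sup>2)))"
    by (simp add: exp_add[symmetric])
  define c where "c = (1 / sqrt (2 * pi * s1\<^sup>2)) * (1 / sqrt (2 * pi * s2\<^sup>2))"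
  have c: "0 \<le> c" unfolding c_def by (intro mult_nonneg_nonneg) auto
  have "normal_density 0 s1 u * normal_density 0 s2 v = c * (exp (- (u\<^sup>2 / (2 * s1\<^sup>2))) * exp (- (v\<^sup>2 / (2 * s2\<^sup>2))))" for u v
    by (simp add: normal_density_def c_def)
  then show ?thesis using mult_left_mono[OF e c] by simp
qed

text \<open>Swapping the coordinates pairs \<open>k u v\<close> with its negative. Both
  contributions add up to \<open>(w u v - w v u) * k u v\<close>, with \<open>w\<close> the product
  density, and where \<open>u\<close> has the larger modulus both factors are nonnegative.\<close>

lemma gaussian_antisymmetric_integral_nonneg:
  fixes k :: "real \<Rightarrow> real \<Rightarrow> real"
  assumes s: "0 < s2" "s2 \<le> s1"
    and k_cont: "continuous_on UNIV (\<lambda>p. k (fst p) (snd p))"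
    and int: "integrable (std_normal_distribution \<Otimes>\<^sub>M std_normal_distribution) (\<lambda>p. k (s1 * fst p) (s2 * snd p))"
    and anti: "\<And>u v. k v u = - k u v" and nonneg: "\<And>u v. \<bar>v\<bar> \<le> \<bar>u\<bar> \<Longrightarrow> 0 \<le> k u v"
  shows "0 \<le> (\<integral>t. \<integral>r. k (s1 * t) (s2 * r) \<partial>std_normal_distribution \<partial>std_normal_distribution)"
proof -
  let ?N = std_normal_distribution
  let ?\<nu> = "\<lambda>s. density lborel (\<lambda>x. ennreal (normal_density 0 s x))"
  let ?w = "\<lambda>u v. normal_density 0 s1 u * normal_density 0 s2 v"
  interpret N: prob_space ?N by (rule prob_space_std_normal)
  have [measurable]: "(\<lambda>p. k (fst p) (snd p)) \<in> borel_measurable (borel \<Otimes>\<^sub>M borel)"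
    using borel_measurable_continuous_onI[OF k_cont] by (simp add: borel_prod)
  have [measurable]: "(\<lambda>p. k (f p) (g p)) \<in> borel_measurable L" if [measurable]: "f \<in> borel_measurable L" "g \<in> borel_measurable L" for f g and L :: "'c measure"
    using measurable_compose[of "\<lambda>p. (f p, g p)" L "borel \<Otimes>\<^sub>M borel" "\<lambda>p. k (fst p) (snd p)"] by simp
  have pN: "prob_space (?\<nu> s)" if "0 < s" for s using prob_space_normal_density[OF that] by simp
  interpret N1: prob_space "?\<nu> s1" using s by (intro pN) auto
  interpret N2: prob_space "?\<nu> s2" using s by (intro pN) auto
  have "distr (?N \<Otimes>\<^sub>M ?N) (borel \<Otimes>\<^sub>M borel) (\<lambda>p. (s1 * fst p, s2 * snd p)) = ?\<nu> s1 \<Otimes>\<^sub>M ?\<nu> s2"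
  proof -
    have d: "distr ?N borel (\<lambda>t. s1 * t) = ?\<nu> s1" "distr ?N borel (\<lambda>t. s2 * t) = ?\<nu> s2"
      using s by (auto intro: std_normal_scale_distr)
    have "distr ?N borel (\<lambda>t. s1 * t) \<Otimes>\<^sub>M distr ?N borel (\<lambda>t. s2 * t) = distr (?N \<Otimes>\<^sub>M ?N) (borel \<Otimes>\<^sub>M borel) (\<lambda>(x, y). (s1 * x, s2 * y))"
      by (rule pair_measure_distr) (use N2.sigma_finite_measure_axioms in \<open>auto simp: d\<close>)
    then show ?thesis unfolding d by (simp add: case_prod_beta')
  qed
  moreover have "?\<nu> s1 \<Otimes>\<^sub>M ?\<nu> s2 = density (lborel \<Otimes>\<^sub>M lborel) (\<lambda>(x, y). ennreal (normal_density 0 s1 x) * ennreal (normal_density 0 s2 y))"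
    by (rule pair_measure_density) (use N2.sigma_finite_measure_axioms in \<open>auto simp: lborel.sigma_finite_measure_axioms\<close>)
  ultimately have D: "distr (?N \<Otimes>\<^sub>M ?N) (borel \<Otimes>\<^sub>M borel) (\<lambda>p. (s1 * fst p, s2 * snd p)) = density (lborel \<Otimes>\<^sub>M lborel) (\<lambda>p. ennreal (?w (fst p) (snd p)))"
    by (simp add: case_prod_beta' ennreal_mult)
  have int': "integrable (lborel \<Otimes>\<^sub>M lborel) (\<lambda>p. ?w (fst p) (snd p) * k (fst p) (snd p))"
  proof -
    have "integrable (distr (?N \<Otimes>\<^sub>M ?N) (borel \<Otimes>\<^sub>M borel) (\<lambda>p. (s1 * fst p, s2 * snd p))) (\<lambda>p. k (fst p) (snd p))"
      using int by (subst integrable_distr_eq) auto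
    then show ?thesis unfolding D by (subst (asm) integrable_density) auto
  qed
  have "(\<integral>t. \<integral>r. k (s1 * t) (s2 * r) \<partial>?N \<partial>?N) = (\<integral>p. k (s1 * fst p) (s2 * snd p) \<partial>(?N \<Otimes>\<^sub>M ?N))"
    using pair_prob_space_integral[OF prob_space_std_normal prob_space_std_normal int] by simp
  also have "\<dots> = (\<integral>p. k (fst p) (snd p) \<partial>distr (?N \<Otimes>\<^sub>M ?N) (borel \<Otimes>\<^sub>M borel) (\<lambda>p. (s1 * fst p, s2 * snd p)))"
    by (subst integral_distr) auto
  also have "\<dots> = (\<integral>p. ?w (fst p) (snd p) * k (fst p) (snd p) \<partial>(lborel \<Otimes>\<^sub>M lborel))"
    unfolding D by (subst integral_density) auto
  finally have I: "(\<integral>t. \<integral>r. k (s1 * t) (s2 * r) \<partial>?N \<partial>?N) = (\<integral>p. ?w (fst p) (snd p) * k (fst p) (snd p) \<partial>(lborel \<Otimes>\<^sub>M lborel))" .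
  have sw: "(\<integral>p. ?w (snd p) (fst p) * k (snd p) (fst p) \<partial>(lborel \<Otimes>\<^sub>M lborel)) = (\<integral>p. ?w (fst p) (snd p) * k (fst p) (snd p) \<partial>(lborel \<Otimes>\<^sub>M lborel))"
    using lborel_pair.integral_product_swap[of "\<lambda>p. ?w (fst p) (snd p) * k (fst p) (snd p)"] by (simp add: case_prod_beta')
  have int'': "integrable (lborel \<Otimes>\<^sub>M lborel) (\<lambda>p. ?w (snd p) (fst p) * k (snd p) (fst p))"
    using lborel_pair.integrable_product_swap[OF int'] by (simp add: case_prod_beta')
  have pt: "0 \<le> ?w u v * k u v + ?w v u * k v u" for u v
  proof (cases "\<bar>v\<bar> \<le> \<bar>u\<bar>")
    case True
    have "0 \<le> (?w u v - ?w v u) * k u v"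
      using normal_density_exchange[OF s True] nonneg[OF True] by (intro mult_nonneg_nonneg) auto
    then show ?thesis using anti[of u v] by (simp add: algebra_simps)
  next
    case False
    then have "0 \<le> (?w v u - ?w u v) * k v u"
      using normal_density_exchange[OF s, of u v] nonneg[of u v] by (intro mult_nonneg_nonneg) auto
    then show ?thesis using anti[of u v] by (simp add: algebra_simps)
  qed
  have "0 \<le> (\<integral>p. ?w (fst p) (snd p) * k (fst p) (snd p) + ?w (snd p) (fst p) * k (snd p) (fst p) \<partial>(lborel \<Otimes>\<^sub>M lborel))"
    using pt by (intro Bochner_Integration.integral_nonneg)
  then show ?thesis using int' int'' sw I by simp
qed

lemma tame_plane_integrable:
  assumes F: "tame d F"
  shows "integrable (std_normal_distribution \<Otimes>\<^sub>M std_normal_distribution)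
    (\<lambda>p. F (\<lambda>k. R k + fst p * a k + snd p * b k))"
proof -
  let ?N = std_normal_distribution
  interpret N: prob_space ?N by (rule prob_space_std_normal)
  interpret P: pair_sigma_finite ?N ?N ..
  define t where "t = (\<Sum>k<d. \<bar>a k\<bar>) + (\<Sum>k<d. \<bar>b k\<bar>)"
  have nn: "0 \<le> (\<Sum>k<d. \<bar>a k\<bar>)" "0 \<le> (\<Sum>k<d. \<bar>b k\<bar>)" by (auto intro: sum_nonneg)
  then have t: "0 \<le> t" by (simp add: t_def)
  obtain B where B: "0 \<le> B" "\<And>z s. (\<Sum>k<d. \<bar>z k\<bar>) \<le> (\<Sum>k<d. \<bar>R k\<bar>) + t * s \<Longrightarrow> 0 \<le> s \<Longrightarrow> \<bar>F z\<bar> \<le> B * exp (B * s)"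
    by (rule tame_linear_growth[OF F t]) auto
  have bound: "\<bar>F (\<lambda>k. R k + x * a k + y * b k)\<bar> \<le> B * (exp (B * \<bar>x\<bar>) * exp (B * \<bar>y\<bar>))" for x y
  proof -
    have "(\<Sum>k<d. \<bar>R k + x * a k + y * b k\<bar>) \<le> (\<Sum>k<d. \<bar>R k\<bar>) + \<bar>x\<bar> * (\<Sum>k<d. \<bar>a k\<bar>) + \<bar>y\<bar> * (\<Sum>k<d. \<bar>b k\<bar>)"
      by (intro order_trans[OF sum_abs_affine_le] add_right_mono sum_abs_affine_le)
    also have "\<dots> \<le> (\<Sum>k<d. \<bar>R k\<bar>) + t * (\<bar>x\<bar> + \<bar>y\<bar>)" using nn by (simp add: t_def algebra_simps)
    finally have "\<bar>F (\<lambda>k. R k + x * a k + y * b k)\<bar> \<le> B * exp (B * (\<bar>x\<bar> + \<bar>y\<bar>))" by (intro B(2)) auto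
    then show ?thesis by (simp add: distrib_left exp_add)
  qed
  show ?thesis
  proof (rule Bochner_Integration.integrable_bound)
    show "integrable (?N \<Otimes>\<^sub>M ?N) (\<lambda>p. B * (exp (B * \<bar>fst p\<bar>) * exp (B * \<bar>snd p\<bar>)))"
    proof (rule integrable_mult_right, rule P.Fubini_integrable)
      show "AE x in ?N. integrable ?N (\<lambda>y. exp (B * \<bar>fst (x, y)\<bar>) * exp (B * \<bar>snd (x, y)\<bar>))"
        using std_normal_integrable_exp_abs[of B] by simp
      show "integrable ?N (\<lambda>x. \<integral>y. norm (exp (B * \<bar>fst (x, y)\<bar>) * exp (B * \<bar>snd (x, y)\<bar>)) \<partial>?N)"
        using std_normal_integrable_exp_abs[of B] by (simp add: abs_mult)
    qed measurable
    show "(\<lambda>p. F (\<lambda>k. R k + fst p * a k + snd p * b k)) \<in> borel_measurable (?N \<Otimes>\<^sub>M ?N)"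
      by (rule tame_measurable[OF F]) measurable
    show "AE p in ?N \<Otimes>\<^sub>M ?N. norm (F (\<lambda>k. R k + fst p * a k + snd p * b k)) \<le> norm (B * (exp (B * \<bar>fst p\<bar>) * exp (B * \<bar>snd p\<bar>)))"
      using bound B(1) by (simp add: abs_mult)
  qed
qed

lemma sum_exp_transpose:
  fixes x :: "nat \<Rightarrow> real"
  assumes "i < d" "j < d"
  shows "(\<Sum>l<d. f (x (Transposition.transpose i j l))) = (\<Sum>l<d. f (x l) :: real)"
  by (rule sum.reindex_bij_witness[of _ "Transposition.transpose i j" "Transposition.transpose i j"])
     (use assms in \<open>auto simp: Transposition.transpose_def\<close>)

lemma soft_max_transpose:
  assumes "i < d" "j < d"
  shows "soft_max d \<beta> (\<lambda>k. x (Transposition.transpose i j k)) = soft_max d \<beta> x"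
  unfolding soft_max_def using sum_exp_transpose[OF assms, of "\<lambda>t. exp (\<beta> * t)" x] by simp

lemma soft_weight_transpose:
  assumes "i < d" "j < d"
  shows "soft_weight d \<beta> k (\<lambda>k. x (Transposition.transpose i j k)) = soft_weight d \<beta> (Transposition.transpose i j k) x"
  unfolding soft_weight_def using sum_exp_transpose[OF assms, of "\<lambda>t. exp (\<beta> * t)" x] by simp

lemma soft_gap_transpose:
  assumes "i < d" "j < d"
  shows "soft_gap d \<beta> (\<lambda>_. c) (\<lambda>k. x (Transposition.transpose i j k)) = soft_gap d \<beta> (\<lambda>_. c) x"
  unfolding soft_gap_def soft_max_transpose[OF assms]
  using sum_exp_transpose[OF assms, of "\<lambda>t. c * t" x] by simp

lemma soft_weight_mono:
  assumes "0 < \<beta>" "0 < d" "x i \<le> x j" shows "soft_weight d \<beta> i x \<le> soft_weight d \<beta> j x"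
  unfolding soft_weight_def using assms soft_den_pos[OF assms(2), of \<beta> x] by (intro divide_right_mono) auto

locale four_indices =
  fixes d u u' w w' :: nat
  assumes less: "u < d" "u' < d" "w < d" "w' < d" and distinct: "distinct [u, u', w, w']"
begin

text \<open>In the order \<open>u, u', w, w'\<close> the two vectors are
  \<open>(1, -1, 1, -1) / 2\<close> and \<open>(1, 1, -1, -1) / 2\<close>. They are orthonormal,
  exchanged by the transposition of \<open>u'\<close> and \<open>w\<close>, and, when
  \<open>u'\<close> and \<open>w'\<close> are the partners of \<open>u\<close> and \<open>w\<close>,
  eigenvectors of every covariance on the path of stage two.\<close>

definition v1 :: "nat \<Rightarrow> real" where
  "v1 k = ((if k = u then 1 else 0) - (if k = u' then 1 else 0) + (if k = w then 1 else 0) - (if k = w' then 1 else 0)) / 2"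

definition v2 :: "nat \<Rightarrow> real" where
  "v2 k = ((if k = u then 1 else 0) + (if k = u' then 1 else 0) - (if k = w then 1 else 0) - (if k = w' then 1 else 0)) / 2"

lemma v_values [simp]:
  "v1 u = 1/2" "v1 u' = -1/2" "v1 w = 1/2" "v1 w' = -1/2"
  "v2 u = 1/2" "v2 u' = 1/2" "v2 w = -1/2" "v2 w' = -1/2"
  using distinct by (auto simp: v1_def v2_def)

lemma v_other:
  assumes "k \<noteq> u" "k \<noteq> u'" "k \<noteq> w" "k \<noteq> w'" shows "v1 k = 0" "v2 k = 0"
  using assms by (auto simp: v1_def v2_def)

lemma sum_v1: "(\<Sum>l<d. f l * v1 l) = (f u - f u' + f w - f w') / 2"
proof -
  have "f l * v1 l = ((if l = u then f l else 0) - (if l = u' then f l else 0) + (if l = w then f l else 0) - (if l = w' then f l else 0)) / 2" for l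
    by (simp add: v1_def)
  then show ?thesis using less by (simp only:) (simp add: sum_divide_distrib[symmetric] sum.distrib sum_subtractf)
qed

lemma sum_v2: "(\<Sum>l<d. f l * v2 l) = (f u + f u' - f w - f w') / 2"
proof -
  have "f l * v2 l = ((if l = u then f l else 0) + (if l = u' then f l else 0) - (if l = w then f l else 0) - (if l = w' then f l else 0)) / 2" for l
    by (simp add: v2_def)
  then show ?thesis using less by (simp only:) (simp add: sum_divide_distrib[symmetric] sum.distrib sum_subtractf)
qed

lemma v_transpose:
  "v1 (Transposition.transpose u' w k) = v2 k" "v2 (Transposition.transpose u' w k) = v1 k"
  using distinct by (auto simp: v1_def v2_def Transposition.transpose_def)

text \<open>With the remainder fixed after both eigenvectors are split off, two independent normal
  coordinates \<open>g\<close> and \<open>h\<close> of standard deviations \<open>s1\<close> and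
  \<open>s2\<close> are left. The remainder agrees at \<open>u\<close> and \<open>w'\<close>, and at
  \<open>u'\<close> and \<open>w\<close>, so the two weight differences have the signs of
  \<open>g + h\<close> and \<open>g - h\<close>, and their product that of
  \<open>g^2 - h^2\<close>.\<close>

lemma soft_exchange_nonneg:
  assumes Z: "has_gaussian_law M d Z C" and sym: "\<And>k l. C k l = C l k"
    and eig1: "\<And>k. k < d \<Longrightarrow> (\<Sum>l<d. C k l * v1 l) = s1\<^sup>2 * v1 k"
    and eig2: "\<And>k. k < d \<Longrightarrow> (\<Sum>l<d. C k l * v2 l) = s2\<^sup>2 * v2 k"
    and s: "0 < s2" "s2 \<le> s1" and \<beta>: "0 < \<beta>" and c: "0 \<le> c" "real d * c = 1"
  shows "0 \<le> (\<integral>x. soft_gap d \<beta> (\<lambda>_. c) (\<lambda>k. Z k x) * (soft_weight d \<beta> u (\<lambda>k. Z k x) - soft_weight d \<beta> w' (\<lambda>k. Z k x))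
     * (soft_weight d \<beta> w (\<lambda>k. Z k x) - soft_weight d \<beta> u' (\<lambda>k. Z k x)) \<partial>M)"
proof -
  let ?N = std_normal_distribution and ?\<tau> = "Transposition.transpose u' w"
  define K where "K x = soft_gap d \<beta> (\<lambda>_. c) x * (soft_weight d \<beta> u x - soft_weight d \<beta> w' x) * (soft_weight d \<beta> w x - soft_weight d \<beta> u' x)" for x
  have d: "0 < d" using less by simp
  have tK: "tame d K" unfolding K_def by (intro tame_mult tame_diff tame_soft_gap \<beta> d tame_soft_weight less)
  note M = gaussian_prob_space[OF Z]
  have s1: "0 < s1" using s by simp
  \<comment> \<open>For the unit eigenvector \<open>v1\<close> with eigenvalue \<open>s1^2\<close>,
    the combination of \<open>Z\<close> with coefficients \<open>v1 l / s1\<close> has variance 1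
    and covariance \<open>s1 * v1 k\<close> with component \<open>k\<close>.\<close>
  define Z1 where "Z1 k p = Z k (fst p) - (\<Sum>l<d. (v1 l / s1) * Z l (fst p)) * (s1 * v1 k) + snd p * (s1 * v1 k)" for k p
  have Z1: "has_gaussian_law (M \<Otimes>\<^sub>M ?N) d Z1 C"
    unfolding Z1_def
  proof (rule gaussian_regression[OF Z sym])
    show "s1 * v1 k = (\<Sum>l<d. C k l * (v1 l / s1))" if "k < d" for k
      using eig1[OF that] s1 by (simp add: sum_divide_distrib[symmetric] power2_eq_square)
    show "(\<Sum>k<d. v1 k / s1 * (s1 * v1 k)) = 1" using s1 sum_v1[of v1] by simp
  qed
  define Z2 where "Z2 k p = Z1 k (fst p) - (\<Sum>l<d. (v2 l / s2) * Z1 l (fst p)) * (s2 * v2 k) + snd p * (s2 * v2 k)" for k p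
  have Z2: "has_gaussian_law ((M \<Otimes>\<^sub>M ?N) \<Otimes>\<^sub>M ?N) d Z2 C"
    unfolding Z2_def
  proof (rule gaussian_regression[OF Z1 sym])
    show "s2 * v2 k = (\<Sum>l<d. C k l * (v2 l / s2))" if "k < d" for k
      using eig2[OF that] s by (simp add: sum_divide_distrib[symmetric] power2_eq_square)
    show "(\<Sum>k<d. v2 k / s2 * (s2 * v2 k)) = 1" using s sum_v2[of v2] by simp
  qed
  define R where "R x k = Z k x - (Z u x - Z u' x + Z w x - Z w' x) / 2 * v1 k - (Z u x + Z u' x - Z w x - Z w' x) / 2 * v2 k" for x k
  have Z1_eq: "Z1 k (x, t) = Z k x - (Z u x - Z u' x + Z w x - Z w' x) / 2 * v1 k + s1 * t * v1 k" for k x t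
  proof -
    have "(\<Sum>l<d. (v1 l / s1) * Z l x) = (Z u x - Z u' x + Z w x - Z w' x) / 2 / s1"
      unfolding sum_v1[of "\<lambda>l. Z l x", symmetric] by (simp add: sum_divide_distrib mult.commute)
    then show ?thesis using s1 by (simp add: Z1_def)
  qed
  have Z2_eq: "Z2 k ((x, t), r) = R x k + (s1 * t) * v1 k + (s2 * r) * v2 k" for k x t r
  proof -
    have "(\<Sum>l<d. (v2 l / s2) * Z1 l (x, t)) = (Z1 u (x, t) + Z1 u' (x, t) - Z1 w (x, t) - Z1 w' (x, t)) / 2 / s2"
      unfolding sum_v2[of "\<lambda>l. Z1 l (x, t)", symmetric] by (simp add: sum_divide_distrib mult.commute)
    also have "Z1 u (x, t) + Z1 u' (x, t) - Z1 w (x, t) - Z1 w' (x, t) = Z u x + Z u' x - Z w x - Z w' x"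
      unfolding Z1_eq v_values by argo
    finally show ?thesis using s by (simp add: Z2_def R_def Z1_eq)
  qed
  \<comment> \<open>\<open>R\<close> has no component along \<open>v1 + v2\<close> and
    \<open>v1 - v2\<close>, which are the differences of the unit vectors at \<open>u\<close>,
    \<open>w'\<close> and at \<open>w\<close>, \<open>u'\<close>.\<close>
  have R: "R x u = R x w'" "R x u' = R x w" for x by (simp_all add: R_def field_simps)
  then have R\<tau>: "R x (?\<tau> k) = R x k" for x k by (simp add: Transposition.transpose_def)
  have inner: "0 \<le> (\<integral>t. \<integral>r. K (\<lambda>k. Z2 k ((x, t), r)) \<partial>?N \<partial>?N)" for x
    unfolding Z2_eq
  proof (rule gaussian_antisymmetric_integral_nonneg[OF s, of "\<lambda>g h. K (\<lambda>k. R x k + g * v1 k + h * v2 k)"])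
    show "continuous_on UNIV (\<lambda>p. K (\<lambda>k. R x k + fst p * v1 k + snd p * v2 k))"
      by (rule tame_continuous_on_compose[OF tK]) (auto intro!: continuous_intros)
    show "integrable (?N \<Otimes>\<^sub>M ?N) (\<lambda>p. K (\<lambda>k. R x k + s1 * fst p * v1 k + s2 * snd p * v2 k))"
      using tame_plane_integrable[OF tK, of "R x" "\<lambda>k. s1 * v1 k" "\<lambda>k. s2 * v2 k"] by (simp add: mult_ac)
  next
    fix g h
    define y where "y k = R x k + g * v1 k + h * v2 k" for k
    \<comment> \<open>Swapping \<open>g\<close> and \<open>h\<close> amounts to transposing
      \<open>u'\<close> and \<open>w\<close>. This fixes the gap, whose weights are uniform, and the
      first weight difference, and it reverses the second.\<close>
    have "(\<lambda>k. R x k + h * v1 k + g * v2 k) = (\<lambda>k. y (?\<tau> k))" by (simp add: y_def R\<tau> v_transpose algebra_simps)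
    moreover have "K (\<lambda>k. y (?\<tau> k)) = - K y"
      unfolding K_def soft_gap_transpose[OF less(2,3)] soft_weight_transpose[OF less(2,3)]
      using distinct by (simp add: Transposition.transpose_def algebra_simps)
    moreover have "(\<lambda>k. R x k + g * v1 k + h * v2 k) = y" by (simp add: y_def fun_eq_iff)
    ultimately show "K (\<lambda>k. R x k + h * v1 k + g * v2 k) = - K (\<lambda>k. R x k + g * v1 k + h * v2 k)"
      by (simp only:)
  next
    fix g h :: real assume gh: "\<bar>h\<bar> \<le> \<bar>g\<bar>"
    define y where "y k = R x k + g * v1 k + h * v2 k" for k
    have y: "y u - y w' = g + h" "y w - y u' = g - h" using R by (simp_all add: y_def field_simps)
    have prod: "0 \<le> (soft_weight d \<beta> u y - soft_weight d \<beta> w' y) * (soft_weight d \<beta> w y - soft_weight d \<beta> u' y)"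
    proof (cases "0 \<le> g")
      case True
      then have "y w' \<le> y u" "y u' \<le> y w" using y gh by linarith+
      then show ?thesis using soft_weight_mono[OF \<beta> d] by (intro mult_nonneg_nonneg) auto
    next
      case False
      then have "y u \<le> y w'" "y w \<le> y u'" using y gh by linarith+
      then show ?thesis using soft_weight_mono[OF \<beta> d] by (intro mult_nonpos_nonpos) auto
    qed
    have "0 \<le> soft_gap d \<beta> (\<lambda>_. c) y" using c by (intro soft_gap_nonneg[OF \<beta>]) auto
    from mult_nonneg_nonneg[OF this prod] show "0 \<le> K (\<lambda>k. R x k + g * v1 k + h * v2 k)"
      unfolding y_def[symmetric] K_def mult.assoc .
  qed
  note MN = pair_prob_space_prob_space[OF M prob_space_std_normal]
  interpret N: prob_space ?N by (rule prob_space_std_normal)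
  interpret MN: prob_space "M \<Otimes>\<^sub>M ?N" by (rule MN)
  interpret P: pair_sigma_finite "M \<Otimes>\<^sub>M ?N" ?N ..
  have "(\<integral>x. K (\<lambda>k. Z k x) \<partial>M) = (\<integral>q. K (\<lambda>k. Z2 k q) \<partial>((M \<Otimes>\<^sub>M ?N) \<Otimes>\<^sub>M ?N))"
    by (rule gaussian_transfer[OF Z Z2 tK])
  also have "\<dots> = (\<integral>p. \<integral>r. K (\<lambda>k. Z2 k (p, r)) \<partial>?N \<partial>(M \<Otimes>\<^sub>M ?N))"
    by (rule pair_prob_space_integral[OF MN prob_space_std_normal gaussian_tame_integrable[OF Z2 tK]])
  also have "\<dots> = (\<integral>x. \<integral>t. \<integral>r. K (\<lambda>k. Z2 k ((x, t), r)) \<partial>?N \<partial>?N \<partial>M)"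
    by (rule pair_prob_space_integral[OF M prob_space_std_normal P.integrable_fst'[OF gaussian_tame_integrable[OF Z2 tK]]])
  also have "\<dots> \<ge> 0" by (rule Bochner_Integration.integral_nonneg) (rule inner)
  finally show ?thesis by (simp add: K_def)
qed

end

section \<open>Interpolation towards the simplex\<close>

lemma partner_eq_iff: "partner k = l \<longleftrightarrow> k = partner l"
  by auto

text \<open>Gram matrix of the vertices of a centered regular simplex: for \<open>d\<close> at least
  2 its rows sum to 0.\<close>

definition simplex_corr :: "nat \<Rightarrow> nat \<Rightarrow> nat \<Rightarrow> real" where
  "simplex_corr d k l = (if k = l then 1 else - (1 / (real d - 1)))"

lemma simplex_corr_sym: "simplex_corr d k l = simplex_corr d l k"
  by (simp add: simplex_corr_def)

lemma sum_off_pair: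
  fixes f :: "nat \<Rightarrow> real"
  assumes "k < 2 * n"
  shows "(\<Sum>l<2 * n. if l = k \<or> l = partner k then 0 else f l) = (\<Sum>l<2 * n. f l) - f k - f (partner k)"
proof -
  have "(\<Sum>l<2 * n. if l = k \<or> l = partner k then 0 else f l) = (\<Sum>l<2 * n. f l - (if l = k then f l else 0) - (if l = partner k then f l else 0))"
    by (intro sum.cong) auto
  then show ?thesis using assms by (simp add: sum_subtractf)
qed

text \<open>The covariance difference \<open>D\<close> has vanishing row sums, so with uniform
  weights the constant terms and those linear in one mean weight cancel. What remains compares
  gap-weighted products inside a pair with those across pairs, and follows by summing the exchange
  inequality over all indices from different pairs.\<close>

lemma gap_energy_simplex_le:
  assumes W: "has_gaussian_law M (2 * n) W (pair_corr (\<lambda>_. -1))" and S: "has_gaussian_law N (2 * n) S (simplex_corr (2 * n))"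
    and n: "0 < n" and \<beta>: "0 < \<beta>"
  shows "gap_energy (2 * n) \<beta> (\<lambda>_. 1 / real (2 * n)) M W \<le> gap_energy (2 * n) \<beta> (\<lambda>_. 1 / real (2 * n)) N S"
proof -
  let ?d = "2 * n"
  define c where "c = 1 / real ?d"
  define \<delta> where "\<delta> = 1 / (real ?d - 1)"
  have d: "0 < ?d" using n by simp
  have d1: "0 < real ?d - 1" using n by simp
  \<comment> \<open>The identity balances a row of \<open>D\<close>: one entry
    \<open>1 - \<delta>\<close> at the partner against \<open>d - 2\<close> entries
    \<open>- \<delta>\<close>.\<close>
  have \<delta>: "0 < \<delta>" "1 - \<delta> = (real ?d - 2) * \<delta>" using d1 by (auto simp: \<delta>_def field_simps)
  have c: "0 \<le> c" "real ?d * c = 1" using n by (auto simp: c_def)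
  define D where "D k l = simplex_corr ?d k l - pair_corr (\<lambda>_. -1) k l" for k l
  have D_eq: "D k l = (if l = partner k then 1 - \<delta> else 0) - (if l = k \<or> l = partner k then 0 else \<delta>)" for k l
    by (auto simp: D_def simplex_corr_def pair_corr_def partner_cases \<delta>_def)
  have D_sym: "D k l = D l k" for k l by (simp add: D_def simplex_corr_sym[of _ k] pair_corr_sym[of _ k])
  have D_row: "(\<Sum>l<?d. D k l) = 0" if "k < ?d" for k
    unfolding D_eq sum_subtractf sum_off_pair[OF that] using that \<delta>(2) by (simp add: left_diff_distrib)
  have "gap_energy ?d \<beta> (\<lambda>_. c) M W \<le> gap_energy ?d \<beta> (\<lambda>_. c) N S"
    unfolding gap_energy_def
  proof (rule gaussian_interpolation_mono[OF W S pair_corr_sym simplex_corr_sym _ _ tame_gap_energy[OF \<beta> d]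
        tame_gap_energy_grad[OF \<beta> d] tame_gap_energy_hess[OF \<beta> d] has_gradient_gap_energy[OF \<beta> d]
        has_gradient_gap_energy_grad[OF \<beta>]])
    fix \<theta> :: real and Z
    let ?Q = "M \<Otimes>\<^sub>M N" and ?q = "\<lambda>k z. soft_weight ?d \<beta> k z"
    assume \<theta>: "0 < \<theta>" "\<theta> < pi / 2"
    assume Z': "has_gaussian_law ?Q ?d Z (\<lambda>k l. (cos \<theta>)\<^sup>2 * pair_corr (\<lambda>_. -1) k l + (sin \<theta>)\<^sup>2 * simplex_corr ?d k l)"
    define \<kappa> where "\<kappa> = (sin \<theta>)\<^sup>2 * \<delta>"
    define \<rho> where "\<rho> = (cos \<theta>)\<^sup>2 + \<kappa>"
    define C where "C k l = (if l = k then 1 else if l = partner k then - \<rho> else - \<kappa>)" for k l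
    have Z: "has_gaussian_law ?Q ?d Z C"
      by (rule gaussian_cong[OF Z'])
         (auto simp: pair_corr_def simplex_corr_def C_def partner_cases \<rho>_def \<kappa>_def \<delta>_def)
    have C_sym: "C k l = C l k" for k l by (auto simp: C_def)
    have "0 < sin \<theta>" using \<theta> by (intro sin_gt_zero) auto
    then have \<kappa>: "0 < \<kappa>" using \<delta> by (simp add: \<kappa>_def)
    have \<rho>: "\<rho> = 1 - (sin \<theta>)\<^sup>2 + \<kappa>" by (simp add: \<rho>_def cos_squared_eq)
    \<comment> \<open>Square roots of the eigenvalues for \<open>v1\<close> and \<open>v2\<close>.
      Here \<open>s2^2 = (sin \<theta>)^2 + \<kappa>\<close> is positive because \<theta> is, and
      \<open>s1^2 - s2^2 = 2 * (cos \<theta>)^2\<close>.\<close>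
    define s1 s2 where "s1 = sqrt (1 + \<rho>)" and "s2 = sqrt (1 - \<rho> + 2 * \<kappa>)"
    have s: "0 < s2" "s2 \<le> s1" "s1\<^sup>2 = 1 + \<rho>" "s2\<^sup>2 = 1 - \<rho> + 2 * \<kappa>"
    proof -
      have "0 < 1 - \<rho> + 2 * \<kappa>" using \<kappa> \<rho> zero_le_power2[of "sin \<theta>"] by linarith
      moreover have "1 - \<rho> + 2 * \<kappa> \<le> 1 + \<rho>" using \<rho>_def zero_le_power2[of "cos \<theta>"] by linarith
      ultimately show "0 < s2" "s2 \<le> s1" "s1\<^sup>2 = 1 + \<rho>" "s2\<^sup>2 = 1 - \<rho> + 2 * \<kappa>"
        by (auto simp: s1_def s2_def)
    qed
    interpret Q: prob_space ?Q using Z by (rule gaussian_prob_space)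
    define m where "m k = (\<integral>z. ?q k (\<lambda>k. Z k z) \<partial>?Q)" for k
    have iq: "integrable ?Q (\<lambda>z. ?q k (\<lambda>k. Z k z))" if "k < ?d" for k
      by (rule gaussian_tame_integrable[OF Z tame_soft_weight[OF that]])
    let ?e = "\<lambda>k l z. soft_gap ?d \<beta> (\<lambda>_. c) (\<lambda>k. Z k z) * ?q k (\<lambda>k. Z k z) * ?q l (\<lambda>k. Z k z)"
    define e where "e k l = integral\<^sup>L ?Q (?e k l)" for k l
    have ie: "integrable ?Q (?e k l)" if "k < ?d" "l < ?d" for k l
      using gaussian_tame_integrable[OF Z tame_mult[OF tame_mult[OF tame_soft_gap[OF \<beta> d, of "\<lambda>_. c"] tame_soft_weight[OF that(1)]] tame_soft_weight[OF that(2)]], of \<beta> \<beta>] .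
    have e_sym: "e k l = e l k" for k l unfolding e_def by (simp add: mult_ac)
    have H: "D k l * (\<integral>z. gap_energy_hess ?d \<beta> (\<lambda>_. c) k l (\<lambda>k. Z k z) \<partial>?Q)
      = - 2 * \<beta> * (D k l * e k l) - 2 * c * (D k l * m l) - 2 * c * (D k l * m k) + 2 * c\<^sup>2 * D k l"
      if "k < ?d" "l < ?d" for k l
    proof (cases "l = k")
      case True then show ?thesis by (simp add: D_eq)
    next
      case False
      have "(\<integral>z. gap_energy_hess ?d \<beta> (\<lambda>_. c) k l (\<lambda>k. Z k z) \<partial>?Q) = - 2 * \<beta> * e k l - 2 * c * m l - 2 * c * m k + 2 * c\<^sup>2"
        unfolding gap_energy_hess_off_diagonal[OF \<beta> False] e_def m_def
        using that iq ie by (simp add: Q.prob_space power2_eq_square)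
      then show ?thesis by (simp only:) (simp add: algebra_simps)
    qed
    have row: "(\<Sum>k<?d. \<Sum>l<?d. D k l * m k) = 0" "(\<Sum>k<?d. \<Sum>l<?d. D k l) = 0"
      using D_row by (simp_all add: sum_distrib_right[symmetric])
    have col: "(\<Sum>k<?d. \<Sum>l<?d. D k l * m l) = 0"
      by (subst sum.swap) (use row(1) in \<open>simp add: D_sym\<close>)
    have sumH: "(\<Sum>k<?d. \<Sum>l<?d. D k l * (\<integral>z. gap_energy_hess ?d \<beta> (\<lambda>_. c) k l (\<lambda>k. Z k z) \<partial>?Q)) = - 2 * \<beta> * (\<Sum>k<?d. \<Sum>l<?d. D k l * e k l)"
    proof -
      have "(\<Sum>k<?d. \<Sum>l<?d. D k l * (\<integral>z. gap_energy_hess ?d \<beta> (\<lambda>_. c) k l (\<lambda>k. Z k z) \<partial>?Q))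
        = (\<Sum>k<?d. \<Sum>l<?d. - 2 * \<beta> * (D k l * e k l) - 2 * c * (D k l * m l) - 2 * c * (D k l * m k) + 2 * c\<^sup>2 * D k l)"
        by (intro sum.cong refl H) auto
      also have "\<dots> = - 2 * \<beta> * (\<Sum>k<?d. \<Sum>l<?d. D k l * e k l) - 2 * c * (\<Sum>k<?d. \<Sum>l<?d. D k l * m l)
          - 2 * c * (\<Sum>k<?d. \<Sum>l<?d. D k l * m k) + 2 * c\<^sup>2 * (\<Sum>k<?d. \<Sum>l<?d. D k l)"
        by (simp only: sum.distrib sum_subtractf sum_distrib_left[symmetric])
      finally show ?thesis unfolding row col by simp
    qed
    \<comment> \<open>The four-index inequality with the product of weight differences multiplied
      out; the negative terms are the two within-pair products.\<close>
    have exchange: "0 \<le> e u w - e u (partner u) - e (partner w) w + e (partner u) (partner w)"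
      if "u < ?d" "w < ?d" "w \<noteq> u" "w \<noteq> partner u" for u w
    proof -
      interpret four_indices ?d u "partner u" w "partner w"
        using that by unfold_locales (auto simp: partner_eq_iff)
      note that' = that(3,4)[symmetric] partner_eq_iff[of w u]
      have eig1: "(\<Sum>l<?d. C k l * v1 l) = s1\<^sup>2 * v1 k" for k
      proof -
        consider "k = u" | "k = partner u" | "k = w" | "k = partner w" | "k \<noteq> u" "k \<noteq> partner u" "k \<noteq> w" "k \<noteq> partner w" by blast
        then show ?thesis
          unfolding sum_v1 s using that that' partner_eq_iff[of k u] partner_eq_iff[of k w]
          by cases (simp_all add: C_def v_other add_divide_distrib diff_divide_distrib eq_commute[of _ "partner k"])
      qed
      have eig2: "(\<Sum>l<?d. C k l * v2 l) = s2\<^sup>2 * v2 k" for k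
      proof -
        consider "k = u" | "k = partner u" | "k = w" | "k = partner w" | "k \<noteq> u" "k \<noteq> partner u" "k \<noteq> w" "k \<noteq> partner w" by blast
        then show ?thesis
          unfolding sum_v2 s using that that' partner_eq_iff[of k u] partner_eq_iff[of k w]
          by cases (simp_all add: C_def v_other add_divide_distrib diff_divide_distrib eq_commute[of _ "partner k"])
      qed
      have "0 \<le> (\<integral>z. soft_gap ?d \<beta> (\<lambda>_. c) (\<lambda>k. Z k z) * (?q u (\<lambda>k. Z k z) - ?q (partner w) (\<lambda>k. Z k z))
          * (?q w (\<lambda>k. Z k z) - ?q (partner u) (\<lambda>k. Z k z)) \<partial>?Q)"
        by (rule soft_exchange_nonneg[OF Z C_sym eig1 eig2 s(1,2) \<beta> c])
      also have "\<dots> = (\<integral>z. ?e u w z - ?e u (partner u) z - ?e (partner w) w z + ?e (partner u) (partner w) z \<partial>?Q)"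
        by (simp add: algebra_simps)
      also have "\<dots> = e u w - e u (partner u) - e (partner w) w + e (partner u) (partner w)"
        unfolding e_def using less ie by simp
      finally show ?thesis .
    qed
    \<comment> \<open>Within-pair and cross-pair totals over ordered index pairs. Each within-pair
      term is met by \<open>d - 2\<close> indices from other pairs, whence the factor in the sums
      that follow.\<close>
    define U where "U = (\<Sum>k<?d. e k (partner k))"
    define T where "T = (\<Sum>k<?d. \<Sum>l<?d. if l = k \<or> l = partner k then 0 else e k l)"
    have 1: "(\<Sum>k<?d. \<Sum>l<?d. if l = k \<or> l = partner k then 0 else e k (partner k)) = (real ?d - 2) * U"
      unfolding U_def sum_distrib_left by (intro sum.cong refl) (subst sum_off_pair; simp add: algebra_simps)
    have 2: "(\<Sum>k<?d. \<Sum>l<?d. if l = k \<or> l = partner k then 0 else e (partner l) l) = (real ?d - 2) * U"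
    proof -
      have "(\<Sum>k<?d. \<Sum>l<?d. if l = k \<or> l = partner k then 0 else e (partner l) l) = (\<Sum>l<?d. \<Sum>k<?d. if k = l \<or> k = partner l then 0 else e l (partner l))"
        by (subst sum.swap) (intro sum.cong refl, auto simp: e_sym)
      then show ?thesis unfolding 1 .
    qed
    have 3: "(\<Sum>k<?d. \<Sum>l<?d. if l = k \<or> l = partner k then 0 else e (partner k) (partner l)) = T"
    proof -
      have "T = (\<Sum>k<?d. \<Sum>l<?d. if l = partner k \<or> l = partner (partner k) then 0 else e (partner k) l)"
        unfolding T_def by (rule sum_partner[symmetric])
      also have "\<dots> = (\<Sum>k<?d. \<Sum>l<?d. if partner l = partner k \<or> partner l = partner (partner k) then 0 else e (partner k) (partner l))"
        by (intro sum.cong refl sum_partner[symmetric])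
      also have "\<dots> = (\<Sum>k<?d. \<Sum>l<?d. if l = k \<or> l = partner k then 0 else e (partner k) (partner l))"
        by (intro sum.cong refl if_cong) (metis partner_partner)+
      finally show ?thesis by simp
    qed
    have "0 \<le> (\<Sum>k<?d. \<Sum>l<?d. if l = k \<or> l = partner k then 0 else e k l - e k (partner k) - e (partner l) l + e (partner k) (partner l))"
      by (intro sum_nonneg) (use exchange in auto)
    also have "\<dots> = (\<Sum>k<?d. \<Sum>l<?d. (if l = k \<or> l = partner k then 0 else e k l) - (if l = k \<or> l = partner k then 0 else e k (partner k))
        - (if l = k \<or> l = partner k then 0 else e (partner l) l) + (if l = k \<or> l = partner k then 0 else e (partner k) (partner l)))"
      by (intro sum.cong refl) auto
    also have "\<dots> = 2 * (T - (real ?d - 2) * U)"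
      unfolding sum.distrib sum_subtractf 1 2 3 T_def[symmetric] by simp
    finally have TU: "(real ?d - 2) * U \<le> T" by simp
    have "(\<Sum>k<?d. \<Sum>l<?d. D k l * e k l) = (\<Sum>k<?d. \<Sum>l<?d. (1 - \<delta>) * (if l = partner k then e k l else 0) - \<delta> * (if l = k \<or> l = partner k then 0 else e k l))"
      unfolding D_eq by (intro sum.cong refl) (auto simp: algebra_simps)
    also have "\<dots> = (1 - \<delta>) * U - \<delta> * T"
      unfolding sum_subtractf sum_distrib_left[symmetric] T_def[symmetric] by (simp add: U_def)
    also have "\<dots> = \<delta> * ((real ?d - 2) * U - T)" unfolding \<delta>(2) by (simp add: algebra_simps)
    also have "\<dots> \<le> 0" using TU \<delta>(1) by (intro mult_nonneg_nonpos) auto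
    finally have "(\<Sum>k<?d. \<Sum>l<?d. D k l * e k l) \<le> 0" .
    then have "0 \<le> - 2 * \<beta> * (\<Sum>k<?d. \<Sum>l<?d. D k l * e k l)" using \<beta> by (intro mult_nonpos_nonpos) auto
    then show "0 \<le> (\<Sum>k<?d. \<Sum>l<?d. (simplex_corr ?d k l - pair_corr (\<lambda>_. - 1) k l) * (\<integral>z. gap_energy_hess ?d \<beta> (\<lambda>_. c) k l (\<lambda>k. Z k z) \<partial>?Q))"
      unfolding D_def[symmetric] sumH .
  qed (auto simp: simplex_corr_def)
  then show ?thesis by (simp add: c_def)
qed

section \<open>Centered Gaussian vectors and projections\<close>

lemma std_normal_integrable_square: "integrable std_normal_distribution (\<lambda>t. t\<^sup>2)"
  unfolding power2_eq_square
proof (rule Bochner_Integration.integrable_bound)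
  show "integrable std_normal_distribution (\<lambda>t. exp (2 * \<bar>t\<bar>))" by (rule std_normal_integrable_exp_abs)
  have "t * t \<le> exp (2 * \<bar>t\<bar>)" for t :: real
  proof -
    have "\<bar>t\<bar> * \<bar>t\<bar> \<le> exp \<bar>t\<bar> * exp \<bar>t\<bar>"
      using exp_ge_add_one_self[of "\<bar>t\<bar>"] by (intro mult_mono) linarith+
    then show ?thesis by (simp add: exp_add[symmetric] abs_mult[symmetric])
  qed
  then show "AE t in std_normal_distribution. norm (t * t) \<le> norm (exp (2 * \<bar>t\<bar>))" by simp
qed simp

lemma std_normal_mean: "(\<integral>t. t \<partial>std_normal_distribution) = 0"
  and std_normal_second_moment: "(\<integral>t. t\<^sup>2 \<partial>std_normal_distribution) = 1"
proof -
  interpret prob_space std_normal_distribution by (rule prob_space_std_normal)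
  have "(\<integral>t. t * 1 \<partial>std_normal_distribution) = (\<integral>t. 0 \<partial>std_normal_distribution)"
    by (rule std_normal_integration_by_parts[where B = 1 and D = 1]) auto
  then show "(\<integral>t. t \<partial>std_normal_distribution) = 0" by simp
  have "\<bar>t\<bar> \<le> exp \<bar>t\<bar>" for t :: real using exp_ge_add_one_self[of "\<bar>t\<bar>"] by linarith
  then have "(\<integral>t. t * t \<partial>std_normal_distribution) = (\<integral>t. 1 \<partial>std_normal_distribution)"
    by (intro std_normal_integration_by_parts[where B = 1 and D = 1]) auto
  then show "(\<integral>t. t\<^sup>2 \<partial>std_normal_distribution) = 1" using prob_space by (simp add: power2_eq_square)
qed

text \<open>Turns the Dirac and the density case into one image law, so that degenerate combinations
  need no separate treatment afterwards.\<close>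

lemma centered_normal_measure_eq:
  assumes "0 \<le> s"
  shows "centered_normal_measure s = distr std_normal_distribution borel (\<lambda>t. s * t)"
proof (cases "s = 0")
  case True
  interpret prob_space std_normal_distribution by (rule prob_space_std_normal)
  have "distr std_normal_distribution borel (\<lambda>t. 0 :: real) = return borel 0"
    by (rule measure_eqI) (auto simp: emeasure_distr emeasure_space_1 indicator_def vimage_def prob_space[simplified] split: if_splits)
  then show ?thesis using True by (simp add: centered_normal_measure_def)
next
  case False
  then show ?thesis using std_normal_scale_distr[of s] assms by (simp add: centered_normal_measure_def)
qed

text \<open>The unspecified \<sigma> of the definition is identified through the second moment of
  the combination, which ties the definition to covariances.\<close>

lemma centered_gaussian_vector_lincomb:
  assumes M: "prob_space M" and X: "centered_gaussian_vector M d X"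
  defines "Y a \<equiv> (\<lambda>x. \<Sum>k<d. a k * X k x)"
  shows "integrable M (\<lambda>x. (Y a x)\<^sup>2)" "(\<integral>x. Y a x \<partial>M) = 0"
    "(CLINT x|M. iexp (Y a x)) = complex_of_real (exp (- (\<integral>x. (Y a x)\<^sup>2 \<partial>M) / 2))"
proof -
  let ?N = std_normal_distribution
  have mX[measurable]: "X k \<in> borel_measurable M" if "k < d" for k using X that by (simp add: centered_gaussian_vector_def)
  have mY[measurable]: "Y a \<in> borel_measurable M" unfolding Y_def by (intro borel_measurable_sum borel_measurable_times) auto
  obtain s where s: "0 \<le> s" "distr M borel (Y a) = distr ?N borel (\<lambda>t. s * t)"
    using X centered_normal_measure_eq unfolding centered_gaussian_vector_def Y_def by metis
  have "integrable (distr M borel (Y a)) (\<lambda>y. y\<^sup>2)"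
    unfolding s(2) using std_normal_integrable_square by (subst integrable_distr_eq) (auto simp: power_mult_distrib)
  then show "integrable M (\<lambda>x. (Y a x)\<^sup>2)" by (subst (asm) integrable_distr_eq) auto
  have tr: "(\<integral>x. f (Y a x) \<partial>M) = (\<integral>t. f (s * t) \<partial>?N)" if [measurable]: "f \<in> borel_measurable borel"
    for f :: "real \<Rightarrow> 'b::{banach, second_countable_topology}"
  proof -
    have "(\<integral>x. f (Y a x) \<partial>M) = (\<integral>y. f y \<partial>distr M borel (Y a))" by (subst integral_distr) auto
    also have "\<dots> = (\<integral>t. f (s * t) \<partial>?N)" unfolding s(2) by (subst integral_distr) auto
    finally show ?thesis .
  qed
  show "(\<integral>x. Y a x \<partial>M) = 0" using tr[of "\<lambda>y. y"] std_normal_mean by simp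
  have sq: "(\<integral>x. (Y a x)\<^sup>2 \<partial>M) = s\<^sup>2" using tr[of "\<lambda>y. y\<^sup>2"] std_normal_second_moment by (simp add: power_mult_distrib)
  show "(CLINT x|M. iexp (Y a x)) = complex_of_real (exp (- (\<integral>x. (Y a x)\<^sup>2 \<partial>M) / 2))"
    unfolding sq using tr[of "\<lambda>y. iexp y"] std_normal_char[of s] by simp
qed

lemma centered_gaussian_vector_component:
  assumes M: "prob_space M" and X: "centered_gaussian_vector M d X" and k: "k < d"
  shows "X k \<in> borel_measurable M" "integrable M (\<lambda>x. (X k x)\<^sup>2)" "(\<integral>x. X k x \<partial>M) = 0"
proof -
  have "(\<Sum>l<d. (if l = k then 1 else 0) * f l) = f k" for f :: "nat \<Rightarrow> real"
    using k by (simp add: if_distrib[where f = "\<lambda>a. a * _"] cong: if_cong)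
  then show "integrable M (\<lambda>x. (X k x)\<^sup>2)" "(\<integral>x. X k x \<partial>M) = 0"
    using centered_gaussian_vector_lincomb[OF M X, of "\<lambda>l. if l = k then 1 else 0"] by simp_all
  show "X k \<in> borel_measurable M" using X k by (simp add: centered_gaussian_vector_def)
qed

section \<open>Projections and a finite-dimensional span\<close>

lemma L2_add: "f \<in> L2 M \<Longrightarrow> g \<in> L2 M \<Longrightarrow> (\<lambda>x. f x + g x) \<in> L2 M"
  using integrable_mult_L2[of f M g] by (auto simp: L2_def power2_sum mult.assoc)

lemma L2_cmult: "f \<in> L2 M \<Longrightarrow> (\<lambda>x. c * f x) \<in> L2 M"
  by (auto simp: L2_def power_mult_distrib)

lemma L2_diff: "f \<in> L2 M \<Longrightarrow> g \<in> L2 M \<Longrightarrow> (\<lambda>x. f x - g x) \<in> L2 M"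
  using L2_add[of f M "\<lambda>x. -1 * g x"] L2_cmult[of g M "-1"] by simp

lemma L2_sum: "(\<And>k. k \<in> I \<Longrightarrow> f k \<in> L2 M) \<Longrightarrow> (\<lambda>x. \<Sum>k\<in>I. f k x) \<in> L2 M"
  by (induction I rule: infinite_finite_induct) (auto intro: L2_add, auto simp: L2_def)

lemma L2_lincomb: "(\<And>k. k < d \<Longrightarrow> X k \<in> L2 M) \<Longrightarrow> (\<lambda>x. \<Sum>k<d. a k * X k x) \<in> L2 M"
  by (intro L2_sum L2_cmult) auto

lemma integral_mult_L2_lincomb:
  assumes G: "G \<in> L2 M" and X: "\<And>k. k < d \<Longrightarrow> X k \<in> L2 M"
  shows "(\<integral>x. G x * (\<Sum>k<d. a k * X k x) \<partial>M) = (\<Sum>k<d. a k * (\<integral>x. G x * X k x \<partial>M))"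
proof -
  have "(\<integral>x. G x * (\<Sum>k<d. a k * X k x) \<partial>M) = (\<integral>x. (\<Sum>k<d. a k * (G x * X k x)) \<partial>M)"
    by (simp add: sum_distrib_left mult_ac)
  also have "\<dots> = (\<Sum>k<d. a k * (\<integral>x. G x * X k x \<partial>M))"
    using integrable_mult_L2[OF G X] by (subst Bochner_Integration.integral_sum) auto
  finally show ?thesis .
qed

text \<open>Gram-Schmidt by induction on the number of components. These may be linearly dependent,
  as for a singular covariance, so the coefficients exist without being unique.\<close>

lemma L2_span_residual_exists:
  fixes d :: nat
  assumes "F \<in> L2 M" "\<And>k. k < d \<Longrightarrow> X k \<in> L2 M"
  shows "\<exists>a. \<forall>j<d. (\<integral>x. (F x - (\<Sum>k<d. a k * X k x)) * X j x \<partial>M) = 0"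
  using assms
proof (induction d arbitrary: F)
  case (Suc d)
  have X: "X k \<in> L2 M" if "k < d" for k using Suc.prems that by simp
  have Xd: "X d \<in> L2 M" using Suc.prems by simp
  obtain a where a: "\<And>j. j < d \<Longrightarrow> (\<integral>x. (F x - (\<Sum>k<d. a k * X k x)) * X j x \<partial>M) = 0"
    using Suc.IH[OF Suc.prems(1) X] by blast
  obtain c where c: "\<And>j. j < d \<Longrightarrow> (\<integral>x. (X d x - (\<Sum>k<d. c k * X k x)) * X j x \<partial>M) = 0"
    using Suc.IH[OF Xd X] by blast
  define G where "G x = F x - (\<Sum>k<d. a k * X k x)" for x
  define Y where "Y x = X d x - (\<Sum>k<d. c k * X k x)" for x
  have G: "G \<in> L2 M" and Y: "Y \<in> L2 M"
    unfolding G_def Y_def using Suc.prems(1) Xd X by (auto intro!: L2_diff L2_lincomb)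
  define s r where "s = (\<integral>x. Y x * Y x \<partial>M)" and "r = (\<integral>x. G x * Y x \<partial>M)"
  \<comment> \<open>If the new residual \<open>Y\<close> vanishes almost everywhere, then
    \<open>r = 0\<close> as well and any coefficient would do; 0 is chosen.\<close>
  define q where "q = (if s = 0 then 0 else r / s)"
  have q: "r = q * s"
  proof (cases "s = 0")
    case True
    have "AE x in M. Y x * Y x = 0"
      using True integral_nonneg_eq_0_iff_AE[OF integrable_mult_L2[OF Y Y]] by (simp add: s_def)
    then have "AE x in M. G x * Y x = 0" by eventually_elim simp
    then have "r = 0" unfolding r_def using integral_cong_AE[of "\<lambda>x. G x * Y x" M "\<lambda>_. 0"] integrable_mult_L2[OF G Y] by simp
    then show ?thesis using True by simp
  qed (simp add: q_def)
  have iGj: "(\<integral>x. (G x - q * Y x) * X j x \<partial>M) = (\<integral>x. G x * X j x \<partial>M) - q * (\<integral>x. Y x * X j x \<partial>M)" if "X j \<in> L2 M" for j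
    using integrable_mult_L2[OF G that] integrable_mult_L2[OF Y that] by (simp add: left_diff_distrib mult.assoc)
  have orth': "(\<integral>x. (G x - q * Y x) * X j x \<partial>M) = 0" if "j < d" for j
    unfolding iGj[OF X[OF that]] using a[OF that] c[OF that] by (simp add: G_def Y_def)
  have orth: "(\<integral>x. (G x - q * Y x) * X j x \<partial>M) = 0" if "j < Suc d" for j
  proof (cases "j = d")
    case False
    then show ?thesis using that orth' by simp
  next
    case True
    have "(\<integral>x. (G x - q * Y x) * (Y x + (\<Sum>k<d. c k * X k x)) \<partial>M)
       = (\<integral>x. (G x - q * Y x) * Y x \<partial>M) + (\<integral>x. (G x - q * Y x) * (\<Sum>k<d. c k * X k x) \<partial>M)"
      unfolding distrib_left
      by (intro Bochner_Integration.integral_add integrable_mult_L2 L2_diff L2_cmult L2_lincomb G Y X)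
    also have "(\<integral>x. (G x - q * Y x) * Y x \<partial>M) = r - q * s"
      unfolding r_def s_def using integrable_mult_L2[OF G Y] integrable_mult_L2[OF Y Y] by (simp add: left_diff_distrib mult.assoc)
    also have "(\<integral>x. (G x - q * Y x) * (\<Sum>k<d. c k * X k x) \<partial>M) = 0"
      by (subst integral_mult_L2_lincomb[OF L2_diff[OF G L2_cmult[OF Y]] X]) (auto simp: orth')
    finally show ?thesis using True q by (simp add: Y_def)
  qed
  have "G x - q * Y x = F x - (\<Sum>k<Suc d. (if k = d then q else a k - q * c k) * X k x)" for x
    by (simp add: G_def Y_def left_diff_distrib sum_subtractf sum_distrib_left right_diff_distrib mult.assoc)
  with orth show ?case by (intro exI[of _ "\<lambda>k. if k = d then q else a k - q * c k"]) simp
qed simp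

text \<open>\<open>L2_proj\<close> selects some solution, so agreement can be claimed almost
  everywhere only. It follows from uniqueness: for two solutions all four pairings of
  \<open>F - A\<close> with \<open>B\<close> vanish, hence so does their squared distance.\<close>

lemma L2_proj_complement_span:
  assumes F: "F \<in> L2 M" and X: "\<And>k. k < d \<Longrightarrow> X k \<in> L2 M"
    and orth: "\<And>j. j < d \<Longrightarrow> (\<integral>x. (F x - (\<Sum>k<d. a k * X k x)) * X j x \<partial>M) = 0"
  shows "L2_proj M (L2_complement M (gaussian_span d X)) F \<in> borel_measurable M"
    "AE x in M. L2_proj M (L2_complement M (gaussian_span d X)) F x = F x - (\<Sum>k<d. a k * X k x)"
proof -
  let ?K = "L2_complement M (gaussian_span d X)"
  define P where "P G \<longleftrightarrow> G \<in> ?K \<and> (\<lambda>x. F x - G x) \<in> L2_complement M ?K" for G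
  define G0 where "G0 x = F x - (\<Sum>k<d. a k * X k x)" for x
  have L: "(\<lambda>x. \<Sum>k<d. a k * X k x) \<in> L2 M" using X by (rule L2_lincomb)
  have G0: "G0 \<in> L2 M" unfolding G0_def using F L by (rule L2_diff)
  have P0: "P G0"
    unfolding P_def
  proof
    show "G0 \<in> ?K"
      using orth by (auto simp: L2_complement_def G0 gaussian_span_def integral_mult_L2_lincomb[OF G0 X] G0_def[symmetric])
    show "(\<lambda>x. F x - G0 x) \<in> L2_complement M ?K"
      using L by (auto simp: L2_complement_def G0_def gaussian_span_def mult.commute)
  qed
  have "P (L2_proj M ?K F)" unfolding L2_proj_def P_def[symmetric] by (rule someI[of P, OF P0])
  then obtain G where GP: "L2_proj M ?K F = G" and G: "P G" by blast
  have GL: "G \<in> L2 M" using G by (simp add: P_def L2_complement_def)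
  then show "L2_proj M ?K F \<in> borel_measurable M" unfolding GP by (simp add: L2_def)
  have z: "(\<integral>x. (F x - A x) * B x \<partial>M) = 0" if "P A" "P B" for A B
    using that by (auto simp: P_def L2_complement_def)
  have D: "(\<lambda>x. G x - G0 x) \<in> L2 M" using GL G0 by (rule L2_diff)
  have i: "integrable M (\<lambda>x. (F x - A x) * B x)" if "P A" "P B" for A B
    using that F by (intro integrable_mult_L2 L2_diff) (auto simp: P_def L2_complement_def)
  have "(\<integral>x. (G x - G0 x) * (G x - G0 x) \<partial>M)
     = (\<integral>x. (F x - G0 x) * G x - (F x - G0 x) * G0 x - ((F x - G x) * G x - (F x - G x) * G0 x) \<partial>M)"
    by (simp add: algebra_simps)
  also have "\<dots> = 0" using i z G P0 by simp
  finally have "AE x in M. (G x - G0 x) * (G x - G0 x) = 0"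
    using integral_nonneg_eq_0_iff_AE[OF integrable_mult_L2[OF D D]] by simp
  then show "AE x in M. L2_proj M ?K F x = F x - (\<Sum>k<d. a k * X k x)"
    unfolding GP by (auto simp: G0_def)
qed

text \<open>Bridge from the matrix of the theorem to \<open>pair_corr\<close>; peeling off the first
  block shifts indices by 2 and block numbers by 1.\<close>

lemma diag_block_mat_corr_block:
  assumes "k < 2 * length bs" "l < 2 * length bs"
  shows "diag_block_mat (map corr_block bs) $$ (k, l) = (if k = l then 1 else if k div 2 = l div 2 then bs ! (k div 2) else 0)"
    and "dim_row (diag_block_mat (map corr_block bs)) = 2 * length bs" "dim_col (diag_block_mat (map corr_block bs)) = 2 * length bs"
proof -
  have dim: "dim_row (corr_block c) = 2" "dim_col (corr_block c) = 2" for c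
    by (simp_all add: corr_block_def mat_of_rows_list_def)
  have dims: "dim_row (diag_block_mat (map corr_block cs)) = 2 * length cs" "dim_col (diag_block_mat (map corr_block cs)) = 2 * length cs" for cs
    by (induction cs) (simp_all add: Let_def dim)
  then show "dim_row (diag_block_mat (map corr_block bs)) = 2 * length bs" "dim_col (diag_block_mat (map corr_block bs)) = 2 * length bs" by auto
  have entry: "corr_block c $$ (i, j) = (if i = j then 1 else c)" if "i < 2" "j < 2" for c i j
    using that by (auto simp: corr_block_def mat_of_rows_list_def less_2_cases_iff)
  show "diag_block_mat (map corr_block bs) $$ (k, l) = (if k = l then 1 else if k div 2 = l div 2 then bs ! (k div 2) else 0)"
    using assms
  proof (induction bs arbitrary: k l)
    case (Cons c cs)
    have half: "k div 2 = 0 \<longleftrightarrow> k < 2" "\<not> k < 2 \<Longrightarrow> k div 2 = Suc ((k - 2) div 2)" for k :: nat by auto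
    show ?case
    proof (cases "k < 2 \<or> l < 2")
      case True
      then show ?thesis using Cons.prems half
        by (auto simp: Let_def dims dim entry)
    next
      case False
      then have "k - 2 < 2 * length cs" "l - 2 < 2 * length cs" using Cons.prems by auto
      from Cons.IH[OF this] False Cons.prems show ?thesis
        by (auto simp: Let_def dims dim half)
    qed
  qed simp
qed

lemma centered_gaussian_vector_law:
  assumes M: "prob_space M" and X: "centered_gaussian_vector M d X"
  shows "has_gaussian_law M d X (\<lambda>k l. \<integral>x. X k x * X l x \<partial>M)"
  unfolding has_gaussian_law_def
proof (intro conjI allI impI)
  note c = centered_gaussian_vector_component[OF M X]
  have L: "X k \<in> L2 M" if "k < d" for k using c[OF that] by (simp add: L2_def)
  show "X k \<in> borel_measurable M" if "k < d" for k using c[OF that] by simp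
  fix a :: "nat \<Rightarrow> real"
  have "(\<integral>x. (\<Sum>k<d. a k * X k x)\<^sup>2 \<partial>M) = (\<integral>x. (\<Sum>l<d. a l * X l x) * (\<Sum>k<d. a k * X k x) \<partial>M)"
    by (simp add: power2_eq_square)
  also have "\<dots> = (\<Sum>k<d. a k * (\<integral>x. X k x * (\<Sum>l<d. a l * X l x) \<partial>M))"
    by (subst integral_mult_L2_lincomb[OF L2_lincomb[OF L] L]) (simp_all add: mult.commute)
  also have "\<dots> = (\<Sum>k<d. a k * (\<Sum>l<d. a l * (\<integral>x. X k x * X l x \<partial>M)))"
    by (intro sum.cong refl arg_cong2[where f = "(*)"] integral_mult_L2_lincomb L) auto
  also have "\<dots> = (\<Sum>k<d. \<Sum>l<d. a k * a l * (\<integral>x. X k x * X l x \<partial>M))"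
    by (simp add: sum_distrib_left mult_ac)
  finally show "(CLINT x|M. iexp (\<Sum>k<d. a k * X k x)) =
      complex_of_real (exp (- (\<Sum>k<d. \<Sum>l<d. a k * a l * (\<integral>x. X k x * X l x \<partial>M)) / 2))"
    using centered_gaussian_vector_lincomb(3)[OF M X, of a] by simp
qed (rule M)

text \<open>Constants are orthogonal to the centered components, so the shift \<open>c\<close> does
  not move the minimizer; the rest is Pythagoras.\<close>

lemma integral_residual_power2_le:
  assumes M: "prob_space M" and F: "F \<in> L2 M" and X: "\<And>k. k < d \<Longrightarrow> X k \<in> L2 M" and EX: "\<And>k. k < d \<Longrightarrow> (\<integral>x. X k x \<partial>M) = 0"
    and orth: "\<And>j. j < d \<Longrightarrow> (\<integral>x. (F x - (\<Sum>k<d. a k * X k x)) * X j x \<partial>M) = 0"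
  shows "(\<integral>x. (F x - (\<Sum>k<d. a k * X k x) + c)\<^sup>2 \<partial>M) \<le> (\<integral>x. (F x - (\<Sum>k<d. b k * X k x) + c)\<^sup>2 \<partial>M)"
proof -
  interpret prob_space M by fact
  define G where "G x = F x - (\<Sum>k<d. a k * X k x) + c" for x
  define L where "L x = (\<Sum>k<d. (a k - b k) * X k x)" for x
  have cL: "(\<lambda>_. u) \<in> L2 M" for u by (auto simp: L2_def)
  have R: "(\<lambda>x. F x - (\<Sum>k<d. a k * X k x)) \<in> L2 M" by (intro L2_diff F L2_lincomb X)
  have G: "G \<in> L2 M" unfolding G_def by (rule L2_add[OF R cL])
  have L: "L \<in> L2 M" unfolding L_def by (rule L2_lincomb[OF X])
  have GX: "(\<integral>x. G x * X k x \<partial>M) = 0" if "k < d" for k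
    unfolding G_def using integrable_mult_L2[OF R X[OF that]] integrable_mult_L2[OF cL[of c] X[OF that]] orth[OF that] EX[OF that]
    by (simp add: distrib_right)
  have GL: "(\<integral>x. G x * L x \<partial>M) = 0"
    unfolding L_def by (simp add: integral_mult_L2_lincomb[OF G X] GX)
  have "F x - (\<Sum>k<d. b k * X k x) + c = G x + L x" for x
    by (simp add: G_def L_def left_diff_distrib sum_subtractf)
  then have "(\<integral>x. (F x - (\<Sum>k<d. b k * X k x) + c)\<^sup>2 \<partial>M) = (\<integral>x. (G x)\<^sup>2 + (L x)\<^sup>2 + 2 * (G x * L x) \<partial>M)"
    by (simp add: power2_sum mult.assoc)
  also have "\<dots> = (\<integral>x. (G x)\<^sup>2 \<partial>M) + (\<integral>x. (L x)\<^sup>2 \<partial>M)"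
    using G L integrable_mult_L2[OF G L] GL by (simp add: L2_def)
  finally show ?thesis by (simp add: G_def)
qed

section \<open>The maximum, and symmetric functions of the simplex vector\<close>

lemma continuous_on_Max_finite:
  fixes f :: "'i \<Rightarrow> 'a::topological_space \<Rightarrow> real"
  assumes "finite I" "I \<noteq> {}" "\<And>i. i \<in> I \<Longrightarrow> continuous_on S (f i)"
  shows "continuous_on S (\<lambda>x. Max ((\<lambda>i. f i x) ` I))"
  using assms
proof (induction I rule: finite_ne_induct)
  case (insert i I)
  then show ?case by (simp add: continuous_on_max)
qed simp

lemma tame_Max:
  assumes "0 < d" shows "tame d (\<lambda>x. Max (x ` {..<d}))"
proof (rule tame_linear_boundI)
  show "continuous_on UNIV (\<lambda>x::nat \<Rightarrow> real. Max (x ` {..<d}))"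
    using assms by (intro continuous_on_Max_finite) auto
  show "Max (x ` {..<d}) = Max (y ` {..<d})" if "\<And>k. k < d \<Longrightarrow> x k = y k" for x y :: "nat \<Rightarrow> real"
    using that by (intro arg_cong[where f = Max] image_cong) auto
  show "\<bar>Max (x ` {..<d})\<bar> \<le> 0 + (\<Sum>k<d. \<bar>x k\<bar>)" for x :: "nat \<Rightarrow> real"
  proof -
    have "Max (x ` {..<d}) \<in> x ` {..<d}" using assms by (intro Max_in) auto
    then obtain k where "k < d" "Max (x ` {..<d}) = x k" by auto
    then show ?thesis by (auto intro!: member_le_sum)
  qed
qed simp

lemma Max_transpose:
  fixes x :: "nat \<Rightarrow> real"
  assumes "i < d" "j < d"
  shows "Max ((\<lambda>k. x (Transposition.transpose i j k)) ` {..<d}) = Max (x ` {..<d})"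
proof -
  have "Transposition.transpose i j ` {..<d} = {..<d}"
    using assms by (intro transpose_image_eq) auto
  moreover have "(\<lambda>k. x (Transposition.transpose i j k)) ` {..<d} = x ` Transposition.transpose i j ` {..<d}"
    by (simp add: image_image)
  ultimately show ?thesis by (simp only:)
qed

text \<open>By exchangeability \<open>F\<close> of the vector has the same inner product with every
  component, and these add up to its inner product with the sum, which is 0. So it is already
  orthogonal to the span and equals its projection almost everywhere.\<close>

lemma simplex_L2_proj:
  assumes S: "has_gaussian_law N d S (simplex_corr d)" and d: "1 < d"
    and S0: "AE x in N. (\<Sum>k<d. S k x) = 0" and F: "tame d F"
    and F_sym: "\<And>i j x. i < d \<Longrightarrow> j < d \<Longrightarrow> F (\<lambda>k. x (Transposition.transpose i j k)) = F x"
  shows "(\<integral>x. (L2_proj N (L2_complement N (gaussian_span d S)) (\<lambda>x. F (\<lambda>k. S k x)) x + c)\<^sup>2 \<partial>N)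
     = (\<integral>x. (F (\<lambda>k. S k x) + c)\<^sup>2 \<partial>N)"
proof -
  let ?P = "L2_proj N (L2_complement N (gaussian_span d S)) (\<lambda>x. F (\<lambda>k. S k x))"
  have eq: "(\<integral>x. F (\<lambda>k. S k x) * S i x \<partial>N) = (\<integral>x. F (\<lambda>k. S k x) * S j x \<partial>N)" if ij: "i < d" "j < d" for i j
  proof -
    let ?\<tau> = "Transposition.transpose i j"
    have "(\<integral>x. (\<lambda>y. F y * y i) (\<lambda>k. S (?\<tau> k) x) \<partial>N) = (\<integral>x. (\<lambda>y. F y * y i) (\<lambda>k. S k x) \<partial>N)"
      by (rule gaussian_involution_invariant[of N d S "simplex_corr d" ?\<tau>, OF S])
         (use ij F in \<open>auto simp: simplex_corr_def Transposition.transpose_def\<close>)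
    then show ?thesis using ij by (simp add: F_sym[OF ij, of "\<lambda>k. S k _"])
  qed
  have L: "S k \<in> L2 N" if "k < d" for k using gaussian_tame_L2[OF S tame_coord[OF that]] .
  have FL: "(\<lambda>x. F (\<lambda>k. S k x)) \<in> L2 N" by (rule gaussian_tame_L2[OF S F])
  have orth: "(\<integral>x. F (\<lambda>k. S k x) * S j x \<partial>N) = 0" if j: "j < d" for j
  proof -
    have "real d * (\<integral>x. F (\<lambda>k. S k x) * S j x \<partial>N) = (\<Sum>k<d. 1 * (\<integral>x. F (\<lambda>k. S k x) * S k x \<partial>N))"
    proof -
      have "(\<Sum>k<d. \<integral>x. F (\<lambda>k. S k x) * S k x \<partial>N) = (\<Sum>k<d. \<integral>x. F (\<lambda>k. S k x) * S j x \<partial>N)"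
        by (intro sum.cong refl eq) (use j in auto)
      then show ?thesis by simp
    qed
    also have "\<dots> = (\<integral>x. F (\<lambda>k. S k x) * (\<Sum>k<d. 1 * S k x) \<partial>N)"
      by (rule integral_mult_L2_lincomb[OF FL L, symmetric])
    also have "\<dots> = (\<integral>x. 0 \<partial>N)"
      by (rule integral_cong_AE)
         (use S0 tame_measurable[OF F gaussian_measurable[OF S]] gaussian_measurable[OF S] in \<open>auto intro!: borel_measurable_times borel_measurable_sum\<close>)
    finally show ?thesis using d by simp
  qed
  have [measurable]: "?P \<in> borel_measurable N"
    by (rule L2_proj_complement_span(1)[OF FL, of d S "\<lambda>_. 0"]) (use L orth in auto)
  have AE: "AE x in N. ?P x = F (\<lambda>k. S k x) - (\<Sum>k<d. 0 * S k x)"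
    by (rule L2_proj_complement_span(2)[OF FL]) (use L orth in auto)
  have [measurable]: "(\<lambda>x. F (\<lambda>k. S k x)) \<in> borel_measurable N"
    by (rule tame_measurable[OF F gaussian_measurable[OF S]])
  show ?thesis
    by (rule integral_cong_AE) (use AE in auto)
qed

section \<open>The comparison\<close>

text \<open>The coefficients \<open>b\<close> are an arbitrary competitor for the minimum. Later
  they are mean weights, which in the case of the maximum still depend on \<beta>.\<close>

lemma gaussian_L2_proj_le:
  assumes X: "has_gaussian_law M d X C" and EX: "\<And>k. k < d \<Longrightarrow> (\<integral>x. X k x \<partial>M) = 0" and F: "tame d F"
  shows "(\<integral>x. (L2_proj M (L2_complement M (gaussian_span d X)) (\<lambda>x. F (\<lambda>k. X k x)) x + c)\<^sup>2 \<partial>M)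
     \<le> (\<integral>x. (F (\<lambda>k. X k x) - (\<Sum>k<d. b k * X k x) + c)\<^sup>2 \<partial>M)"
proof -
  let ?P = "L2_proj M (L2_complement M (gaussian_span d X)) (\<lambda>x. F (\<lambda>k. X k x))"
  have L: "X k \<in> L2 M" if "k < d" for k using gaussian_tame_L2[OF X tame_coord[OF that]] .
  have FL: "(\<lambda>x. F (\<lambda>k. X k x)) \<in> L2 M" by (rule gaussian_tame_L2[OF X F])
  have "\<exists>a. \<forall>j<d. (\<integral>x. (F (\<lambda>k. X k x) - (\<Sum>k<d. a k * X k x)) * X j x \<partial>M) = 0"
    by (rule L2_span_residual_exists[OF FL]) (rule L)
  then obtain a where a: "\<And>j. j < d \<Longrightarrow> (\<integral>x. (F (\<lambda>k. X k x) - (\<Sum>k<d. a k * X k x)) * X j x \<partial>M) = 0"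
    by blast
  have m[measurable]: "?P \<in> borel_measurable M"
    by (rule L2_proj_complement_span(1)[OF FL _ a]) (use L in auto)
  have AE: "AE x in M. ?P x = F (\<lambda>k. X k x) - (\<Sum>k<d. a k * X k x)"
    by (rule L2_proj_complement_span(2)[OF FL _ a]) (use L in auto)
  have mF[measurable]: "(\<lambda>x. F (\<lambda>k. X k x)) \<in> borel_measurable M"
    by (rule tame_measurable[OF F gaussian_measurable[OF X]])
  have mL[measurable]: "(\<lambda>x. \<Sum>k<d. a k * X k x) \<in> borel_measurable M"
    using gaussian_measurable[OF X] by (intro borel_measurable_sum borel_measurable_times) auto
  have "(\<integral>x. (?P x + c)\<^sup>2 \<partial>M) = (\<integral>x. (F (\<lambda>k. X k x) - (\<Sum>k<d. a k * X k x) + c)\<^sup>2 \<partial>M)"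
    by (rule integral_cong_AE) (use AE in auto)
  also have "\<dots> \<le> (\<integral>x. (F (\<lambda>k. X k x) - (\<Sum>k<d. b k * X k x) + c)\<^sup>2 \<partial>M)"
    by (rule integral_residual_power2_le[OF gaussian_prob_space[OF X] FL L EX a])
  finally show ?thesis .
qed

lemma le_limit_inverse:
  fixes A B C D :: real
  assumes "\<And>\<beta>. 0 < \<beta> \<Longrightarrow> A \<le> B + C / \<beta> + D / \<beta>\<^sup>2"
  shows "A \<le> B"
proof (rule tendsto_lowerbound)
  show "((\<lambda>\<beta>. B + C / \<beta> + D / \<beta>\<^sup>2) \<longlongrightarrow> B) at_top" by real_asymp
  show "\<forall>\<^sub>F \<beta> in at_top. A \<le> B + C / \<beta> + D / \<beta>\<^sup>2"
    using eventually_gt_at_top[of 0] by eventually_elim (rule assms)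
qed simp

theorem theorem1p8:
  fixes n :: nat and b :: "nat \<Rightarrow> real"
    and M :: "'a measure" and X :: "nat \<Rightarrow> 'a \<Rightarrow> real"
    and N :: "'b measure" and S :: "nat \<Rightarrow> 'b \<Rightarrow> real"
  assumes "n \<ge> 1"
    and "\<And>i. i < n \<Longrightarrow> b i \<in> {-1..1}"
    and "prob_space M"
    and "centered_gaussian_vector M (2 * n) X"
    and "covariance_matrix M (2 * n) X = diag_block_mat (map (\<lambda>i. corr_block (b i)) [0..<n])"
    and "prob_space N"
    and "centered_gaussian_vector N (2 * n) S"
    and "\<And>i. i < 2 * n \<Longrightarrow> (\<integral>\<omega>. (S i \<omega>)\<^sup>2 \<partial>N) = 1"
    and "\<And>i j. i < 2 * n \<Longrightarrow> j < 2 * n \<Longrightarrow> i \<noteq> j \<Longrightarrow>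
           (\<integral>\<omega>. S i \<omega> * S j \<omega> \<partial>N) = - (1 / (2 * real n - 1))"
  shows "(\<forall>\<beta>>0.
            (\<integral>\<omega>. (L2_proj M (L2_complement M (gaussian_span (2 * n) X))
                     (\<lambda>\<omega>. soft_max (2 * n) \<beta> (\<lambda>k. X k \<omega>)) \<omega> + 1 / \<beta>)\<^sup>2 \<partial>M)
            \<le> (\<integral>\<omega>. (L2_proj N (L2_complement N (gaussian_span (2 * n) S))
                     (\<lambda>\<omega>. soft_max (2 * n) \<beta> (\<lambda>k. S k \<omega>)) \<omega> + 1 / \<beta>)\<^sup>2 \<partial>N))
       \<and> (\<integral>\<omega>. (L2_proj M (L2_complement M (gaussian_span (2 * n) X))
                  (\<lambda>\<omega>. Max ((\<lambda>i. X i \<omega>) ` {..<2 * n})) \<omega>)\<^sup>2 \<partial>M)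
         \<le> (\<integral>\<omega>. (L2_proj N (L2_complement N (gaussian_span (2 * n) S))
                  (\<lambda>\<omega>. Max ((\<lambda>i. S i \<omega>) ` {..<2 * n})) \<omega>)\<^sup>2 \<partial>N)"
proof -
  let ?d = "2 * n"
  have n: "0 < n" and d: "0 < ?d" using assms(1) by auto
  note M = assms(3) and N = assms(6)
  interpret M: prob_space M by fact
  interpret N: prob_space N by fact
  note cX = centered_gaussian_vector_component[OF M assms(4)] and cS = centered_gaussian_vector_component[OF N assms(7)]
  have X: "has_gaussian_law M ?d X (pair_corr b)"
  proof (rule gaussian_cong[OF centered_gaussian_vector_law[OF M assms(4)]])
    fix k l assume kl: "k < ?d" "l < ?d"
    then have "(\<integral>x. X k x * X l x \<partial>M) = covariance_matrix M ?d X $$ (k, l)"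
      by (simp add: covariance_matrix_def cX)
    also have "\<dots> = pair_corr b k l"
      using diag_block_mat_corr_block(1)[of k "map b [0..<n]" l] kl unfolding assms(5) by (simp add: comp_def pair_corr_def)
    finally show "(\<integral>x. X k x * X l x \<partial>M) = pair_corr b k l" .
  qed
  have S: "has_gaussian_law N ?d S (simplex_corr ?d)"
    by (rule gaussian_cong[OF centered_gaussian_vector_law[OF N assms(7)]])
       (use assms(8,9) in \<open>auto simp: simplex_corr_def power2_eq_square\<close>)
  have LS: "S k \<in> L2 N" if "k < ?d" for k using gaussian_tame_L2[OF S tame_coord[OF that]] .
  \<comment> \<open>The second moment of the sum is the total of the covariance entries, which is 0
    since every row sums to 0.\<close>
  have S0: "AE x in N. (\<Sum>k<?d. S k x) = 0"
  proof -
    have L: "(\<lambda>x. \<Sum>k<?d. 1 * S k x) \<in> L2 N" using LS by (rule L2_lincomb)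
    have SS: "(\<integral>x. S l x * S k x \<partial>N) = simplex_corr ?d k l" if "k < ?d" "l < ?d" for k l
      using assms(8)[of k] assms(9)[of l k] that by (auto simp: simplex_corr_def power2_eq_square)
    have "(\<integral>x. (\<Sum>k<?d. 1 * S k x) * (\<Sum>k<?d. 1 * S k x) \<partial>N) = (\<Sum>k<?d. \<Sum>l<?d. simplex_corr ?d k l)"
      by (subst integral_mult_L2_lincomb[OF L LS], assumption, subst mult.commute, intro sum.cong refl)
         (subst integral_mult_L2_lincomb[OF LS LS]; simp add: SS simplex_corr_sym[of ?d])
    also have "\<dots> = 0"
    proof -
      have "(\<Sum>l<?d. simplex_corr ?d k l) = 0" if "k < ?d" for k
      proof -
        have "(\<Sum>l<?d. simplex_corr ?d k l) = (\<Sum>l<?d. (if l = k then 1 + 1 / (real ?d - 1) else 0) - 1 / (real ?d - 1))"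
          by (intro sum.cong) (auto simp: simplex_corr_def)
        also have "\<dots> = 0"
        proof -
          have "real ?d - 1 \<noteq> 0" using n by linarith
          then have "1 + 1 / (real ?d - 1) = real ?d * (1 / (real ?d - 1))" by (simp add: field_simps)
          then show ?thesis using that unfolding sum_subtractf by simp
        qed
        finally show ?thesis .
      qed
      then show ?thesis by simp
    qed
    finally have "AE x in N. (\<Sum>k<?d. 1 * S k x) * (\<Sum>k<?d. 1 * S k x) = 0"
      using integral_nonneg_eq_0_iff_AE[OF integrable_mult_L2[OF L L]] by simp
    then show ?thesis by simp
  qed
  have b: "\<bar>b i\<bar> \<le> 1" if "i < n" for i using assms(2)[OF that] by (simp add: abs_le_iff)
  obtain W where W: "has_gaussian_law (Pi\<^sub>M {..<?d} (\<lambda>_. std_normal_distribution)) ?d W (pair_corr (\<lambda>_. -1))"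
    using gaussian_pair_exists[of n "\<lambda>_. -1"] by auto
  have energy: "gap_energy ?d \<beta> (mean_weight ?d \<beta> M X) M X \<le> (\<integral>x. (soft_max ?d \<beta> (\<lambda>k. S k x) + 1 / \<beta>)\<^sup>2 \<partial>N)"
    if \<beta>: "0 < \<beta>" for \<beta>
  proof -
    \<comment> \<open>Stage one ends at \<open>W\<close> with its mean weights, stage two starts
      there with uniform ones; minimality of the mean weights links the two.\<close>
    note gap_energy_antithetic_le[OF X W b \<beta> n]
    also note gap_energy_mean_weight_le[OF W pair_corr_sym _ \<beta> d, of "\<lambda>_. 1 / real ?d"]
    also note gap_energy_simplex_le[OF W S n \<beta>]
    also have "gap_energy ?d \<beta> (\<lambda>_. 1 / real ?d) N S = (\<integral>x. (soft_max ?d \<beta> (\<lambda>k. S k x) + 1 / \<beta>)\<^sup>2 \<partial>N)"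
      unfolding gap_energy_def
    proof (rule integral_cong_AE)
      show "AE x in N. (soft_gap ?d \<beta> (\<lambda>_. 1 / real ?d) (\<lambda>k. S k x) + 1 / \<beta>)\<^sup>2 = (soft_max ?d \<beta> (\<lambda>k. S k x) + 1 / \<beta>)\<^sup>2"
        using S0 by eventually_elim (simp add: soft_gap_def sum_divide_distrib[symmetric])
    qed (auto intro!: borel_measurable_power borel_measurable_add tame_measurable[OF tame_soft_gap[OF \<beta> d]]
          tame_measurable[OF tame_soft_max[OF \<beta> d]] gaussian_measurable[OF S])
    finally show ?thesis by simp
  qed
  have soft: "(\<integral>\<omega>. (L2_proj M (L2_complement M (gaussian_span ?d X)) (\<lambda>\<omega>. soft_max ?d \<beta> (\<lambda>k. X k \<omega>)) \<omega> + 1 / \<beta>)\<^sup>2 \<partial>M)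
      \<le> (\<integral>\<omega>. (L2_proj N (L2_complement N (gaussian_span ?d S)) (\<lambda>\<omega>. soft_max ?d \<beta> (\<lambda>k. S k \<omega>)) \<omega> + 1 / \<beta>)\<^sup>2 \<partial>N)"
    if \<beta>: "0 < \<beta>" for \<beta>
  proof -
    have "(\<integral>\<omega>. (L2_proj M (L2_complement M (gaussian_span ?d X)) (\<lambda>\<omega>. soft_max ?d \<beta> (\<lambda>k. X k \<omega>)) \<omega> + 1 / \<beta>)\<^sup>2 \<partial>M)
      \<le> gap_energy ?d \<beta> (mean_weight ?d \<beta> M X) M X"
      unfolding gap_energy_def soft_gap_def by (rule gaussian_L2_proj_le[OF X cX(3) tame_soft_max[OF \<beta> d]])
    also note energy[OF \<beta>]
    finally show ?thesis
      using simplex_L2_proj[OF S _ S0 tame_soft_max[OF \<beta> d] soft_max_transpose] n by simp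
  qed
  let ?max = "\<lambda>x. Max (x ` {..<?d})"
  have max_ge: "x k \<le> ?max x" if "k < ?d" for x :: "nat \<Rightarrow> real" and k using that by (intro Max_ge) auto
  have max_le: "?max x \<le> soft_max ?d \<beta> x" if "0 < \<beta>" for x \<beta>
    using d soft_max_ge[OF that] by (intro Max.boundedI) (auto simp: lessThan_empty_iff)
  \<comment> \<open>The limit is taken in the bound only: both sides here are free of \<beta>, and
    the errors are of order \<open>1 / \<beta>\<close> and \<open>1 / \<beta>^2\<close>.\<close>
  have "(\<integral>\<omega>. (L2_proj M (L2_complement M (gaussian_span ?d X)) (\<lambda>\<omega>. ?max (\<lambda>k. X k \<omega>)) \<omega> + 0)\<^sup>2 \<partial>M)
      \<le> (\<integral>\<omega>. (?max (\<lambda>k. S k \<omega>))\<^sup>2 \<partial>N)" (is "?A \<le> ?B")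
  proof (rule le_limit_inverse)
    fix \<beta> :: real assume \<beta>: "0 < \<beta>"
    define p where "p = mean_weight ?d \<beta> M X"
    have p: "0 \<le> p k" "(\<Sum>k<?d. p k) = 1" for k
      unfolding p_def using mean_weight_nonneg[OF d] sum_mean_weight[OF X d] by auto
    \<comment> \<open>\<open>ln d\<close> comes from comparing the soft maximum with the maximum, 1
      from the shift \<open>1 / \<beta>\<close>.\<close>
    define K where "K = ln (real ?d) + 1"
    have tp: "tame ?d (\<lambda>x. ?max x - (\<Sum>k<?d. p k * x k))"
      by (intro tame_diff tame_Max[OF d] tame_sum tame_mult tame_const tame_coord) auto
    have "?A \<le> (\<integral>\<omega>. (?max (\<lambda>k. X k \<omega>) - (\<Sum>k<?d. p k * X k \<omega>) + 0)\<^sup>2 \<partial>M)"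
      by (rule gaussian_L2_proj_le[OF X cX(3) tame_Max[OF d]])
    also have "\<dots> \<le> gap_energy ?d \<beta> p M X"
      unfolding gap_energy_def
    proof (rule integral_mono)
      show "integrable M (\<lambda>\<omega>. (?max (\<lambda>k. X k \<omega>) - (\<Sum>k<?d. p k * X k \<omega>) + 0)\<^sup>2)"
        using gaussian_tame_integrable[OF X tame_power2[OF tp]] by simp
      show "integrable M (\<lambda>\<omega>. (soft_gap ?d \<beta> p (\<lambda>k. X k \<omega>) + 1 / \<beta>)\<^sup>2)"
        by (rule gaussian_tame_integrable[OF X tame_gap_energy[OF \<beta> d]])
      fix \<omega>
      \<comment> \<open>Convex weights make the difference nonnegative, which is what allows
        squaring the comparison.\<close>
      have "(\<Sum>k<?d. p k * X k \<omega>) \<le> (\<Sum>k<?d. p k * ?max (\<lambda>k. X k \<omega>))"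
        using p max_ge[of _ "\<lambda>k. X k \<omega>"] by (intro sum_mono mult_left_mono) auto
      also have "\<dots> = ?max (\<lambda>k. X k \<omega>)" using p(2) by (simp add: sum_distrib_right[symmetric])
      finally show "(?max (\<lambda>k. X k \<omega>) - (\<Sum>k<?d. p k * X k \<omega>) + 0)\<^sup>2 \<le> (soft_gap ?d \<beta> p (\<lambda>k. X k \<omega>) + 1 / \<beta>)\<^sup>2"
        using max_le[OF \<beta>, of "\<lambda>k. X k \<omega>"] \<beta> by (intro power_mono) (simp_all add: soft_gap_def add_increasing2)
    qed
    also have "\<dots> \<le> (\<integral>x. (soft_max ?d \<beta> (\<lambda>k. S k x) + 1 / \<beta>)\<^sup>2 \<partial>N)" unfolding p_def by (rule energy[OF \<beta>])
    also have "\<dots> \<le> (\<integral>x. (?max (\<lambda>k. S k x) + K / \<beta>)\<^sup>2 \<partial>N)"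
    proof (rule integral_mono_AE)
      show "integrable N (\<lambda>x. (soft_max ?d \<beta> (\<lambda>k. S k x) + 1 / \<beta>)\<^sup>2)"
        by (rule gaussian_tame_integrable[OF S tame_power2[OF tame_add[OF tame_soft_max[OF \<beta> d] tame_const]]])
      show "integrable N (\<lambda>x. (?max (\<lambda>k. S k x) + K / \<beta>)\<^sup>2)"
        by (rule gaussian_tame_integrable[OF S tame_power2[OF tame_add[OF tame_Max[OF d] tame_const]]])
      show "AE x in N. (soft_max ?d \<beta> (\<lambda>k. S k x) + 1 / \<beta>)\<^sup>2 \<le> (?max (\<lambda>k. S k x) + K / \<beta>)\<^sup>2"
        using S0
      proof eventually_elim
        case (elim x)
        \<comment> \<open>Nonnegativity comes from the zero sum here: the gap with uniform weights
          is the soft maximum itself.\<close>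
        have "0 \<le> soft_gap ?d \<beta> (\<lambda>_. 1 / real ?d) (\<lambda>k. S k x)" using d by (intro soft_gap_nonneg[OF \<beta>]) auto
        then have "0 \<le> soft_max ?d \<beta> (\<lambda>k. S k x)" using elim by (simp add: soft_gap_def sum_divide_distrib[symmetric])
        moreover have "soft_max ?d \<beta> (\<lambda>k. S k x) \<le> ?max (\<lambda>k. S k x) + ln (real ?d) / \<beta>"
          by (rule soft_max_le[OF \<beta> d max_ge])
        ultimately show ?case using \<beta> by (intro power_mono) (simp_all add: K_def add_divide_distrib)
      qed
    qed
    also have "\<dots> = (\<integral>x. (?max (\<lambda>k. S k x))\<^sup>2 + (2 * K / \<beta>) * ?max (\<lambda>k. S k x) + K\<^sup>2 / \<beta>\<^sup>2 \<partial>N)"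
      by (simp add: power2_sum power_divide mult_ac add_ac)
    also have "\<dots> = ?B + (2 * K * (\<integral>x. ?max (\<lambda>k. S k x) \<partial>N)) / \<beta> + K\<^sup>2 / \<beta>\<^sup>2"
      using gaussian_tame_integrable[OF S tame_power2[OF tame_Max[OF d]]] gaussian_tame_integrable[OF S tame_Max[OF d]]
      by (simp add: N.prob_space)
    finally show "?A \<le> ?B + (2 * K * (\<integral>x. ?max (\<lambda>k. S k x) \<partial>N)) / \<beta> + K\<^sup>2 / \<beta>\<^sup>2" .
  qed
  also have "?B = (\<integral>\<omega>. (L2_proj N (L2_complement N (gaussian_span ?d S)) (\<lambda>\<omega>. ?max (\<lambda>k. S k \<omega>)) \<omega> + 0)\<^sup>2 \<partial>N)"
    using simplex_L2_proj[OF S _ S0 tame_Max[OF d] Max_transpose, of 0] n by simp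
  finally show ?thesis using soft by simp
qed

end
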